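(* Let $n\ge 2$ be an integer and let $d$ be a nonzero complex number with $|d|\neq 1$. For every effective transitive action of the unitary group $\mathrm{U}_n$ on the Hopf manifold $M_d^n$ by holomorphic transformations, there exist $p,r\in\mathbb{Z}$ with $r\neq 0$ and $C\in\mathrm{GL}_n(\mathbb{C})$ such that the action has either the form $$(\mathrm{I})\qquad A[z]=\left[e^{i(1+pn)t}\,d^{\frac{nrt}{2\pi}}\,CBC^{-1}z\right]$$ or the form $$(\mathrm{II})\qquad A[z]=\left[e^{i(-1+pn)t}\,d^{\frac{nrt}{2\pi}}\,C\overline{B}C^{-1}z\right]$$ for all $z\in\mathbb{C}^n\setminus\{0\}$ and all $A\in\mathrm{U}_n$, where $A$ is represented as $A=e^{it}\cdot B$ with $t\in\mathbb{R}$ and $B\in\mathrm{SU}_n$. Furthermore, for any $p,r\in\mathbb{Z}$ with $r\ne 0$ and any $C\in\mathrm{GL}_n(\mathbb{C})$: the action (I) is effective if and only if there does not exist $\ell\in\mathbb{Z}$ such that $r$ divides $\ell(1+pn)$ but does not divide $\ell p$; the action (II) is effective if and only if there does not exist $\ell\in\mathbb{Z}$ such that $r$ divides $\ell(-1+pn)$ but does not divide $\ell p$.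
   Context: For a nonzero complex number $d$ with $|d|\neq 1$, the $n$-dimensional Hopf manifold $M_d^n$ is the compact complex manifold obtained from $\mathbb{C}^n\setminus\{0\}$ by identifying every point $z$ with $d\cdot z$ (hence with $d^k\cdot z$ for all $k\in\mathbb{Z}$); $[z]\in M_d^n$ denotes the equivalence class of $z\in\mathbb{C}^n\setminus\{0\}$. For $\mu\in\mathbb{R}$ set $d^{\mu}:=|d|^{\mu}e^{i\mu\arg d}$, where $\arg$ takes values in $[0,2\pi)$. $\overline{B}$ denotes the entrywise complex conjugate of the matrix $B$. The representation $A=e^{it}\cdot B$ is not unique; the right-hand sides of the formulas do not depend on the choice of representation. An action of $\mathrm{U}_n$ on a complex manifold $X$ by holomorphic transformations is a (left) action such that each group element acts by a biholomorphic map of $X$ and the action map $\mathrm{U}_n\times X\to X$ is continuous. It is effective if only the identity element acts trivially. *)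

theory Defs
  imports "HOL-Analysis.Analysis" "HOL-Algebra.Group_Action"
begin

section \<open>Complex manifolds given by an atlas\<close>

text \<open>\<open>S\<close> is meant to be open.\<close>

definition vec_holomorphic_on :: "(complex^'n \<Rightarrow> complex^'m) \<Rightarrow> (complex^'n) set \<Rightarrow> bool"
    (infixl "vec'_holomorphic'_on" 50) where
  "f vec_holomorphic_on S \<longleftrightarrow>
     (\<forall>z\<in>S. \<exists>f'. (f has_derivative f') (at z) \<and> Vector_Spaces.linear (*s) (*s) f')"

text \<open>A chart is a pair of its domain and its coordinate map; the values of the coordinate map
  outside the domain are irrelevant.\<close>

type_synonym ('p, 'n) complex_chart = "'p set \<times> ('p \<Rightarrow> complex^'n)"

definition complex_atlas :: "'p topology \<Rightarrow> ('p, 'n::finite) complex_chart set \<Rightarrow> bool" where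
  "complex_atlas X \<A> \<longleftrightarrow>
     (\<Union>(V, \<phi>)\<in>\<A>. V) = topspace X \<and>
     (\<forall>(V, \<phi>)\<in>\<A>. openin X V \<and> open (\<phi> ` V) \<and>
        homeomorphic_map (subtopology X V) (top_of_set (\<phi> ` V)) \<phi>) \<and>
     (\<forall>(V, \<phi>)\<in>\<A>. \<forall>(W, \<psi>)\<in>\<A>. (\<psi> \<circ> inv_into V \<phi>) vec_holomorphic_on (\<phi> ` (V \<inter> W)))"

definition holomorphic_map ::
  "'p topology \<Rightarrow> ('p, 'n::finite) complex_chart set \<Rightarrow>
   'q topology \<Rightarrow> ('q, 'm::finite) complex_chart set \<Rightarrow> ('p \<Rightarrow> 'q) \<Rightarrow> bool" where
  "holomorphic_map X \<A> Y \<B> f \<longleftrightarrow>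
     continuous_map X Y f \<and>
     (\<forall>(V, \<phi>)\<in>\<A>. \<forall>(W, \<psi>)\<in>\<B>.
        (\<psi> \<circ> f \<circ> inv_into V \<phi>) vec_holomorphic_on (\<phi> ` {x\<in>V. f x \<in> W}))"

definition biholomorphic_map ::
  "'p topology \<Rightarrow> ('p, 'n::finite) complex_chart set \<Rightarrow>
   'q topology \<Rightarrow> ('q, 'm::finite) complex_chart set \<Rightarrow> ('p \<Rightarrow> 'q) \<Rightarrow> bool" where
  "biholomorphic_map X \<A> Y \<B> f \<longleftrightarrow>
     holomorphic_map X \<A> Y \<B> f \<and>
     (\<exists>g. holomorphic_map Y \<B> X \<A> g \<and>
        (\<forall>x\<in>topspace X. g (f x) = x) \<and> (\<forall>y\<in>topspace Y. f (g y) = y))"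


section \<open>The unitary group and its actions\<close>

abbreviation cnj_matrix :: "complex^'n^'m \<Rightarrow> complex^'n^'m" where
  "cnj_matrix \<equiv> map_matrix cnj"

definition unitary_matrix :: "complex^'n^'n \<Rightarrow> bool" where
  "unitary_matrix A \<longleftrightarrow>
     A ** transpose (cnj_matrix A) = mat 1 \<and> transpose (cnj_matrix A) ** A = mat 1"

definition unitary_group :: "(complex^'n^'n) monoid" where
  "unitary_group = \<lparr>carrier = {A. unitary_matrix A}, monoid.mult = (**), one = mat 1\<rparr>"

definition special_unitary :: "(complex^'n^'n) set" where
  "special_unitary = {B. unitary_matrix B \<and> det B = 1}"

lemma unitary_group_simps:
  "carrier unitary_group = {A. unitary_matrix A}"
  "A \<otimes>\<^bsub>unitary_group\<^esub> B = A ** B"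
  "\<one>\<^bsub>unitary_group\<^esub> = mat 1"
  by (simp_all add: unitary_group_def)

lemma cnj_matrix_mult: "cnj_matrix (A ** B) = cnj_matrix A ** cnj_matrix B"
  by (simp add: map_matrix_def matrix_matrix_mult_def)

lemma group_unitary_group: "group (unitary_group :: (complex^'n^'n) monoid)"
proof (rule groupI)
  fix A B :: "complex^'n^'n"
  assume A: "A \<in> carrier unitary_group" and B: "B \<in> carrier unitary_group"
  let ?h = "\<lambda>A::complex^'n^'n. transpose (cnj_matrix A)"
  have h: "?h (A ** B) = ?h B ** ?h A"
    by (simp add: cnj_matrix_mult matrix_transpose_mul)
  have "(A ** B) ** (?h B ** ?h A) = A ** (B ** ?h B) ** ?h A"
    by (simp add: matrix_mul_assoc)
  moreover have "(?h B ** ?h A) ** (A ** B) = ?h B ** (?h A ** A) ** B"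
    by (simp add: matrix_mul_assoc)
  ultimately show "A \<otimes>\<^bsub>unitary_group\<^esub> B \<in> carrier unitary_group"
    using A B by (simp add: unitary_group_simps unitary_matrix_def h)
next
  have "cnj_matrix (mat 1 :: complex^'n^'n) = mat 1"
    by (simp add: vec_eq_iff mat_def)
  then show "\<one>\<^bsub>unitary_group\<^esub> \<in> carrier (unitary_group :: (complex^'n^'n) monoid)"
    by (simp add: unitary_group_simps unitary_matrix_def transpose_mat)
next
  fix A :: "complex^'n^'n"
  assume A: "A \<in> carrier unitary_group"
  have "transpose (cnj_matrix (transpose (cnj_matrix A))) = A"
    by (simp add: vec_eq_iff transpose_def)
  with A have "transpose (cnj_matrix A) \<in> carrier unitary_group"
    by (simp add: unitary_group_simps unitary_matrix_def)
  moreover have "transpose (cnj_matrix A) \<otimes>\<^bsub>unitary_group\<^esub> A = \<one>\<^bsub>unitary_group\<^esub>"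
    using A by (simp add: unitary_group_simps unitary_matrix_def)
  ultimately show "\<exists>B\<in>carrier unitary_group. B \<otimes>\<^bsub>unitary_group\<^esub> A = \<one>\<^bsub>unitary_group\<^esub>"
    by blast
qed (auto simp: unitary_group_simps matrix_mul_assoc)

definition effective_action :: "('g, 'b) monoid_scheme \<Rightarrow> 'p set \<Rightarrow> ('g \<Rightarrow> 'p \<Rightarrow> 'p) \<Rightarrow> bool" where
  "effective_action G E \<rho> \<longleftrightarrow> (\<forall>g\<in>carrier G. (\<forall>x\<in>E. \<rho> g x = x) \<longrightarrow> g = \<one>\<^bsub>G\<^esub>)"

text \<open>Note that \<^const>\<open>group_action\<close> makes each \<open>\<rho> A\<close> \<open>undefined\<close> outside the space.\<close>

definition unitary_holomorphic_action ::
  "'p topology \<Rightarrow> ('p, 'm::finite) complex_chart set \<Rightarrow> (complex^'n^'n \<Rightarrow> 'p \<Rightarrow> 'p) \<Rightarrow> bool" where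
  "unitary_holomorphic_action X \<A> \<rho> \<longleftrightarrow>
     group_action unitary_group (topspace X) \<rho> \<and>
     (\<forall>A\<in>carrier unitary_group. biholomorphic_map X \<A> X \<A> (\<rho> A)) \<and>
     continuous_map (prod_topology (top_of_set (carrier unitary_group)) X) X (\<lambda>(A, x). \<rho> A x)"


section \<open>Hopf manifolds\<close>

definition hopf_rel :: "complex \<Rightarrow> ((complex^'n) \<times> (complex^'n)) set" where
  "hopf_rel d = {(z, w). z \<noteq> 0 \<and> w \<noteq> 0 \<and> (\<exists>k::int. w = (d powi k) *s z)}"

definition hopf_class :: "complex \<Rightarrow> complex^'n \<Rightarrow> (complex^'n) set" where
  "hopf_class d z = hopf_rel d `` {z}"

definition hopf_points :: "complex \<Rightarrow> (complex^'n) set set" where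
  "hopf_points d = (- {0}) // hopf_rel d"

text \<open>The quotient topology, and the charts given by the local inverses of the projection.\<close>

definition hopf_manifold :: "complex \<Rightarrow> (complex^'n) set topology" where
  "hopf_manifold d =
     topology (\<lambda>V. V \<subseteq> hopf_points d \<and> open {z. z \<noteq> 0 \<and> hopf_class d z \<in> V})"

definition hopf_atlas :: "complex \<Rightarrow> ((complex^'n) set, 'n) complex_chart set" where
  "hopf_atlas d = {(hopf_class d ` W, inv_into W (hopf_class d)) | W.
                     open W \<and> 0 \<notin> W \<and> inj_on (hopf_class d) W}"

lemma openin_hopf_manifold:
  fixes V :: "(complex^'n) set set"
  shows "openin (hopf_manifold d) V \<longleftrightarrow>
     V \<subseteq> hopf_points d \<and> open {z. z \<noteq> 0 \<and> hopf_class d z \<in> V}"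
proof -
  have "istopology (\<lambda>V :: (complex^'n) set set. V \<subseteq> hopf_points d \<and> open {z. z \<noteq> 0 \<and> hopf_class d z \<in> V})"
    (is "istopology ?P")
    unfolding istopology_def
  proof (intro conjI allI impI)
    fix S T assume S: "?P S" and T: "?P T"
    have "{z. z \<noteq> 0 \<and> hopf_class d z \<in> S \<inter> T} =
          {z. z \<noteq> 0 \<and> hopf_class d z \<in> S} \<inter> {z. z \<noteq> 0 \<and> hopf_class d z \<in> T}"
      by auto
    then show "open {z. z \<noteq> 0 \<and> hopf_class d z \<in> S \<inter> T}"
      using S T by (simp only: open_Int)
    show "S \<inter> T \<subseteq> hopf_points d" using S by auto
  next
    fix \<K> assume K: "\<forall>K\<in>\<K>. ?P K"
    have "{z. z \<noteq> 0 \<and> hopf_class d z \<in> \<Union>\<K>} =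
          (\<Union>K\<in>\<K>. {z. z \<noteq> 0 \<and> hopf_class d z \<in> K})"
      by auto
    then show "open {z. z \<noteq> 0 \<and> hopf_class d z \<in> \<Union>\<K>}"
      using K by auto
    show "\<Union>\<K> \<subseteq> hopf_points d" using K by auto
  qed
  then show ?thesis
    by (simp add: hopf_manifold_def topology_inverse')
qed

lemma hopf_points_eq: "hopf_points d = hopf_class d ` (- {0})"
  by (auto simp: hopf_points_def hopf_class_def quotient_def)

lemma topspace_hopf_manifold: "topspace (hopf_manifold d :: (complex^'n) set topology) = hopf_points d"
proof -
  have "{z :: complex^'n. z \<noteq> 0 \<and> hopf_class d z \<in> hopf_points d} = - {0}"
    by (auto simp: hopf_points_eq)
  moreover have "open (- {0 :: complex^'n})" by auto
  ultimately have "openin (hopf_manifold d) (hopf_points d :: (complex^'n) set set)"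
    by (simp add: openin_hopf_manifold)
  then show ?thesis
    by (metis openin_hopf_manifold openin_subset openin_topspace subset_antisym)
qed

lemma quotient_map_hopf_class:
  "quotient_map (top_of_set (- {0})) (hopf_manifold d) (hopf_class d)"
proof -
  have "openin (top_of_set (- {0})) {z. z \<noteq> 0 \<and> hopf_class d z \<in> U} \<longleftrightarrow>
        open {z. z \<noteq> 0 \<and> hopf_class d z \<in> U}" for U
    by (subst openin_open_eq) auto
  then show ?thesis
    by (auto simp: quotient_map_def openin_hopf_manifold topspace_hopf_manifold hopf_points_eq)
qed

lemma equiv_hopf_rel:
  assumes "d \<noteq> 0"
  shows "equiv (- {0}) (hopf_rel d)"
proof (rule equivI)
  show "hopf_rel d \<subseteq> (- {0}) \<times> (- {0})"
    by (auto simp: hopf_rel_def)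
  show "refl_on (- {0}) (hopf_rel d)"
    by (auto simp: refl_on_def hopf_rel_def intro!: exI[of _ 0])
  show "sym (hopf_rel d)"
  proof (rule symI)
    fix z w assume "(z, w) \<in> hopf_rel d"
    then obtain k where "z \<noteq> 0" "w \<noteq> 0" "w = (d powi k) *s z"
      by (auto simp: hopf_rel_def)
    moreover from this have "z = (d powi (- k)) *s w"
      using assms by (simp add: vector_smult_assoc power_int_minus)
    ultimately show "(w, z) \<in> hopf_rel d"
      unfolding hopf_rel_def by blast
  qed
  show "trans (hopf_rel d)"
  proof (rule transI)
    fix x y z assume "(x, y) \<in> hopf_rel d" "(y, z) \<in> hopf_rel d"
    then obtain k l where "x \<noteq> 0" "z \<noteq> 0" "y = (d powi k) *s x" "z = (d powi l) *s y"
      by (auto simp: hopf_rel_def)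
    moreover from this have "z = (d powi (l + k)) *s x"
      using assms by (simp add: vector_smult_assoc power_int_add)
    ultimately show "(x, z) \<in> hopf_rel d"
      unfolding hopf_rel_def by blast
  qed
qed

lemma hopf_class_eq_iff:
  assumes "d \<noteq> 0" "z \<noteq> 0" "w \<noteq> 0"
  shows "hopf_class d z = hopf_class d w \<longleftrightarrow> (\<exists>k::int. w = (d powi k) *s z)"
  using eq_equiv_class_iff[OF equiv_hopf_rel[OF assms(1)], of z w] assms
  by (simp add: hopf_class_def hopf_rel_def)

lemma norm_vec_smult: "norm (c *s (v :: complex^'n)) = norm c * norm v"
  by (simp add: norm_vec_def L2_set_def norm_mult power_mult_distrib
      flip: sum_distrib_left) (simp add: real_sqrt_mult)

lemma has_derivative_vec_smult:
  "((\<lambda>z::complex^'n. c *s z) has_derivative (\<lambda>z. c *s z)) F"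
proof (rule bounded_linear_imp_has_derivative, rule bounded_linear_intro)
  fix x y :: "complex^'n" and r :: real
  show "c *s (x + y) = c *s x + c *s y" by (simp add: vector_add_ldistrib)
  show "c *s (r *\<^sub>R x) = r *\<^sub>R (c *s x)" by (simp add: vec_eq_iff)
  show "norm (c *s x) \<le> norm x * norm c" by (simp add: norm_vec_smult mult.commute)
qed

lemma open_map_hopf_class:
  assumes "d \<noteq> 0"
  shows "open_map (top_of_set (- {0})) (hopf_manifold d) (hopf_class d)"
  unfolding open_map_def
proof (intro allI impI)
  fix U :: "(complex^'n) set"
  assume "openin (top_of_set (- {0})) U"
  moreover have "open (- {0 :: complex^'n})" by auto
  ultimately have U: "open U" "0 \<notin> U"
    using openin_open_eq[of "- {0 :: complex^'n}" U] by auto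
  have "{z. z \<noteq> 0 \<and> hopf_class d z \<in> hopf_class d ` U} =
        (\<Union>k::int. (\<lambda>z. (d powi k) *s z) -` U)" (is "?L = ?R")
  proof (intro equalityI subsetI)
    fix z assume "z \<in> ?L"
    then obtain u where "z \<noteq> 0" "u \<in> U" "hopf_class d z = hopf_class d u" by auto
    then show "z \<in> ?R"
      using hopf_class_eq_iff[OF assms, of z u] U(2) by auto
  next
    fix z assume "z \<in> ?R"
    then obtain k :: int where k: "(d powi k) *s z \<in> U" by auto
    then have "(d powi k) *s z \<noteq> 0" using U(2) by metis
    moreover from this have "z \<noteq> 0" by auto
    ultimately have "hopf_class d z = hopf_class d ((d powi k) *s z)"
      by (subst hopf_class_eq_iff) (use assms in auto)
    with k \<open>z \<noteq> 0\<close> show "z \<in> ?L" by auto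
  qed
  moreover have "open ((\<lambda>z. (d powi k) *s z) -` U)" for k :: int
    using U(1) by (intro open_vimage)
      (auto intro!: has_derivative_continuous_on has_derivative_vec_smult)
  ultimately show "openin (hopf_manifold d) (hopf_class d ` U)"
    using U(2) by (auto simp: openin_hopf_manifold hopf_points_eq)
qed

lemma hopf_class_locally_injective:
  fixes z :: "complex^'n"
  assumes d: "d \<noteq> 0" "norm d \<noteq> 1" and z: "z \<noteq> 0"
  obtains W :: "(complex^'n) set" where "open W" "z \<in> W" "0 \<notin> W" "inj_on (hopf_class d) W"
proof -
  define a where "a = max (norm d) (1 / norm d)"
  have a: "a > 1"
  proof (cases "norm d > 1")
    case False
    then have "1 / norm d > 1" using d by (simp add: field_simps)
    then show ?thesis by (simp add: a_def)
  qed (simp add: a_def)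
  define W where "W = {w :: complex^'n. norm z / sqrt a < norm w \<and> norm w < norm z * sqrt a}"
  have sa: "sqrt a > 1" using a by simp
  have "open W"
    unfolding W_def by (intro open_Collect_conj open_Collect_less continuous_intros)
  moreover have "z \<in> W"
    using sa z by (auto simp: W_def field_simps)
  moreover have "0 \<notin> W"
    using sa z by (auto simp: W_def not_less)
  moreover have "inj_on (hopf_class d) W"
  proof (rule inj_onI, rule ccontr)
    fix u v assume uv: "u \<in> W" "v \<in> W" "hopf_class d u = hopf_class d v" "u \<noteq> v"
    then have nz: "u \<noteq> 0" "v \<noteq> 0" using \<open>0 \<notin> W\<close> by auto
    obtain k :: int where k: "v = (d powi k) *s u"
      using uv(3) hopf_class_eq_iff[OF d(1) nz] by auto
    then have "k \<noteq> 0" using uv(4) by auto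
    have nv: "norm v = norm d powi k * norm u"
      by (simp add: k norm_vec_smult norm_power_int)
    have lt: "norm x < a * norm y" if "x \<in> W" "y \<in> W" for x y
    proof -
      have "norm x < sqrt a * norm z" using that by (auto simp: W_def mult.commute)
      also have "norm z < sqrt a * norm y"
        using that sa by (auto simp: W_def field_simps)
      then have "sqrt a * norm z < sqrt a * (sqrt a * norm y)"
        using sa by (intro mult_strict_left_mono) auto
      finally show ?thesis using a by (simp flip: mult.assoc)
    qed
    have big: "a \<le> b powi m" if "b = a" "m > 0" for b and m :: int
    proof -
      have "a ^ 1 \<le> a ^ nat m"
        using that a by (intro power_increasing) auto
      then show ?thesis using that by (simp add: power_int_def)
    qed
    have "a \<le> norm d powi k \<or> a \<le> norm d powi (- k)"
    proof (cases "norm d > 1")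
      case True
      then have "1 / norm d < 1" using d by simp
      with True have "norm d = a" by (simp add: a_def max_def)
      with big[OF this, of k] big[OF this, of "- k"] \<open>k \<noteq> 0\<close> show ?thesis by linarith
    next
      case False
      then have "norm d < 1" "1 < 1 / norm d" using d by (auto simp: field_simps)
      then have "1 / norm d = a" by (simp add: a_def max_def)
      then have e: "inverse (norm d) = a" by (simp add: divide_inverse)
      have "inverse (norm d) powi m = norm d powi (- m)" for m :: int
        by (simp add: power_int_inverse power_int_minus)
      with big[OF e, of k] big[OF e, of "- k"] \<open>k \<noteq> 0\<close> show ?thesis
        by (metis add.inverse_inverse linorder_neqE_linordered_idom neg_0_less_iff_less)
    qed
    moreover have "norm u = norm d powi (- k) * norm v"
      using d by (simp add: nv power_int_minus)
    ultimately show False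
      using lt[OF uv(1,2)] lt[OF uv(2,1)] nv nz
      by (metis leD mult_right_mono norm_ge_zero)
  qed
  ultimately show ?thesis using that by blast
qed

lemma complex_atlas_hopf_atlas:
  assumes d: "d \<noteq> 0" "norm d \<noteq> 1"
  shows "complex_atlas (hopf_manifold d) (hopf_atlas d :: ((complex^'n) set, 'n) complex_chart set)"
proof -
  let ?p = "hopf_class d :: complex^'n \<Rightarrow> _"
  have opn: "openin (hopf_manifold d) (?p ` W)" if "open W" "0 \<notin> W" for W
  proof -
    have "open (- {0 :: complex^'n})" by auto
    then have "openin (top_of_set (- {0})) W"
      using that openin_open_eq[of "- {0 :: complex^'n}" W] by auto
    then show ?thesis
      using open_map_hopf_class[OF d(1)] by (auto simp: open_map_def)
  qed
  have hom: "homeomorphic_map (subtopology (hopf_manifold d) (?p ` W)) (top_of_set W) (inv_into W ?p)"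
    if W: "open W" "0 \<notin> W" and inj: "inj_on ?p W" for W
  proof -
    have sub: "W \<subseteq> - {0}" using W by auto
    have "homeomorphic_map (top_of_set W) (subtopology (hopf_manifold d) (?p ` W)) ?p"
    proof (rule bijective_open_imp_homeomorphic_map)
      have "continuous_map (top_of_set (- {0})) (hopf_manifold d) ?p"
        using quotient_imp_continuous_map[OF quotient_map_hopf_class] .
      then have "continuous_map (top_of_set W) (hopf_manifold d) ?p"
        using sub by (rule continuous_map_from_subtopology_mono)
      then show "continuous_map (top_of_set W) (subtopology (hopf_manifold d) (?p ` W)) ?p"
        by (auto simp: continuous_map_in_subtopology)
      show "open_map (top_of_set W) (subtopology (hopf_manifold d) (?p ` W)) ?p"
        unfolding open_map_def
      proof (intro allI impI)
        fix U assume "openin (top_of_set W) U"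
        then have "open U" "U \<subseteq> W" using W by (auto simp: openin_open_eq)
        then have "openin (hopf_manifold d) (?p ` U)" using W by (intro opn) auto
        then show "openin (subtopology (hopf_manifold d) (?p ` W)) (?p ` U)"
          using \<open>U \<subseteq> W\<close> by (metis image_mono inf.absorb_iff1 openin_subtopology)
      qed
      show "?p ` topspace (top_of_set W) = topspace (subtopology (hopf_manifold d) (?p ` W))"
        using openin_subset[OF opn[OF W]] by auto
    qed (use inj in auto)
    then obtain g where
      g: "homeomorphic_maps (top_of_set W) (subtopology (hopf_manifold d) (?p ` W)) ?p g"
      by (auto simp: homeomorphic_map_maps)
    then have "homeomorphic_map (subtopology (hopf_manifold d) (?p ` W)) (top_of_set W) g"
      by (simp add: homeomorphic_maps_map)
    moreover have "g x = inv_into W ?p x"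
      if "x \<in> topspace (subtopology (hopf_manifold d) (?p ` W))" for x
      using that g inj by (auto simp: homeomorphic_maps_map)
    ultimately show ?thesis by (rule homeomorphic_map_eq)
  qed
  have trans: "(inv_into W' ?p \<circ> inv_into (?p ` W) (inv_into W ?p))
      vec_holomorphic_on (inv_into W ?p ` (?p ` W \<inter> ?p ` W'))"
    if W: "open W" "0 \<notin> W" "inj_on ?p W" and W': "open W'" "0 \<notin> W'" "inj_on ?p W'" for W W'
    unfolding vec_holomorphic_on_def
  proof
    fix z assume "z \<in> inv_into W ?p ` (?p ` W \<inter> ?p ` W')"
    then obtain x where x: "x \<in> ?p ` W" "x \<in> ?p ` W'" "z = inv_into W ?p x" by auto
    then have "z \<in> W" "?p z = x" by (simp_all add: inv_into_into f_inv_into_f)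
    with x(2) obtain z' where z: "z \<in> W" "z' \<in> W'" "?p z = ?p z'" by auto
    moreover have "z \<noteq> 0" "z' \<noteq> 0" using z W W' by auto
    ultimately obtain k :: int where k: "z' = (d powi k) *s z"
      using hopf_class_eq_iff[OF d(1)] by blast
    let ?S = "W \<inter> (\<lambda>w. (d powi k) *s w) -` W'"
    have "open ((\<lambda>w. (d powi k) *s w) -` W')"
      using W'(1) by (intro open_vimage)
        (auto intro!: has_derivative_continuous_on has_derivative_vec_smult)
    then have S: "open ?S" "z \<in> ?S" using W z k by auto
    have eq: "(inv_into W' ?p \<circ> inv_into (?p ` W) (inv_into W ?p)) w = (d powi k) *s w"
      if w: "w \<in> ?S" for w
    proof -
      have "inv_into (?p ` W) (inv_into W ?p) (inv_into W ?p (?p w)) = ?p w"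
        using w by (intro inv_into_f_f inj_on_inv_into) auto
      moreover have "inv_into W ?p (?p w) = w" using w W by (simp add: inv_into_f_f)
      moreover have "?p w = ?p ((d powi k) *s w)"
        by (subst hopf_class_eq_iff) (use w d W W' in auto)
      ultimately show ?thesis using w W'(3) by (simp add: inv_into_f_f)
    qed
    have "((inv_into W' ?p \<circ> inv_into (?p ` W) (inv_into W ?p)) has_derivative
            (\<lambda>w. (d powi k) *s w)) (at z)"
      using has_derivative_vec_smult S by (rule has_derivative_transform_within_open) (use eq in auto)
    moreover have "Vector_Spaces.linear (*s) (*s) (\<lambda>w::complex^'n. (d powi k) *s w)"
      by (auto simp: Vector_Spaces.linear_iff vec.vector_space_axioms vector_add_ldistrib
          vector_smult_assoc mult.commute)
    ultimately show "\<exists>f'. ((inv_into W' ?p \<circ> inv_into (?p ` W) (inv_into W ?p)) has_derivative f') (at z)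
        \<and> Vector_Spaces.linear (*s) (*s) f'" by blast
  qed
  have im: "inv_into W ?p ` ?p ` W = W" if "inj_on ?p W" for W
    using that by (auto simp: inv_into_f_f image_iff)
  have cover: "(\<Union>(V, \<phi>)\<in>hopf_atlas d. V) = topspace (hopf_manifold d :: (complex^'n) set topology)"
  proof
    show "(\<Union>(V, \<phi>)\<in>hopf_atlas d. V) \<subseteq> topspace (hopf_manifold d :: (complex^'n) set topology)"
      by (auto simp: hopf_atlas_def topspace_hopf_manifold hopf_points_eq)
    show "topspace (hopf_manifold d :: (complex^'n) set topology) \<subseteq> (\<Union>(V, \<phi>)\<in>hopf_atlas d. V)"
    proof
      fix x assume "x \<in> topspace (hopf_manifold d :: (complex^'n) set topology)"
      then obtain z :: "complex^'n" where z: "z \<noteq> 0" "x = ?p z"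
        by (auto simp: topspace_hopf_manifold hopf_points_eq)
      obtain W where W: "open W" "z \<in> W" "0 \<notin> W" "inj_on ?p W"
        using hopf_class_locally_injective[OF d z(1)] .
      then have "(?p ` W, inv_into W ?p) \<in> hopf_atlas d" by (auto simp: hopf_atlas_def)
      then show "x \<in> (\<Union>(V, \<phi>)\<in>hopf_atlas d. V)" using W(2) z(2) by blast
    qed
  qed
  show ?thesis
    unfolding complex_atlas_def cover
    by (auto simp: hopf_atlas_def im opn hom trans)
qed


section \<open>The two families of actions\<close>

text \<open>\<open>d\<^sup>\<mu>\<close> with the argument of \<open>d\<close> taken in \<open>[0, 2\<pi>)\<close>; this is not \<open>powr\<close> on the complex numbers,
  which uses the principal argument.\<close>

definition real_power :: "complex \<Rightarrow> real \<Rightarrow> complex" where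
  "real_power d \<mu> = complex_of_real (norm d powr \<mu>) * cis (\<mu> * Arg2pi d)"

definition hopf_form_I ::
  "complex \<Rightarrow> int \<Rightarrow> int \<Rightarrow> complex^'n^'n \<Rightarrow>
   (complex^'n^'n \<Rightarrow> (complex^'n) set \<Rightarrow> (complex^'n) set) \<Rightarrow> bool" where
  "hopf_form_I d p r C \<rho> \<longleftrightarrow>
     (\<forall>A\<in>carrier unitary_group. \<forall>t. \<forall>B\<in>special_unitary. A = map_matrix ((*) (cis t)) B \<longrightarrow>
        (\<forall>z. z \<noteq> 0 \<longrightarrow> \<rho> A (hopf_class d z) =
           hopf_class d ((cis ((1 + real_of_int p * CARD('n)) * t) *
              real_power d (CARD('n) * real_of_int r * t / (2 * pi))) *s
              ((C ** B ** matrix_inv C) *v z))))"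

definition hopf_form_II ::
  "complex \<Rightarrow> int \<Rightarrow> int \<Rightarrow> complex^'n^'n \<Rightarrow>
   (complex^'n^'n \<Rightarrow> (complex^'n) set \<Rightarrow> (complex^'n) set) \<Rightarrow> bool" where
  "hopf_form_II d p r C \<rho> \<longleftrightarrow>
     (\<forall>A\<in>carrier unitary_group. \<forall>t. \<forall>B\<in>special_unitary. A = map_matrix ((*) (cis t)) B \<longrightarrow>
        (\<forall>z. z \<noteq> 0 \<longrightarrow> \<rho> A (hopf_class d z) =
           hopf_class d ((cis ((- 1 + real_of_int p * CARD('n)) * t) *
              real_power d (CARD('n) * real_of_int r * t / (2 * pi))) *s
              ((C ** cnj_matrix B ** matrix_inv C) *v z))))"

end

theory Submission
  imports Defs "HOL-Complex_Analysis.Complex_Analysis"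
    "HOL-Computational_Algebra.Fundamental_Theorem_Algebra"
begin

text \<open>Each transformation of the action lifts to the universal covering \<open>\<complex>\<^sup>n - {0}\<close>. A lift is
  holomorphic and commutes with \<open>z \<mapsto> d z\<close>, so by Liouville's theorem on the affine lines missing the
  origin it is linear; thus the action becomes a homomorphism from the unitary group into invertible
  matrices modulo powers of \<open>d\<close>. Lifts of the coordinate reflections are, up to a scalar, commuting
  involutions permuted by the symmetric group; since a joint eigenspace with \<open>k\<close> negative signs
  comes with \<open>n choose k\<close> of them, \<open>k\<close> is \<open>1\<close> or \<open>n - 1\<close>, which fixes a basis in which the diagonal
  torus acts diagonally. There the symmetric group and effectiveness leave only
  \<open>e\<^sup>b\<^sup>s diag(e\<^sup>\<plusminus>\<^sup>i\<^sup>\<theta>)\<close> with \<open>s\<close> the sum of the angles, so the spectral theorem determines the trace of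
  every lift, and the traces determine the representation up to conjugation by a diagonal matrix.
  Compatibility with the full turn of a coordinate circle gives \<open>e\<^sup>2\<^sup>\<pi>\<^sup>b = d\<^sup>r\<close>, whence the integers
  \<open>p\<close> and \<open>r\<close>.\<close>

section \<open>Matrices\<close>

text \<open>The obstacle is that lifts multiply well only modulo powers of \<open>d\<close>: no
  choice of one lift per matrix is multiplicative from the outset. Since |d| differs from 1, a lift
  is determined by the absolute value of its determinant, so identities between lifts are proved by
  comparing determinants, and a continuous family is rigid because its ambiguous exponent is an
  integer. Dimension at least 2 enters through simple connectedness of the punctured space and
  through the lines missing the origin. That a lift commutes with multiplication by \<open>d\<close>
  is itself a result: a priori G(dz) = \<open>d^a\<close> G(z), the lift of the inverse
  transformation forces a = 1 or a = -1, and for a = -1 the lift would decay along lines and vanish.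
  Traces of unitary matrices take the place of Lie algebras, so continuity in the group variable
  suffices. The two possible signs of the torus weights are the two families. Transitivity excludes
  r = 0: there norms, measured in a suitable basis, change only by powers of |d|.\<close>

abbreviation cscale :: "complex \<Rightarrow> complex^'n^'m \<Rightarrow> complex^'n^'m" (infixr "*\<^sub>m" 75) where
  "c *\<^sub>m A \<equiv> map_matrix ((*) c) A"

abbreviation adjoint_matrix :: "complex^'n^'m \<Rightarrow> complex^'m^'n" where
  "adjoint_matrix A \<equiv> transpose (cnj_matrix A)"

definition diag_matrix :: "('n::finite \<Rightarrow> complex) \<Rightarrow> complex^'n^'n" where
  "diag_matrix f = (\<chi> i j. if i = j then f i else 0)"

lemma diag_matrix_nth [simp]: "diag_matrix f $ i $ j = (if i = j then f i else 0)"
  by (simp add: diag_matrix_def)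

lemma cscale_mult_left: "(c *\<^sub>m A) ** B = c *\<^sub>m (A ** B)"
  by (simp add: vec_eq_iff matrix_matrix_mult_def sum_distrib_left mult.assoc)

lemma cscale_mult_right: "A ** (c *\<^sub>m B) = c *\<^sub>m (A ** B)"
  by (simp add: vec_eq_iff matrix_matrix_mult_def sum_distrib_left mult_ac)

lemma cscale_cscale: "c *\<^sub>m (e *\<^sub>m A) = (c * e) *\<^sub>m A"
  by (simp add: vec_eq_iff mult.assoc)

lemma cscale_one [simp]: "1 *\<^sub>m A = A"
  by (simp add: vec_eq_iff)

lemma cscale_mult_vec: "(c *\<^sub>m A) *v x = c *s (A *v x)"
  by (simp add: vec_eq_iff matrix_vector_mult_def sum_distrib_left mult.assoc)

lemma cscale_eq_diag: "c *\<^sub>m A = diag_matrix (\<lambda>_. c) ** A"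
  by (simp add: vec_eq_iff matrix_matrix_mult_def if_distrib[of "\<lambda>x. x * _"] cong: if_cong)

lemma diag_matrix_mult_nth: "(diag_matrix f ** A) $ i $ j = f i * A $ i $ j"
  by (simp add: matrix_matrix_mult_def if_distrib[of "\<lambda>x. x * _"] cong: if_cong)

lemma mult_diag_matrix_nth: "(A ** diag_matrix f) $ i $ j = A $ i $ j * f j"
  by (simp add: matrix_matrix_mult_def if_distrib[of "\<lambda>x. _ * x"] cong: if_cong)

lemma diag_matrix_mult: "diag_matrix f ** diag_matrix g = diag_matrix (\<lambda>i. f i * g i)"
  by (simp add: vec_eq_iff diag_matrix_mult_nth)

lemma diag_matrix_mult_vec_nth: "(diag_matrix f *v x) $ i = f i * x $ i"
  by (simp add: matrix_vector_mult_def if_distrib[of "\<lambda>x. x * _"] cong: if_cong)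

lemma diag_matrix_one: "diag_matrix (\<lambda>_. 1) = mat 1"
  by (simp add: vec_eq_iff mat_def)

lemma det_diag_matrix: "det (diag_matrix f) = (\<Prod>i\<in>UNIV. f i)"
  by (subst det_diagonal) auto

lemma det_cscale: "det (c *\<^sub>m (A :: complex^'n^'n)) = c ^ CARD('n) * det A"
  by (simp add: cscale_eq_diag det_mul det_diag_matrix)

lemma cscale_cancel: "c \<noteq> 0 \<Longrightarrow> c *\<^sub>m A = c *\<^sub>m B \<longleftrightarrow> A = B"
  by (simp add: vec_eq_iff)

section \<open>Unitary matrices and their determinants\<close>

lemma adjoint_adjoint [simp]: "adjoint_matrix (adjoint_matrix A) = A"
  by (simp add: vec_eq_iff transpose_def)

lemma unitary_iff: "unitary_matrix A \<longleftrightarrow> A ** adjoint_matrix A = mat 1"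
  using matrix_left_right_inverse by (auto simp: unitary_matrix_def)

lemma unitary_iff': "unitary_matrix A \<longleftrightarrow> adjoint_matrix A ** A = mat 1"
  using matrix_left_right_inverse by (auto simp: unitary_matrix_def)

lemma unitary_adjoint: "unitary_matrix A \<Longrightarrow> unitary_matrix (adjoint_matrix A)"
  by (simp add: unitary_matrix_def)

lemma unitary_mult: "unitary_matrix A \<Longrightarrow> unitary_matrix B \<Longrightarrow> unitary_matrix (A ** B)"
  using group.is_monoid[OF group_unitary_group] monoid.m_closed[of unitary_group A B]
  by (simp add: unitary_group_simps)

lemma unitary_mat_1: "unitary_matrix (mat 1)"
  using group.is_monoid[OF group_unitary_group] monoid.one_closed[of unitary_group]
  by (simp add: unitary_group_simps)

lemma unitary_diag_matrix: "(\<And>i. norm (f i) = 1) \<Longrightarrow> unitary_matrix (diag_matrix f)"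
proof -
  assume a: "\<And>i. norm (f i) = 1"
  have "adjoint_matrix (diag_matrix f) = diag_matrix (\<lambda>i. cnj (f i))"
    by (simp add: vec_eq_iff transpose_def)
  then show ?thesis
    using a by (simp add: unitary_iff diag_matrix_mult complex_norm_square[symmetric] diag_matrix_one)
qed

lemma det_cnj_matrix: "det (cnj_matrix A) = cnj (det A)"
  by (simp add: det_def)

lemma unitary_cnj: "unitary_matrix A \<Longrightarrow> unitary_matrix (cnj_matrix A)"
proof -
  assume "unitary_matrix A"
  then have "cnj_matrix (A ** adjoint_matrix A) = cnj_matrix (mat 1)" by (simp add: unitary_iff)
  moreover have "cnj_matrix (adjoint_matrix A) = adjoint_matrix (cnj_matrix A)"
    "cnj_matrix (mat 1) = mat 1"
    by (simp_all add: vec_eq_iff transpose_def mat_def)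
  ultimately show ?thesis by (simp add: unitary_iff cnj_matrix_mult)
qed

lemma norm_det_unitary: "unitary_matrix A \<Longrightarrow> norm (det A) = 1"
proof -
  assume "unitary_matrix A"
  then have "det (A ** adjoint_matrix A) = 1" by (simp add: unitary_iff)
  then have "det A * cnj (det A) = 1" by (simp add: det_mul det_cnj_matrix)
  then have "(norm (det A))\<^sup>2 = 1"
    by (metis complex_norm_square of_real_eq_1_iff)
  then show ?thesis by (simp add: power2_eq_1_iff) (smt (verit) norm_ge_zero)
qed

lemma cis_Arg_norm_one: "norm z = 1 \<Longrightarrow> cis (Arg z) = z"
  by (metis cis_Arg div_by_1 norm_zero of_real_1 sgn_eq zero_neq_one)

lemma invertible_mult_inv: "invertible A \<Longrightarrow> A ** matrix_inv A = mat 1"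
  and invertible_inv_mult: "invertible A \<Longrightarrow> matrix_inv A ** A = mat 1"
  unfolding invertible_def matrix_inv_def by (metis (mono_tags, lifting) someI_ex)+

lemma unitary_invertible: "unitary_matrix A \<Longrightarrow> invertible A"
  by (auto simp: unitary_matrix_def invertible_def)

lemma diag_matrix_mult_axis: "diag_matrix f *v axis j 1 = f j *s axis j 1"
  by (simp add: vec_eq_iff diag_matrix_mult_vec_nth axis_def)

section \<open>The spectral theorem for unitary matrices\<close>

text \<open>A linear dependency among the iterates \<open>C\<^sup>k v\<close> gives a polynomial annihilating \<open>v\<close>; peeling off its
  linear factors one at a time meets an eigenvector.\<close>

definition poly_apply :: "complex^'n^'n \<Rightarrow> complex poly \<Rightarrow> complex^'n \<Rightarrow> complex^'n" where
  "poly_apply C p v = (\<Sum>k\<le>degree p. coeff p k *s (((*v) C ^^ k) v))"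

lemma poly_apply_bound:
  "degree p \<le> N \<Longrightarrow> poly_apply C p v = (\<Sum>k\<le>N. coeff p k *s (((*v) C ^^ k) v))"
  unfolding poly_apply_def by (rule sum.mono_neutral_left) (auto simp: coeff_eq_0)

lemma poly_apply_linear_factor:
  "poly_apply C ([:-a, 1:] * q) v = C *v poly_apply C q v - a *s poly_apply C q v"
proof -
  let ?N = "Suc (degree q)"
  have "degree ([:-a, 1:] * q) \<le> ?N"
    by (rule order.trans[OF degree_mult_le]) simp
  then have "poly_apply C ([:-a, 1:] * q) v =
      (\<Sum>k\<le>?N. coeff ([:-a, 1:] * q) k *s (((*v) C ^^ k) v))" by (rule poly_apply_bound)
  also have "\<dots> = (\<Sum>k\<le>?N. (if k = 0 then 0 else coeff q (k - 1)) *s (((*v) C ^^ k) v))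
      - a *s (\<Sum>k\<le>?N. coeff q k *s (((*v) C ^^ k) v))"
    unfolding vec.scale_sum_right sum_subtractf[symmetric]
    by (rule sum.cong) (auto simp: vec_eq_iff algebra_simps coeff_pCons split: nat.splits)
  also have "(\<Sum>k\<le>?N. (if k = 0 then 0 else coeff q (k - 1)) *s (((*v) C ^^ k) v))
      = (\<Sum>k\<le>degree q. coeff q k *s (((*v) C ^^ Suc k) v))"
    by (subst sum.atMost_Suc_shift) simp
  also have "\<dots> = C *v poly_apply C q v"
    by (simp add: poly_apply_def vec.sum vec.scale)
  also have "(\<Sum>k\<le>?N. coeff q k *s (((*v) C ^^ k) v)) = poly_apply C q v"
    by (rule poly_apply_bound[symmetric]) simp
  finally show ?thesis .
qed

lemma eigenvector_of_annihilating_poly: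
  assumes "vec.subspace W" "\<And>x. x \<in> W \<Longrightarrow> C *v x \<in> W"
  shows "p \<noteq> 0 \<Longrightarrow> poly_apply C p v = 0 \<Longrightarrow> v \<in> W \<Longrightarrow> v \<noteq> 0 \<Longrightarrow>
    \<exists>x a. x \<in> W \<and> x \<noteq> 0 \<and> C *v x = a *s x"
proof (induction "degree p" arbitrary: p)
  case 0
  then have "p = [:coeff p 0:]" "coeff p 0 \<noteq> 0" by (metis degree_0_id, metis leading_coeff_0_iff)
  then have "poly_apply C p v = coeff p 0 *s v"
    by (simp add: poly_apply_def "0.hyps"[symmetric])
  then show ?case using 0 \<open>coeff p 0 \<noteq> 0\<close> by simp
next
  case (Suc m)
  obtain a where "poly p a = 0" using alg_closed_imp_poly_has_root[of p] Suc.hyps(2) by auto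
  then obtain q where q: "p = [:-a, 1:] * q" by (metis dvdE poly_eq_0_iff_dvd)
  let ?u = "poly_apply C q v"
  have it: "((*v) C ^^ k) v \<in> W" for k by (induction k) (use Suc assms in auto)
  have "?u \<in> W"
    unfolding poly_apply_def
    by (intro vec.subspace_sum[OF assms(1)] vec.subspace_scale[OF assms(1)] it)
  show ?case
  proof (cases "?u = 0")
    case True
    moreover have "q \<noteq> 0" using Suc q by auto
    moreover have "degree q = m" using Suc.hyps(2) \<open>q \<noteq> 0\<close> unfolding q by (subst (asm) degree_mult_eq) auto
    ultimately show ?thesis using Suc by blast
  next
    case False
    have "C *v ?u = a *s ?u" using Suc.prems(2) unfolding q poly_apply_linear_factor by simp
    then show ?thesis using False \<open>?u \<in> W\<close> by blast
  qed
qed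

text \<open>There are n + 1 iterates from degree 0 to n in a space of dimension n. The coefficients
  of a dependency are the coefficients of the polynomial.\<close>

lemma exists_annihilating_poly: "\<exists>p. p \<noteq> 0 \<and> poly_apply C p (v :: complex^'n) = 0"
proof -
  define f where "f = (\<lambda>k. ((*v) C ^^ k) v)"
  have pa: "poly_apply C p v = (\<Sum>k\<le>N. coeff p k *s f k)" if "degree p \<le> N" for p N
    unfolding f_def by (rule poly_apply_bound[OF that])
  let ?N = "CARD('n)"
  show ?thesis
  proof (cases "inj_on f {..?N}")
    \<comment> \<open>Dependence is a property of the set of vectors and does not see a repeated
      iterate, so a coincidence of two iterates is turned into a difference of monomials
      directly.\<close>
    case False
    then obtain i j where ij: "i < j" "f i = f j" unfolding inj_on_def using linorder_less_linear by metis
    let ?p = "monom 1 j - monom 1 i :: complex poly"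
    have "coeff ?p j \<noteq> 0" using ij by simp
    then have "?p \<noteq> 0" by (metis coeff_0)
    moreover have "degree ?p \<le> j" using ij by (intro degree_diff_le) (auto simp: degree_monom_eq)
    then have "poly_apply C ?p v = (\<Sum>k\<le>j. coeff ?p k *s f k)" by (rule pa)
    then have "poly_apply C ?p v = (\<Sum>k\<le>j. (if k = j then f k else 0) - (if k = i then f k else 0))"
      using ij by (auto intro!: sum.cong)
    then have "poly_apply C ?p v = 0" using ij by (simp add: sum_subtractf)
    ultimately show ?thesis by blast
  next
    case True
    then have c: "card (f ` {..?N}) = Suc ?N" by (simp add: card_image)
    have "vec.dependent (f ` {..?N})"
    proof (rule ccontr)
      assume "\<not> ?thesis"
      then have "card (f ` {..?N}) \<le> vec.dim (UNIV :: (complex^'n) set)"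
        using vec.independent_card_le_dim by blast
      then show False using c by (simp add: vec.dim_UNIV card_cart_basis)
    qed
    then obtain u where u: "\<exists>x\<in>f ` {..?N}. u x \<noteq> 0" "(\<Sum>x\<in>f ` {..?N}. u x *s x) = 0"
      using vec.dependent_finite[of "f ` {..?N}"] by auto
    define p where "p = (\<Sum>k\<le>?N. monom (u (f k)) k)"
    have cp: "coeff p k = (if k \<le> ?N then u (f k) else 0)" for k
      by (simp add: p_def coeff_sum)
    have "degree p \<le> ?N" by (rule degree_le) (simp add: cp)
    then have "poly_apply C p v = (\<Sum>k\<le>?N. coeff p k *s f k)" by (rule pa)
    also have "\<dots> = (\<Sum>k\<le>?N. u (f k) *s f k)" by (simp add: cp)
    also have "\<dots> = 0" using u(2) True by (simp add: sum.reindex)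
    finally have "poly_apply C p v = 0" .
    moreover obtain k where "k \<le> ?N" "u (f k) \<noteq> 0" using u(1) by auto
    then have "coeff p k \<noteq> 0" by (simp add: cp)
    then have "p \<noteq> 0" by auto
    ultimately show ?thesis by blast
  qed
qed

text \<open>The version relative to an invariant subspace lets the search be repeated in the
  complement of the eigenvectors already found.\<close>

lemma exists_eigenvector:
  fixes C :: "complex^'n^'n"
  assumes "vec.subspace W" "\<And>x. x \<in> W \<Longrightarrow> C *v x \<in> W" "v \<in> W" "v \<noteq> 0"
  obtains x a where "x \<in> W" "x \<noteq> 0" "C *v x = a *s x"
  using exists_annihilating_poly[of C v] eigenvector_of_annihilating_poly[OF assms(1,2)] assms(3,4)
  by blast

section \<open>Completing eigenvectors to a unitary basis\<close>

lemma mult_axis_nth: "(A *v axis i (1 :: 'a :: comm_semiring_1)) $ k = A $ k $ i"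
  by (simp add: matrix_vector_mult_def axis_def if_distrib[of "\<lambda>x. _ * x"] cong: if_cong)

lemma matrix_eqI_axis:
  "(\<And>i. M *v axis i 1 = N *v axis i (1 :: 'a :: comm_semiring_1)) \<Longrightarrow> M = N"
  by (metis mult_axis_nth vec_eq_iff)

text \<open>The reflection along v = \<open>axis j 1 - x\<close>. Over the complex numbers it
  exchanges two unit vectors only if their inner product is real, whence the condition on
  \<open>x $ j\<close>. Basis vectors orthogonal to v stay fixed, which protects the columns treated
  earlier.\<close>

lemma exists_householder:
  fixes x :: "complex^'n"
  assumes nx: "(\<Sum>k\<in>UNIV. x $ k * cnj (x $ k)) = 1" and real: "x $ j \<in> \<real>"
  obtains H where "unitary_matrix H" "H *v axis j 1 = x"
    "\<And>i. i \<noteq> j \<Longrightarrow> x $ i = 0 \<Longrightarrow> H *v axis i 1 = axis i 1"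
proof (cases "x = axis j 1")
  case True
  then show ?thesis using that[of "mat 1"] by (simp add: unitary_mat_1)
next
  case False
  define v where "v = axis j 1 - x"
  define N where "N = (\<Sum>k\<in>UNIV. v $ k * cnj (v $ k))"
  have "N = complex_of_real (\<Sum>k\<in>UNIV. (norm (v $ k))\<^sup>2)"
    unfolding N_def of_real_sum by (rule sum.cong[OF refl], rule complex_norm_square[symmetric])
  moreover have "\<exists>k. v $ k \<noteq> 0" using False by (simp add: v_def vec_eq_iff) metis
  ultimately have N0: "N \<noteq> 0"
    by (auto simp: sum_nonneg_eq_0_iff simp flip: of_real_sum of_real_power)
  have "N = (\<Sum>k\<in>UNIV. (if k = j then 1 - cnj (x $ k) - x $ k else 0) + x $ k * cnj (x $ k))"
    unfolding N_def by (rule sum.cong) (auto simp: v_def axis_def algebra_simps)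
  also have "\<dots> = 2 * (1 - x $ j)"
    using real by (simp add: sum.distrib nx Reals_cnj_iff)
  finally have N: "N = 2 * (1 - x $ j)" .
  have Nr: "cnj N = N" unfolding N_def by (simp add: mult.commute)
  define H :: "complex^'n^'n" where "H = (\<chi> k l. (if k = l then 1 else 0) - 2 / N * v $ k * cnj (v $ l))"
  have adj: "adjoint_matrix H = H"
    by (simp add: vec_eq_iff H_def transpose_def Nr mult_ac)
  have sums: "(\<Sum>m\<in>UNIV. a * (v $ m * cnj (v $ m)) * b) = a * N * b" for a b
    by (simp only: N_def sum_distrib_left sum_distrib_right)
  have "(H ** H) $ k $ l = mat 1 $ k $ l" for k l
  proof -
    have "(H ** H) $ k $ l = (\<Sum>m\<in>UNIV. (if k = m then (if m = l then 1 else 0) - 2 / N * v $ m * cnj (v $ l) else 0)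
      - (if m = l then 2 / N * v $ k * cnj (v $ m) else 0)
      + 2 / N * v $ k * (v $ m * cnj (v $ m)) * (2 / N * cnj (v $ l)))"
      unfolding matrix_matrix_mult_def H_def by (simp, rule sum.cong) (auto simp: algebra_simps)
    also have "\<dots> = (if k = l then 1 else 0) - 2 / N * v $ k * cnj (v $ l) - 2 / N * v $ k * cnj (v $ l)
        + 2 / N * v $ k * N * (2 / N * cnj (v $ l))"
      unfolding sum.distrib sum_subtractf sums by simp
    also have "\<dots> = mat 1 $ k $ l" using N0 by (simp add: mat_def field_simps)
    finally show ?thesis .
  qed
  then have "unitary_matrix H" by (simp add: unitary_iff adj vec_eq_iff)
  moreover have Hax: "(H *v axis i 1) $ k = (if k = i then 1 else 0) - 2 / N * v $ k * cnj (v $ i)" for i k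
    by (simp add: mult_axis_nth H_def)
  have "(H *v axis j 1) $ k = x $ k" for k
  proof -
    have "cnj (v $ j) = 1 - x $ j" using real by (simp add: v_def axis_def Reals_cnj_iff)
    then have "2 * cnj (v $ j) = N" by (simp add: N)
    moreover have "2 / N * v $ k * cnj (v $ j) = v $ k * (2 * cnj (v $ j)) / N" by simp
    ultimately have "2 / N * v $ k * cnj (v $ j) = v $ k" using N0 by simp
    then show ?thesis unfolding Hax by (simp add: v_def axis_def)
  qed
  moreover have "H *v axis i 1 = axis i 1" if "i \<noteq> j" "x $ i = 0" for i
  proof -
    have "v $ i = 0" using that by (simp add: v_def axis_def)
    then show ?thesis by (simp add: vec_eq_iff Hax) (simp add: axis_def)
  qed
  ultimately show ?thesis using that by (simp add: vec_eq_iff)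
qed

text \<open>Induction on the set of columns of \<open>U\<close> that are eigenvectors. In the basis
  \<open>U\<close>, the matrix becomes \<open>C\<close>, which preserves the coordinate subspace
  complementary to \<open>S\<close>; an eigenvector found there becomes the new column j by a
  Householder reflection fixing the columns in \<open>S\<close>.\<close>

lemma unitary_eigenvectors:
  fixes A :: "complex^'n^'n"
  assumes A: "unitary_matrix A" and fin: "finite S"
  shows "\<exists>U \<mu>. unitary_matrix U \<and> (\<forall>i\<in>S. A *v (U *v axis i 1) = \<mu> i *s (U *v axis i 1))"
  using fin
proof (induction S)
  case empty
  then show ?case using unitary_mat_1 by auto
next
  case (insert j S)
  then obtain U \<mu> where U: "unitary_matrix U"
    and \<mu>: "\<And>i. i \<in> S \<Longrightarrow> A *v (U *v axis i 1) = \<mu> i *s (U *v axis i 1)" by blast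
  define C where "C = adjoint_matrix U ** A ** U"
  have UC: "U ** C = A ** U"
    using U by (simp add: C_def unitary_matrix_def matrix_mul_assoc)
  have C: "unitary_matrix C"
    unfolding C_def using A U by (intro unitary_mult unitary_adjoint)
  have Ce: "C *v axis i 1 = \<mu> i *s axis i 1" if "i \<in> S" for i
  proof -
    have "C *v axis i 1 = adjoint_matrix U *v (A *v (U *v axis i 1))"
      by (simp only: C_def matrix_vector_mul_assoc matrix_mul_assoc)
    also have "\<dots> = \<mu> i *s ((adjoint_matrix U ** U) *v axis i 1)"
      by (subst \<mu>[OF that]) (simp only: vec.scale matrix_vector_mul_assoc)
    finally show ?thesis using U by (simp add: unitary_matrix_def)
  qed
  \<comment> \<open>Column i of \<open>C\<close> is known to be diagonal; since the adjoint inverts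
    \<open>C\<close>, row i is diagonal too, and this is what makes the complementary subspace
    \<open>W\<close> invariant.\<close>
  have C0: "C $ i $ k = 0" if "i \<in> S" "k \<noteq> i" for i k
  proof -
    have "axis i 1 = adjoint_matrix C *v (C *v axis i 1)"
      using C by (simp add: unitary_matrix_def matrix_vector_mul_assoc)
    also have "\<dots> = \<mu> i *s (adjoint_matrix C *v axis i 1)"
      by (simp only: Ce[OF that(1)] vec.scale)
    finally have e: "axis i 1 $ m = \<mu> i * cnj (C $ i $ m)" for m
      by (simp add: vec_eq_iff mult_axis_nth transpose_def)
    have "\<mu> i \<noteq> 0" using e[of i] by auto
    then show ?thesis using e[of k] that by (simp add: axis_def)
  qed
  define W where "W = {x :: complex^'n. \<forall>i\<in>S. x $ i = 0}"
  have "vec.subspace W" by (simp add: W_def vec.subspace_def)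
  moreover have "C *v x \<in> W" if "x \<in> W" for x
  proof -
    have "C $ i $ k * x $ k = 0" if "i \<in> S" for i k
      using C0[OF that, of k] \<open>x \<in> W\<close> that by (cases "k = i") (auto simp: W_def)
    then show ?thesis by (auto simp: W_def matrix_vector_mult_def intro!: sum.neutral)
  qed
  moreover have "axis j 1 \<in> W" using insert.hyps by (auto simp: W_def axis_def)
  moreover have "axis j (1 :: complex) \<noteq> 0" by simp
  ultimately obtain y a where y: "y \<in> W" "y \<noteq> 0" "C *v y = a *s y"
    by (rule exists_eigenvector)
  \<comment> \<open>Normalises the length and rotates the phase so that the j-th coordinate becomes
    real, as the Householder reflection requires.\<close>
  define c where "c = (if y $ j = 0 then 1 else cnj (sgn (y $ j))) / norm y"
  define x where "x = c *s y"
  have nc: "norm c = 1 / norm y"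
    by (simp add: c_def norm_divide norm_sgn)
  have "(\<Sum>k\<in>UNIV. x $ k * cnj (x $ k)) = of_real (\<Sum>k\<in>UNIV. (norm (x $ k))\<^sup>2)"
    unfolding of_real_sum by (rule sum.cong[OF refl], rule complex_norm_square[symmetric])
  also have "(\<Sum>k\<in>UNIV. (norm (x $ k))\<^sup>2) = (norm x)\<^sup>2"
    by (simp add: norm_vec_def L2_set_def sum_nonneg)
  also have "norm x = 1" unfolding x_def norm_vec_smult nc using y(2) by simp
  finally have nx: "(\<Sum>k\<in>UNIV. x $ k * cnj (x $ k)) = 1" by simp
  have "cnj (sgn z) * z = of_real (norm z)" for z :: complex
    by (simp add: sgn_div_norm scaleR_conv_of_real divide_inverse[symmetric] mult.commute[of z]
        mult.commute[of _ z] complex_norm_square[symmetric] power2_eq_square)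
  then have "x $ j \<in> \<real>" by (auto simp: x_def c_def)
  then obtain H where H: "unitary_matrix H" "H *v axis j 1 = x"
    "\<And>i. i \<noteq> j \<Longrightarrow> x $ i = 0 \<Longrightarrow> H *v axis i 1 = axis i 1"
    using exists_householder[OF nx] by blast
  have e: "C *v (H *v axis i 1) = (if i = j then a else \<mu> i) *s (H *v axis i 1)" if "i \<in> insert j S" for i
  proof (cases "i = j")
    case True
    have "C *v x = a *s x" unfolding x_def by (simp add: vec.scale y(3) vector_smult_assoc mult.commute)
    then show ?thesis using True H by simp
  next
    case False
    then have "x $ i = 0" using that y(1) by (auto simp: W_def x_def)
    then show ?thesis using False that Ce H(3) by auto
  qed
  have "A *v ((U ** H) *v axis i 1) = (if i = j then a else \<mu> i) *s ((U ** H) *v axis i 1)"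
    if "i \<in> insert j S" for i
  proof -
    have "A *v ((U ** H) *v axis i 1) = (A ** U) *v (H *v axis i 1)"
      by (simp add: matrix_vector_mul_assoc matrix_mul_assoc)
    also have "\<dots> = U *v (C *v (H *v axis i 1))"
      by (simp only: UC[symmetric] matrix_vector_mul_assoc matrix_mul_assoc)
    also have "\<dots> = (if i = j then a else \<mu> i) *s (U *v (H *v axis i 1))"
      unfolding e[OF that] by (rule vec.scale)
    finally show ?thesis by (simp add: matrix_vector_mul_assoc)
  qed
  then show ?case using unitary_mult[OF U H(1)]
    by (intro exI[of _ "U ** H"] exI[of _ "\<lambda>i. if i = j then a else \<mu> i"]) blast
qed

theorem unitary_spectral:
  fixes A :: "complex^'n^'n"
  assumes A: "unitary_matrix A"
  obtains U \<theta> where "unitary_matrix U" "A = U ** diag_matrix (\<lambda>i. cis (\<theta> i)) ** adjoint_matrix U"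
proof -
  obtain U \<mu> where U: "unitary_matrix U"
    and \<mu>: "\<And>i. A *v (U *v axis i 1) = \<mu> i *s (U *v axis i 1)"
    using unitary_eigenvectors[OF A finite[of UNIV]] by auto
  have AU: "A ** U = U ** diag_matrix \<mu>"
    by (rule matrix_eqI_axis) (simp add: matrix_vector_mul_assoc[symmetric] \<mu> diag_matrix_mult_axis vec.scale)
  then have D: "diag_matrix \<mu> = adjoint_matrix U ** A ** U"
    using U by (simp add: unitary_matrix_def matrix_mul_assoc[symmetric])
      (simp add: matrix_mul_assoc)
  have "unitary_matrix (diag_matrix \<mu>)"
    unfolding D using A U by (intro unitary_mult unitary_adjoint)
  then have "(diag_matrix \<mu> ** adjoint_matrix (diag_matrix \<mu>)) $ i $ i = 1" for i
    by (simp add: unitary_iff mat_def)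
  then have "\<mu> i * cnj (\<mu> i) = 1" for i
    by (simp add: diag_matrix_mult_nth transpose_def)
  then have "norm (\<mu> i) = 1" for i
    by (metis complex_mod_sqrt_Re_mult_cnj one_complex.sel(1) real_sqrt_one)
  then have "cis (Arg (\<mu> i)) = \<mu> i" for i
    by (rule cis_Arg_norm_one)
  moreover have "A = U ** diag_matrix \<mu> ** adjoint_matrix U"
    unfolding AU[symmetric] using U by (simp add: unitary_matrix_def matrix_mul_assoc[symmetric])
  ultimately show ?thesis using U that[of U "\<lambda>i. Arg (\<mu> i)"] by simp
qed

section \<open>Reflections and permutation matrices\<close>

definition reflection_matrix :: "'n::finite \<Rightarrow> complex^'n^'n" where
  "reflection_matrix j = diag_matrix (\<lambda>i. if i = j then -1 else 1)"

definition perm_matrix :: "('n::finite \<Rightarrow> 'n) \<Rightarrow> complex^'n^'n" where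
  "perm_matrix \<pi> = (\<chi> i j. if i = \<pi> j then 1 else 0)"

lemma unitary_perm_matrix:
  assumes "bij \<pi>" shows "unitary_matrix (perm_matrix \<pi>)"
proof -
  have "(adjoint_matrix (perm_matrix \<pi>) ** perm_matrix \<pi>) $ i $ j = mat 1 $ i $ j" for i j
  proof -
    have "(adjoint_matrix (perm_matrix \<pi>) ** perm_matrix \<pi>) $ i $ j =
        (\<Sum>k\<in>UNIV. if k = \<pi> j then (if \<pi> j = \<pi> i then 1 else 0) else 0)"
      by (simp only: matrix_matrix_mult_def vec_lambda_beta, rule sum.cong)
        (auto simp: perm_matrix_def transpose_def)
    then show ?thesis using bij_is_inj[OF assms] by (simp add: mat_def inj_eq)
  qed
  then show ?thesis by (simp add: unitary_iff' vec_eq_iff)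
qed

lemma perm_matrix_diag: "perm_matrix \<pi> ** diag_matrix (\<lambda>i. f (\<pi> i)) = diag_matrix f ** perm_matrix \<pi>"
  by (simp add: vec_eq_iff mult_diag_matrix_nth diag_matrix_mult_nth) (simp add: perm_matrix_def)

lemma perm_matrix_reflection:
  assumes "bij \<pi>"
  shows "perm_matrix \<pi> ** reflection_matrix j = reflection_matrix (\<pi> j) ** perm_matrix \<pi>"
proof -
  have "reflection_matrix j = diag_matrix (\<lambda>i. if \<pi> i = \<pi> j then -1 else 1)"
    using bij_is_inj[OF assms] by (simp add: reflection_matrix_def inj_eq)
  then show ?thesis using perm_matrix_diag[of \<pi> "\<lambda>i. if i = \<pi> j then -1 else 1"] by (simp add: reflection_matrix_def)
qed

lemma unitary_reflection: "unitary_matrix (reflection_matrix j)"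
  unfolding reflection_matrix_def by (rule unitary_diag_matrix) auto

lemma reflection_square: "reflection_matrix j ** reflection_matrix j = mat 1"
  by (simp add: reflection_matrix_def diag_matrix_mult if_distrib[of "\<lambda>x. x * _"] diag_matrix_one cong: if_cong)

lemma reflection_commute: "reflection_matrix i ** reflection_matrix j = reflection_matrix j ** reflection_matrix i"
  by (simp add: reflection_matrix_def diag_matrix_mult mult.commute)

lemma reflection_inj: "reflection_matrix i = reflection_matrix j \<Longrightarrow> i = j"
  by (auto simp: reflection_matrix_def vec_eq_iff dest!: spec[of _ i] split: if_splits)

text \<open>The reflection is the identity minus twice the projection to coordinate j, so the
  correction is the product of column j of \<open>X\<close> with row j of \<open>Y\<close>: a single
  product of entries is isolated.\<close>

lemma reflection_sandwich_nth:
  "(X ** reflection_matrix j ** Y) $ i $ k = (X ** Y) $ i $ k - 2 * X $ i $ j * Y $ j $ k"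
proof -
  have "(X ** reflection_matrix j ** Y) $ i $ k =
      (\<Sum>m\<in>UNIV. X $ i $ m * Y $ m $ k - (if m = j then 2 * X $ i $ m * Y $ m $ k else 0))"
    by (subst matrix_matrix_mult_def)
      (simp add: reflection_matrix_def mult_diag_matrix_nth, rule sum.cong, auto)
  also have "\<dots> = (X ** Y) $ i $ k - 2 * X $ i $ j * Y $ j $ k"
    unfolding sum_subtractf by (simp add: matrix_matrix_mult_def)
  finally show ?thesis .
qed

section \<open>Trace-preserving representations of the unitary group\<close>

text \<open>Inserting the reflections between two matrices turns the trace condition into relations between
  single matrix entries.\<close>

lemma trace_preserving_conjugate:
  fixes \<Psi> :: "complex^'n^'n \<Rightarrow> complex^'n^'n"
  assumes mult: "\<And>A B. unitary_matrix A \<Longrightarrow> unitary_matrix B \<Longrightarrow> \<Psi> (A ** B) = \<Psi> A ** \<Psi> B"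
    and refl: "\<And>j. \<Psi> (reflection_matrix j) = reflection_matrix j"
    and tr: "\<And>A. unitary_matrix A \<Longrightarrow> trace (\<Psi> A) = trace A"
  obtains c where "\<And>i. c i \<noteq> 0" "\<And>A. unitary_matrix A \<Longrightarrow> \<Psi> A ** diag_matrix c = diag_matrix c ** A"
proof -
  have sand: "\<Psi> (A ** reflection_matrix j ** B) $ i $ k = \<Psi> (A ** B) $ i $ k - 2 * \<Psi> A $ i $ j * \<Psi> B $ j $ k"
    if "unitary_matrix A" "unitary_matrix B" for A B i j k
    using that by (simp add: mult refl unitary_mult unitary_reflection reflection_sandwich_nth)
  have tr_refl: "trace (reflection_matrix j ** X) = trace X - 2 * X $ j $ j" for j and X :: "complex^'n^'n"
  proof -
    have "trace (reflection_matrix j ** X) = (\<Sum>i\<in>UNIV. X $ i $ i - (if i = j then 2 * X $ i $ i else 0))"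
      by (simp add: trace_def reflection_matrix_def diag_matrix_mult_nth, rule sum.cong) auto
    then show ?thesis by (simp add: sum_subtractf trace_def)
  qed
  \<comment> \<open>Multiplying by a reflection changes the trace by twice a diagonal entry, so
    preserved traces give preserved diagonals.\<close>
  have diag: "\<Psi> A $ j $ j = A $ j $ j" if "unitary_matrix A" for A j
    using tr[OF unitary_mult[OF unitary_reflection that, of j]] tr[OF that] that
    by (simp add: mult refl unitary_reflection tr_refl)
  have prod: "\<Psi> A $ i $ j * \<Psi> B $ j $ i = A $ i $ j * B $ j $ i"
    if "unitary_matrix A" "unitary_matrix B" for A B i j
    using sand[OF that, of j i i] that
    by (simp add: diag unitary_mult unitary_reflection reflection_sandwich_nth)
  \<comment> \<open>Transposition matrices are unitary matrices with entry 1 at both (i, j) and (j,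
    i). Inserted into \<open>prod\<close>, they show that \<Psi> multiplies the entry at each fixed
    position by a factor independent of the matrix.\<close>
  define w where "w i j = perm_matrix (Transposition.transpose i j)" for i j :: 'n
  have w: "unitary_matrix (w i j)" "w i j $ i $ j = 1" "w i j $ j $ i = 1" for i j
    unfolding w_def by (auto intro: unitary_perm_matrix) (simp_all add: perm_matrix_def)
  define g where "g j i = 1 / \<Psi> (w i j) $ i $ j" for i j
  have w0: "\<Psi> (w i j) $ i $ j \<noteq> 0" for i j
    using prod[OF w(1) w(1), of i j i j i j] w(2,3)[of i j] by auto
  have g0: "g j i \<noteq> 0" for i j using w0 by (simp add: g_def)
  have g: "\<Psi> B $ j $ i = g j i * B $ j $ i" if "unitary_matrix B" for B i j
    using prod[OF w(1)[of i j] that, of i j] w(2)[of i j] w0[of i j] by (simp add: g_def field_simps)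
  \<comment> \<open>The entry (i, k) of \<open>w i j\<close> times reflection j times
    \<open>w j k\<close> isolates a product of two entries equal to 1. The factors thus form a
    multiplicative cocycle, which is a coboundary: fixing the second index at m gives the
    conjugating diagonal.\<close>
  have cocycle: "g i k = g i j * g j k" for i j k
    using sand[OF w(1)[of i j] w(1)[of j k], of j i k] w(2)[of i j] w(2)[of j k] w(1)
    by (simp add: g unitary_mult unitary_reflection reflection_sandwich_nth algebra_simps)
  obtain m :: 'n where True by auto
  have "\<Psi> A ** diag_matrix (\<lambda>i. g i m) = diag_matrix (\<lambda>i. g i m) ** A" if "unitary_matrix A" for A
    unfolding vec_eq_iff mult_diag_matrix_nth diag_matrix_mult_nth g[OF that] cocycle[of _ m _]
    using cocycle[of _ m] by (metis mult.commute mult.left_commute)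
  then show ?thesis using that[of "\<lambda>i. g i m"] g0 by blast
qed

section \<open>Families of commuting involutions permuted by the symmetric group\<close>

definition sign_vector :: "('n::finite \<Rightarrow> complex^'n^'n) \<Rightarrow> 'n set \<Rightarrow> complex^'n \<Rightarrow> bool" where
  "sign_vector \<sigma> S v \<longleftrightarrow> v \<noteq> 0 \<and> (\<forall>j. \<sigma> j *v v = (if j \<in> S then -1 else 1) *s v)"

text \<open>If \<sigma> i and \<sigma> j differ at u, they act with opposite signs on the difference
  of the two images of u. This relation is linear and survives the projections to eigenspaces of the
  commuting involutions, so the final sign set contains exactly one of i and j.\<close>

lemma exists_sign_vector:
  fixes \<sigma> :: "'n::finite \<Rightarrow> complex^'n^'n"
  assumes sq: "\<And>j. \<sigma> j ** \<sigma> j = mat 1"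
    and comm: "\<And>i j. \<sigma> i ** \<sigma> j = \<sigma> j ** \<sigma> i"
    and ne: "\<sigma> i \<noteq> \<sigma> j"
  obtains S v where "sign_vector \<sigma> S v" "S \<noteq> {}" "S \<noteq> UNIV"
proof -
  have sqv: "\<sigma> k *v (\<sigma> k *v x) = x" for k x
    by (simp add: matrix_vector_mul_assoc sq)
  have commv: "\<sigma> k *v (\<sigma> l *v x) = \<sigma> l *v (\<sigma> k *v x)" for k l x
    by (simp add: matrix_vector_mul_assoc comm)
  obtain u where u: "\<sigma> i *v u \<noteq> \<sigma> j *v u" using ne by (metis matrix_eqI_axis)
  have *: "\<exists>v. v \<noteq> 0 \<and> \<sigma> i *v v = - (\<sigma> j *v v) \<and> (\<forall>k\<in>J. \<sigma> k *v v = v \<or> \<sigma> k *v v = - v)"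
    if "finite J" for J
    using that
  proof (induction J)
    case empty
    let ?v = "\<sigma> i *v u - \<sigma> j *v u"
    have "\<sigma> i *v ?v = - (\<sigma> j *v ?v)"
      by (simp add: matrix_vector_mult_diff_distrib sqv commv[of i j])
    then show ?case using u by (intro exI[of _ ?v]) simp
  next
    case (insert l J)
    then obtain v where v: "v \<noteq> 0" "\<sigma> i *v v = - (\<sigma> j *v v)"
      "\<And>k. k \<in> J \<Longrightarrow> \<sigma> k *v v = v \<or> \<sigma> k *v v = - v" by blast
    \<comment> \<open>\<open>v + \<sigma> l *v v\<close> is twice the component of v fixed by
      \<sigma> l. If it vanishes, v is already in the eigenspace of -1; otherwise it replaces
      v.\<close>
    show ?case
    proof (cases "v + \<sigma> l *v v = 0")
      case True
      then have "\<sigma> l *v v = - v" by (simp add: add_eq_0_iff)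
      then show ?thesis using v by (intro exI[of _ v]) auto
    next
      case False
      let ?w = "v + \<sigma> l *v v"
      have "\<sigma> l *v ?w = ?w" by (simp add: vec.add sqv)
      moreover have w: "\<sigma> k *v ?w = \<sigma> k *v v + \<sigma> l *v (\<sigma> k *v v)" for k
        by (simp add: vec.add commv[of k])
      have "\<sigma> i *v ?w = - (\<sigma> j *v ?w)" unfolding w v(2) by (simp add: vec.neg)
      moreover have "\<sigma> k *v ?w = ?w \<or> \<sigma> k *v ?w = - ?w" if "k \<in> J" for k
        unfolding w using v(3)[OF that] by (auto simp: vec.neg)
      ultimately show ?thesis using False by (intro exI[of _ ?w]) blast
    qed
  qed
  obtain v where v: "v \<noteq> 0" "\<sigma> i *v v = - (\<sigma> j *v v)"
    "\<And>k. \<sigma> k *v v = v \<or> \<sigma> k *v v = - v" using *[OF finite[of UNIV]] by auto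
  let ?S = "{k. \<sigma> k *v v = - v}"
  have nv: "- v \<noteq> v"
    using v(1) by (metis add_eq_0_iff vec.scale_eq_0_iff vec.scale_left_distrib vec.scale_one
        one_add_one zero_neq_numeral)
  have "sign_vector \<sigma> ?S v"
    unfolding sign_vector_def using v(1,3) nv by (auto simp: vec_eq_iff)
  moreover have "i \<in> ?S \<longleftrightarrow> j \<notin> ?S" using v(2) v(3)[of i] v(3)[of j] nv by auto
  ultimately show ?thesis using that by blast
qed

text \<open>The product of the factors (1 + e \<sigma> j) / 2, with e the sign that
  \<open>S0\<close> prescribes at j: each factor keeps or kills a sign vector according to its sign
  at j. Applied to a linear relation, \<open>L\<close> extracts the term with sign set
  \<open>S0\<close>.\<close>

lemma sign_projection:
  fixes \<sigma> :: "'n::finite \<Rightarrow> complex^'n^'n"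
  obtains L where "\<And>S u. sign_vector \<sigma> S u \<Longrightarrow> L *v u = (if S = S0 then u else 0)"
proof -
  have "\<exists>L. \<forall>S u. sign_vector \<sigma> S u \<longrightarrow> L *v u = (if S \<inter> J = S0 \<inter> J then u else 0)" if "finite J" for J
    using that
  proof (induction J)
    case empty
    then show ?case by (intro exI[of _ "mat 1"]) simp
  next
    case (insert j J)
    then obtain L where L: "\<And>S u. sign_vector \<sigma> S u \<Longrightarrow> L *v u = (if S \<inter> J = S0 \<inter> J then u else 0)"
      by blast
    define e :: complex where "e = (if j \<in> S0 then -1 else 1)"
    define L' where "L' = (1 / 2) *\<^sub>m (L + e *\<^sub>m (\<sigma> j ** L))"
    have "L' *v u = (if S \<inter> insert j J = S0 \<inter> insert j J then u else 0)" if u: "sign_vector \<sigma> S u" for S u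
    proof -
      have "L' *v u = (1 / 2) *s (L *v u + e *s (\<sigma> j *v (L *v u)))"
        by (simp add: L'_def cscale_mult_vec matrix_vector_mult_add_rdistrib matrix_vector_mul_assoc)
      also have "\<dots> = (if S \<inter> J = S0 \<inter> J \<and> (j \<in> S \<longleftrightarrow> j \<in> S0) then u else 0)"
        using u by (auto simp: L[OF u] sign_vector_def e_def vec_eq_iff)
      also have "\<dots> = (if S \<inter> insert j J = S0 \<inter> insert j J then u else 0)"
        using insert.hyps(2) by (auto intro!: if_cong)
      finally show ?thesis .
    qed
    then show ?case by blast
  qed
  from this[OF finite[of UNIV]] show ?thesis using that by auto
qed

lemma sign_vectors_independent:
  fixes \<sigma> :: "'n::finite \<Rightarrow> complex^'n^'n"
  assumes v: "\<And>S. S \<in> K \<Longrightarrow> sign_vector \<sigma> S (v S)"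
  shows "card K \<le> CARD('n)"
proof -
  have inj: "inj_on v K"
  proof (rule inj_onI)
    fix S T assume ST: "S \<in> K" "T \<in> K" "v S = v T"
    obtain L where L: "\<And>R u. sign_vector \<sigma> R u \<Longrightarrow> L *v u = (if R = S then u else 0)"
      using sign_projection[of \<sigma> S] by blast
    have "L *v v S = v S" "T \<noteq> S \<Longrightarrow> L *v v T = 0"
      using L[OF v[OF ST(1)]] L[OF v[OF ST(2)]] by simp_all
    then show "S = T" using ST v[OF ST(1)] by (auto simp: sign_vector_def)
  qed
  have "vec.independent (v ` K)"
  proof (rule ccontr)
    assume "\<not> ?thesis"
    then obtain u S where u: "(\<Sum>x\<in>v ` K. u x *s x) = 0" and S: "S \<in> K" "u (v S) \<noteq> 0"
      using vec.dependent_finite[of "v ` K"] by auto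
    obtain L where L: "\<And>R u. sign_vector \<sigma> R u \<Longrightarrow> L *v u = (if R = S then u else 0)"
      using sign_projection[of \<sigma> S] by blast
    have "0 = L *v (\<Sum>T\<in>K. u (v T) *s v T)" using u inj by (simp add: sum.reindex)
    also have "\<dots> = (\<Sum>T\<in>K. if T = S then u (v T) *s v T else 0)"
      unfolding vec.sum vec.scale by (rule sum.cong) (auto simp: L[OF v])
    also have "\<dots> = u (v S) *s v S" using S by simp
    finally show False using S v[OF S(1)] by (simp add: sign_vector_def)
  qed
  then have "card (v ` K) \<le> vec.dim (UNIV :: (complex^'n) set)"
    using vec.independent_card_le_dim by blast
  then show ?thesis using inj by (simp add: card_image vec.dim_UNIV card_cart_basis)
qed

text \<open>Binomial coefficients increase strictly up to the middle, so the intermediate ones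
  exceed n choose 1.\<close>

lemma subset_size_extreme:
  assumes "n choose k \<le> n" "0 < k" "k < n"
  shows "k = 1 \<or> k = n - 1"
proof (rule ccontr)
  assume c: "\<not> ?thesis"
  show False
  proof (cases "2 * k \<le> n")
    case True
    then have "n choose 1 < n choose k" using c assms by (intro binomial_strict_mono) auto
    then show False using assms by simp
  next
    case False
    then have "n choose 1 < n choose (n - k)" using c assms by (intro binomial_strict_mono) auto
    then show False using assms by (simp add: binomial_symmetric[symmetric])
  qed
qed

text \<open>\<open>W \<pi>\<close> carries a sign vector for S to one for the image of S under
  \<pi>, so every set of the size of S occurs as a sign set, and independence bounds their number by
  n. One vector for each of the n sets becomes a column of \<open>Q\<close>.\<close>

lemma involutions_diagonalize:
  fixes \<sigma> :: "'n::finite \<Rightarrow> complex^'n^'n"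
  assumes n: "CARD('n) \<ge> 2"
    and sq: "\<And>j. \<sigma> j ** \<sigma> j = mat 1"
    and comm: "\<And>i j. \<sigma> i ** \<sigma> j = \<sigma> j ** \<sigma> i"
    and ne: "\<And>i j. i \<noteq> j \<Longrightarrow> \<sigma> i \<noteq> \<sigma> j"
    and W: "\<And>\<pi>. bij \<pi> \<Longrightarrow> invertible (W \<pi>)" "\<And>\<pi> j. bij \<pi> \<Longrightarrow> W \<pi> ** \<sigma> j = \<sigma> (\<pi> j) ** W \<pi>"
  obtains Q e where "invertible Q" "e = 1 \<or> e = -1" "\<And>j. \<sigma> j ** Q = Q ** (e *\<^sub>m reflection_matrix j)"
proof -
  obtain i j :: 'n where "i \<noteq> j"
    using obtain_subset_with_card_n[OF n] by (metis card_2_iff)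
  then obtain S v where v: "sign_vector \<sigma> S v" "S \<noteq> {}" "S \<noteq> UNIV"
    using exists_sign_vector[of \<sigma>, OF sq comm ne[OF \<open>i \<noteq> j\<close>]] by blast
  have transport: "\<exists>v. sign_vector \<sigma> T v" if T: "card T = card S" for T
  proof -
    obtain f where f: "bij_betw f S T"
      using T finite_same_card_bij[of S T] by auto
    have "card (- S) = card (- T)" using T by (simp add: Compl_eq_Diff_UNIV card_Diff_subset)
    then obtain g where g: "bij_betw g (- S) (- T)"
      using finite_same_card_bij[of "- S" "- T"] by auto
    define \<pi> where "\<pi> x = (if x \<in> S then f x else g x)" for x
    have "bij_betw \<pi> (S \<union> - S) (T \<union> - T)"
      unfolding \<pi>_def using f g by (intro bij_betw_disjoint_Un) auto
    then have \<pi>: "bij \<pi>" by simp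
    have mem: "\<pi> k \<in> T \<longleftrightarrow> k \<in> S" for k
      using f g by (auto simp: \<pi>_def bij_betw_def)
    have "sign_vector \<sigma> T (W \<pi> *v v)"
      unfolding sign_vector_def
    proof (intro conjI allI)
      show "W \<pi> *v v \<noteq> 0"
        using v(1) invertible_inv_mult[OF W(1)[OF \<pi>]] unfolding sign_vector_def
        by (metis matrix_vector_mul_assoc matrix_vector_mul_lid matrix_vector_mult_0_right)
      fix l
      obtain k where k: "l = \<pi> k" using \<pi> by (metis bij_pointE)
      have "\<sigma> l *v (W \<pi> *v v) = W \<pi> *v (\<sigma> k *v v)"
        by (simp add: k matrix_vector_mul_assoc W(2)[OF \<pi>])
      also have "\<sigma> k *v v = (if l \<in> T then -1 else 1) *s v"
        using v(1) mem unfolding sign_vector_def k by simp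
      finally show "\<sigma> l *v (W \<pi> *v v) = (if l \<in> T then -1 else 1) *s (W \<pi> *v v)"
        by (simp only: vec.scale)
    qed
    then show ?thesis by blast
  qed
  define V where "V T = (SOME v. sign_vector \<sigma> T v)" for T
  have V: "sign_vector \<sigma> T (V T)" if "card T = card S" for T
    unfolding V_def by (rule someI_ex[OF transport[OF that]])
  have "card {T. T \<subseteq> (UNIV :: 'n set) \<and> card T = card S} \<le> CARD('n)"
    by (rule sign_vectors_independent[of _ \<sigma> V]) (use V in auto)
  then have "CARD('n) choose card S \<le> CARD('n)"
    using n_subsets[of "UNIV :: 'n set" "card S"] by simp
  moreover have "0 < card S" using v(2) by (simp add: card_gt_0_iff)
  moreover have "card S < CARD('n)" using v(3) by (simp add: psubset_card_mono psubsetI)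
  ultimately have k: "card S = 1 \<or> card S = CARD('n) - 1" by (rule subset_size_extreme)
  \<comment> \<open>For size n - 1 the sign sets are complements of points. Each \<sigma> j is then
    minus a reflection in the new basis, and \<open>e\<close> records this sign.\<close>
  define e :: complex where "e = (if card S = 1 then 1 else -1)"
  define T where "T j = (if card S = 1 then {j} else - {j})" for j :: 'n
  have "card (T j) = card S" for j using k by (auto simp: T_def Compl_eq_Diff_UNIV card_Diff_subset)
  then have VT: "sign_vector \<sigma> (T j) (V (T j))" for j by (rule V)
  have injT: "T i = T j \<longleftrightarrow> i = j" for i j by (auto simp: T_def)
  have memT: "(if k \<in> T i then -1 else 1) = e * (if i = k then -1 else 1)" for i k
    by (auto simp: T_def e_def)
  define Q :: "complex^'n^'n" where "Q = (\<chi> i j. V (T j) $ i)"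
  have Qe: "Q *v axis j 1 = V (T j)" for j by (simp add: vec_eq_iff mult_axis_nth Q_def)
  \<comment> \<open>Projecting the combination of columns to the sign set \<open>T j\<close> leaves
    only the j-th term.\<close>
  have "x = 0" if x: "Q *v x = 0" for x
  proof -
    have "x $ j = 0" for j
    proof -
      obtain L where L: "\<And>R u. sign_vector \<sigma> R u \<Longrightarrow> L *v u = (if R = T j then u else 0)"
        using sign_projection[of \<sigma> "T j"] by blast
      have "Q *v x = (\<Sum>i\<in>UNIV. x $ i *s V (T i))"
        by (simp add: vec_eq_iff Q_def matrix_vector_mult_def sum_component mult.commute)
      then have "0 = L *v (\<Sum>i\<in>UNIV. x $ i *s V (T i))" using x by simp
      also have "\<dots> = (\<Sum>i\<in>UNIV. if i = j then x $ i *s V (T i) else 0)"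
        unfolding vec.sum vec.scale by (rule sum.cong) (auto simp: L[OF VT] injT)
      also have "\<dots> = x $ j *s V (T j)" by simp
      finally show ?thesis using VT[of j] by (simp add: sign_vector_def)
    qed
    then show ?thesis by (simp add: vec_eq_iff)
  qed
  then have "invertible Q" using matrix_left_invertible_ker invertible_left_inverse by blast
  moreover have "\<sigma> j ** Q = Q ** (e *\<^sub>m reflection_matrix j)" for j
  proof (rule matrix_eqI_axis)
    fix i
    have "\<sigma> j ** Q *v axis i 1 = (if j \<in> T i then -1 else 1) *s V (T i)"
      using VT[of i] by (simp add: matrix_vector_mul_assoc[symmetric] Qe sign_vector_def)
    also have "\<dots> = Q ** (e *\<^sub>m reflection_matrix j) *v axis i 1"
      unfolding memT by (simp add: matrix_vector_mul_assoc[symmetric] cscale_mult_vec reflection_matrix_def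
        diag_matrix_mult_axis vec.scale Qe vector_smult_assoc)
    finally show "\<sigma> j ** Q *v axis i 1 = Q ** (e *\<^sub>m reflection_matrix j) *v axis i 1" .
  qed
  ultimately show ?thesis using that[of Q e] by (simp add: e_def)
qed

section \<open>Discreteness and one-parameter subgroups\<close>

lemma ln_power_int: "(a :: real) > 0 \<Longrightarrow> ln (a powi k) = of_int k * ln a"
  by (simp add: powr_real_of_int'[symmetric] ln_powr)

lemma power_int_inj:
  assumes "(a :: real) > 0" "a \<noteq> 1" "a powi j = a powi k"
  shows "j = k"
proof -
  have "of_int j * ln a = of_int k * ln a"
    using ln_power_int[OF assms(1)] assms(3) by metis
  then show ?thesis using assms by simp
qed

lemma continuous_integer_valued_constant:
  fixes f :: "'a::topological_space \<Rightarrow> 'b::real_normed_algebra_1"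
  assumes S: "connected S" "continuous_on S f" and int: "\<And>x. x \<in> S \<Longrightarrow> \<exists>k::int. f x = of_int k"
    and "x \<in> S" "y \<in> S"
  shows "f x = f y"
proof -
  have "f constant_on S"
  proof (rule continuous_discrete_range_constant[OF S])
    fix x assume "x \<in> S"
    have "1 \<le> norm (f y - f x)" if y: "y \<in> S" "f y \<noteq> f x" for y
    proof -
      obtain k l :: int where "f x = of_int k" "f y = of_int l"
        using int[OF \<open>x \<in> S\<close>] int[OF y(1)] by blast
      then have "norm (f y - f x) = of_int \<bar>l - k\<bar>" "k \<noteq> l"
        using y by (auto simp flip: of_int_diff simp: norm_of_int)
      then show ?thesis by linarith
    qed
    then show "\<exists>e>0. \<forall>y. y \<in> S \<and> f y \<noteq> f x \<longrightarrow> e \<le> norm (f y - f x)" by (intro exI[of _ 1]) auto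
  qed
  then show ?thesis using assms(4,5) by (auto simp: constant_on_def)
qed

text \<open>The logarithm to base a makes the values integers. This lemma freezes the unknown
  exponent of \<open>d\<close> along connected families of lifts.\<close>

lemma continuous_power_int_valued_constant:
  fixes f :: "'a::topological_space \<Rightarrow> real"
  assumes S: "connected S" "continuous_on S f" and a: "a > 0" "a \<noteq> 1"
    and pow: "\<And>x. x \<in> S \<Longrightarrow> \<exists>k::int. f x = a powi k"
    and "x \<in> S" "y \<in> S"
  shows "f x = f y"
proof -
  have pos: "f x > 0" if "x \<in> S" for x using pow[OF that] a by auto
  have "ln (f x) / ln a = ln (f y) / ln a"
  proof (rule continuous_integer_valued_constant[OF S(1) _ _ assms(6,7)])
    show "continuous_on S (\<lambda>x. ln (f x) / ln a)"
      using pos a by (intro continuous_intros S(2)) force+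
    show "\<exists>k::int. ln (f x) / ln a = of_int k" if "x \<in> S" for x
      using pow[OF that] a by (auto simp: ln_power_int)
  qed
  then show ?thesis using a pos[OF assms(6)] pos[OF assms(7)] by simp
qed

text \<open>Cauchy's functional equation: the deviation \<open>e\<close> from the linear function is
  additive and vanishes at 1, hence on the rationals, hence everywhere by continuity.\<close>

lemma continuous_additive_linear:
  fixes h :: "real \<Rightarrow> complex"
  assumes cont: "continuous_on UNIV h" and add: "\<And>x y. h (x + y) = h x + h y"
  shows "h x = of_real x * h 1"
proof -
  define e where "e x = h x - of_real x * h 1" for x
  have e_add: "e (x + y) = e x + e y" for x y by (simp add: e_def add algebra_simps)
  have e0: "e 0 = 0" using e_add[of 0 0] by simp
  have e1: "e 1 = 0" by (simp add: e_def)
  have e_nat: "e (real n * x) = of_nat n * e x" for n x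
    by (induction n) (simp_all add: e0 e_add algebra_simps)
  have e_minus: "e (- x) = - e x" for x using e_add[of x "- x"] e0 by (simp add: eq_neg_iff_add_eq_0 add.commute)
  have e_int: "e (of_int k) = 0" for k
  proof (cases k)
    case (nonneg n)
    then show ?thesis using e_nat[of n 1] e1 by simp
  next
    case (neg n)
    then show ?thesis using e_nat[of "Suc n" 1] e1 e_minus[of "real (Suc n)"] by simp
  qed
  have e_rat: "e x = 0" if x: "x \<in> \<rat>" for x
  proof -
    obtain m n where mn: "n > 0" "x = of_int m / of_int n" using Rats_cases'[OF x] by metis
    then have "real (nat n) * x = of_int m" by simp
    then have "of_nat (nat n) * e x = 0" by (metis e_nat e_int)
    then show ?thesis using mn by simp
  qed
  have "continuous_on (closure \<rat>) e"
    unfolding e_def by (intro continuous_intros continuous_on_subset[OF cont]) auto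
  then have "e x = 0"
    using continuous_constant_on_closure[of \<rat> e 0 x] e_rat by (auto simp: Rats_closure_real)
  then show ?thesis by (simp add: e_def)
qed

text \<open>A continuous logarithm, shifted to vanish at 0, is additive up to a multiple of 2 \<pi>
  i. For fixed y this multiple is a continuous function of x that is 0 at x = 0, so the logarithm is
  additive.\<close>

lemma one_parameter_exp:
  fixes c :: "real \<Rightarrow> complex"
  assumes cont: "continuous_on UNIV c" and mult: "\<And>x y. c (x + y) = c x * c y" and c0: "c 0 = 1"
  obtains l where "\<And>x. c x = exp (l * of_real x)"
proof -
  have nz: "c x \<noteq> 0" for x using mult[of x "-x"] c0 by auto
  have "simply_connected (UNIV :: real set)" "locally path_connected (UNIV :: real set)"
    by (simp_all add: convex_imp_simply_connected open_imp_locally_path_connected)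
  then obtain g where g: "continuous_on UNIV g" "\<And>x. c x = exp (g x)"
    using continuous_logarithm_on_simply_connected[OF cont] nz by (metis UNIV_I)
  define h where "h x = g x - g 0" for x
  have "exp (g 0) = 1" using g(2)[of 0] c0 by simp
  then have exph: "exp (h x) = c x" for x by (simp add: h_def exp_diff g(2))
  have conth: "continuous_on UNIV h" unfolding h_def by (intro continuous_intros g)
  have "h (x + y) = h x + h y" for x y
  proof -
    let ?f = "\<lambda>x. (h (x + y) - h x - h y) / (2 * of_real pi * \<i>)"
    have "?f x = ?f 0"
    proof (rule continuous_integer_valued_constant[of UNIV ?f x 0])
      show "continuous_on UNIV ?f"
        by (intro continuous_intros continuous_on_compose2[OF conth] conth) auto
      show "\<exists>k::int. ?f x = of_int k" for x
      proof -
        have "exp (h (x + y)) = exp (h x + h y)" by (simp add: exph mult exp_add)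
        then obtain n :: int where "h (x + y) = h x + h y + of_int (2 * n) * pi * \<i>"
          by (auto simp: exp_eq)
        then have "?f x = of_int n" by (simp add: field_simps)
        then show ?thesis by blast
      qed
    qed auto
    then show ?thesis by (simp add: h_def algebra_simps)
  qed
  then have "h x = of_real x * h 1" for x by (rule continuous_additive_linear[OF conth])
  then have "c x = exp (h 1 * of_real x)" for x by (metis exph mult.commute)
  then show ?thesis using that by blast
qed

section \<open>Angles modulo full turns\<close>

lemma cis_eq_one_iff: "cis x = 1 \<longleftrightarrow> (\<exists>m::int. x = 2 * pi * of_int m)"
  unfolding cis_conv_exp exp_eq_1 by (auto simp: mult_ac)

lemma cis_eq_cis_iff: "cis x = cis y \<longleftrightarrow> (\<exists>m::int. x = y + 2 * pi * of_int m)"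
proof -
  have "cis x = cis y \<longleftrightarrow> cis (x - y) = 1" by (simp add: cis_divide[symmetric])
  then show ?thesis by (simp add: cis_eq_one_iff algebra_simps)
qed

lemma prod_cis: "(\<Prod>i\<in>I. cis (f i)) = cis (\<Sum>i\<in>I. f i)"
  by (induction I rule: infinite_finite_induct) (simp_all add: cis_mult)

section \<open>Multivalued linear lifts of the unitary group\<close>

text \<open>\<open>L A M\<close> stands for: the linear map \<open>M\<close> of \<open>\<complex>\<^sup>n\<close> lies over the transformation of the Hopf
  manifold given by \<open>A\<close>.\<close>

locale lift_family =
  fixes d :: complex and L :: "complex^'n^'n \<Rightarrow> complex^'n^'n \<Rightarrow> bool"
  assumes dim: "CARD('n) \<ge> 2" and d: "d \<noteq> 0" "norm d \<noteq> 1"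
    and inv: "L A M \<Longrightarrow> invertible M"
    and mult: "L A M \<Longrightarrow> L B N \<Longrightarrow> L (A ** B) (M ** N)"
    and uniq: "L A M \<Longrightarrow> L A N \<Longrightarrow> \<exists>k::int. N = (d powi k) *\<^sub>m M"
    and scale: "L A M \<Longrightarrow> L A ((d powi k) *\<^sub>m M)"
    and faithful: "L A (mat 1) \<Longrightarrow> A = mat 1"
    and path: "continuous_on UNIV \<gamma> \<Longrightarrow> (\<And>\<theta>::real. unitary_matrix (\<gamma> \<theta>)) \<Longrightarrow>
      \<exists>M. continuous_on UNIV M \<and> (\<forall>\<theta>. L (\<gamma> \<theta>) (M \<theta>))"
begin

section \<open>Calculus of lifts modulo powers of d\<close>

lemma exists_lift: "unitary_matrix A \<Longrightarrow> \<exists>M. L A M"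
  using path[of "\<lambda>_. A"] by auto

lemma scale_cancel: "L A ((d powi k) *\<^sub>m M) \<Longrightarrow> L A M"
  using scale[of A "(d powi k) *\<^sub>m M" "- k"] d
  by (simp add: cscale_cscale power_int_minus)

text \<open>Any lift M of the identity satisfies M M = \<open>d powi k\<close> M; cancelling M shows
  that M is itself a power of \<open>d\<close>.\<close>

lemma one: "L (mat 1) (mat 1)"
proof -
  obtain M where M: "L (mat 1) M" using exists_lift unitary_mat_1 by blast
  obtain k where "M ** M = (d powi k) *\<^sub>m M" using uniq[OF M] mult[OF M M] by auto
  then have "matrix_inv M ** (M ** M) = (d powi k) *\<^sub>m mat 1"
    using inv[OF M] by (simp add: cscale_mult_right invertible_inv_mult)
  then have "M = (d powi k) *\<^sub>m mat 1" using inv[OF M]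
    by (simp add: matrix_mul_assoc invertible_inv_mult)
  then show ?thesis using M scale_cancel by metis
qed

lemma det_nonzero: "L A M \<Longrightarrow> det M \<noteq> 0"
  using inv invertible_det_nz by blast

text \<open>The factor \<open>d powi k\<close> changes the absolute value of the determinant by the
  n-th power of its norm, which is 1 only for k = 0. All equalities of lifts below rest on this
  normalisation.\<close>

lemma uniq_det:
  assumes "L A M" "L A N" "norm (det M) = norm (det N)"
  shows "M = N"
proof -
  obtain k where k: "N = (d powi k) *\<^sub>m M" using uniq[OF assms(1,2)] by blast
  then have "norm (d powi k) ^ CARD('n) = 1"
    using assms(3) det_nonzero[OF assms(1)] by (simp add: det_cscale norm_mult norm_power)
  then have "norm (d powi k) = 1" using power_eq_imp_eq_base[of "norm (d powi k)" "CARD('n)" 1] by simp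
  then have "norm d powi k = norm d powi 0" by (simp add: norm_power_int)
  then have "k = 0" using d by (intro power_int_inj[of "norm d"]) auto
  then show ?thesis using k by simp
qed

text \<open>Both products lie over the same matrix and have the same determinant, so the power of
  \<open>d\<close> between them is trivial.\<close>

lemma commute:
  assumes "L A M" "L B N" "A ** B = B ** A"
  shows "M ** N = N ** M"
proof -
  have "L (A ** B) (N ** M)" using mult[OF assms(2,1)] by (simp only: assms(3))
  moreover have "norm (det (M ** N)) = norm (det (N ** M))" by (simp add: det_mul norm_mult)
  ultimately show ?thesis using uniq_det[OF mult[OF assms(1,2)]] by blast
qed

lemma inverse:
  assumes "L A M" "A ** B = mat 1" "unitary_matrix B"
  shows "L B (matrix_inv M)"
proof -
  obtain N where N: "L B N" using exists_lift[OF assms(3)] by blast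
  have "L (mat 1) (M ** N)" using mult[OF assms(1) N] assms(2) by simp
  then obtain k where "M ** N = (d powi k) *\<^sub>m mat 1" using uniq[OF one] by blast
  then have "matrix_inv M ** (M ** N) = (d powi k) *\<^sub>m matrix_inv M"
    by (simp add: cscale_mult_right)
  then have "N = (d powi k) *\<^sub>m matrix_inv M" using inv[OF assms(1)]
    by (simp add: matrix_mul_assoc invertible_inv_mult)
  then show ?thesis using N scale_cancel by metis
qed

lemma conjugate:
  assumes "L A M" "L B N" "unitary_matrix B"
  shows "L (B ** A ** adjoint_matrix B) (N ** M ** matrix_inv N)"
  using assms(3) by (intro mult inverse[OF assms(2)] assms(1,2))
    (simp_all add: unitary_matrix_def unitary_adjoint)

lemma det_conjugate: "invertible (N :: complex^'n^'n) \<Longrightarrow> det (N ** M ** matrix_inv N) = det M"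
proof -
  assume "invertible N"
  then have "det N * det (matrix_inv N) = 1" by (simp add: invertible_mult_inv flip: det_mul)
  moreover have "det (N ** M ** matrix_inv N) = det M * (det N * det (matrix_inv N))"
    by (simp add: det_mul)
  ultimately show ?thesis by simp
qed

lemma conjugate_perm:
  assumes "L A M" "bij \<pi>" "L (perm_matrix \<pi>) W" "perm_matrix \<pi> ** A = B ** perm_matrix \<pi>"
  shows "L B (W ** M ** matrix_inv W)"
proof -
  have P: "unitary_matrix (perm_matrix \<pi>)" using assms(2) by (rule unitary_perm_matrix)
  then have "perm_matrix \<pi> ** A ** adjoint_matrix (perm_matrix \<pi>) = B"
    unfolding assms(4) by (simp add: matrix_mul_assoc[symmetric] unitary_matrix_def)
  then show ?thesis using conjugate[OF assms(1,3) P] by simp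
qed

text \<open>A change of basis in the space of lifts; it allows the basis \<open>Q\<close> found from
  the reflections to be taken as the standard one.\<close>

lemma conj_family:
  assumes Q: "invertible Q"
  shows "lift_family d (\<lambda>A M. L A (Q ** M ** matrix_inv Q))"
proof
  have iQ: "matrix_inv Q ** Q = mat 1" "Q ** matrix_inv Q = mat 1"
    using Q by (simp_all add: invertible_inv_mult invertible_mult_inv)
  have cancelQ: "matrix_inv Q ** (Q ** M ** matrix_inv Q) ** Q = M" for M
  proof -
    have "matrix_inv Q ** (Q ** M ** matrix_inv Q) ** Q = (matrix_inv Q ** Q) ** M ** (matrix_inv Q ** Q)"
      by (simp only: matrix_mul_assoc)
    then show ?thesis by (simp add: iQ)
  qed
  show "CARD('n) \<ge> 2" "d \<noteq> 0" "norm d \<noteq> 1" using dim d by auto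
  show "invertible M" if "L A (Q ** M ** matrix_inv Q)" for A M
    using invertible_mult[OF invertible_mult[OF _ inv[OF that]] Q, of "matrix_inv Q"] iQ
    unfolding cancelQ by (auto simp: invertible_def)
  show "L (A ** B) (Q ** (M ** N) ** matrix_inv Q)"
    if "L A (Q ** M ** matrix_inv Q)" "L B (Q ** N ** matrix_inv Q)" for A B M N
  proof -
    have "(Q ** M ** matrix_inv Q) ** (Q ** N ** matrix_inv Q)
        = Q ** M ** (matrix_inv Q ** Q) ** N ** matrix_inv Q" by (simp only: matrix_mul_assoc)
    then show ?thesis using mult[OF that] by (simp add: iQ matrix_mul_assoc)
  qed
  show "\<exists>k::int. N = (d powi k) *\<^sub>m M"
    if h: "L A (Q ** M ** matrix_inv Q)" "L A (Q ** N ** matrix_inv Q)" for A M N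
  proof -
    obtain k :: int where "Q ** N ** matrix_inv Q = (d powi k) *\<^sub>m (Q ** M ** matrix_inv Q)"
      using uniq[OF h] by blast
    then have "N = matrix_inv Q ** ((d powi k) *\<^sub>m (Q ** M ** matrix_inv Q)) ** Q"
      using cancelQ[of N] by simp
    then have "N = (d powi k) *\<^sub>m M" by (simp add: cscale_mult_left cscale_mult_right cancelQ)
    then show ?thesis by blast
  qed
  show "L A (Q ** ((d powi k) *\<^sub>m M) ** matrix_inv Q)" if "L A (Q ** M ** matrix_inv Q)" for A M k
    using scale[OF that] by (simp add: cscale_mult_left cscale_mult_right)
  show "A = mat 1" if "L A (Q ** mat 1 ** matrix_inv Q)" for A
    using that faithful by (simp add: iQ)
  show "\<exists>M. continuous_on UNIV M \<and> (\<forall>\<theta>. L (\<gamma> \<theta>) (Q ** M \<theta> ** matrix_inv Q))"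
    if h: "continuous_on UNIV \<gamma>" "\<And>\<theta>::real. unitary_matrix (\<gamma> \<theta>)" for \<gamma>
  proof -
    obtain M where M: "continuous_on UNIV M" "\<forall>\<theta>. L (\<gamma> \<theta>) (M \<theta>)" using path[OF h] by blast
    have "Q ** (matrix_inv Q ** M \<theta> ** Q) ** matrix_inv Q = M \<theta>" for \<theta>
    proof -
      have "Q ** (matrix_inv Q ** M \<theta> ** Q) ** matrix_inv Q = (Q ** matrix_inv Q) ** M \<theta> ** (Q ** matrix_inv Q)"
        by (simp only: matrix_mul_assoc)
      then show ?thesis by (simp add: iQ)
    qed
    moreover have "continuous_on UNIV (\<lambda>\<theta>. matrix_inv Q ** M \<theta> ** Q)"
      unfolding matrix_matrix_mult_def by (intro continuous_intros M(1))
    ultimately show ?thesis using M(2) by (intro exI[of _ "\<lambda>\<theta>. matrix_inv Q ** M \<theta> ** Q"]) simp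
  qed
qed

text \<open>The lifts \<open>F j\<close> of the reflections are chosen conjugate to each other.
  Their squares then agree and equal one power of \<open>d\<close>, so division by a common square
  root gives involutions to which \<open>involutions_diagonalize\<close> applies.\<close>

lemma exists_normalization:
  obtains Q \<kappa> where "invertible Q" "\<kappa> \<noteq> 0"
    "\<And>j. L (reflection_matrix j) (Q ** (\<kappa> *\<^sub>m reflection_matrix j) ** matrix_inv Q)"
proof -
  fix m :: 'n
  obtain F0 where F0: "L (reflection_matrix m) F0" using exists_lift unitary_reflection by blast
  define W where "W \<pi> = (SOME M. L (perm_matrix \<pi>) M)" for \<pi> :: "'n \<Rightarrow> 'n"
  have W: "L (perm_matrix \<pi>) (W \<pi>)" if "bij \<pi>" for \<pi>
    unfolding W_def using exists_lift[OF unitary_perm_matrix[OF that]] by (rule someI_ex)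
  \<comment> \<open>Conjugates of the single lift \<open>F0\<close> share its determinant; this is
    what makes \<open>uniq_det\<close> applicable to their squares and to their images under
    permutations.\<close>
  define F where "F j = W (Transposition.transpose m j) ** F0 ** matrix_inv (W (Transposition.transpose m j))" for j
  have F: "L (reflection_matrix j) (F j)" for j
    unfolding F_def
    using conjugate_perm[OF F0 bij_transpose W[OF bij_transpose] perm_matrix_reflection[OF bij_transpose], of m j]
    by simp
  have dF: "det (F j) = det F0" for j
    unfolding F_def by (rule det_conjugate) (auto intro!: inv[OF W])
  have FF: "L (mat 1) (F j ** F j)" for j using mult[OF F F, of j j] by (simp add: reflection_square)
  obtain k where k: "F m ** F m = (d powi k) *\<^sub>m mat 1" using uniq[OF one FF] by blast
  have FFj: "F j ** F j = (d powi k) *\<^sub>m mat 1" for j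
    unfolding k[symmetric] by (rule uniq_det[OF FF FF]) (simp add: det_mul dF)
  \<comment> \<open>The other square root would change the sign of all \<sigma> j at once, a freedom
    of the same kind as the sign \<open>e\<close> obtained below.\<close>
  define \<kappa> where "\<kappa> = csqrt (d powi k)"
  have \<kappa>2: "\<kappa> * \<kappa> = d powi k" unfolding \<kappa>_def by (metis power2_csqrt power2_eq_square)
  then have \<kappa>: "\<kappa> \<noteq> 0" using d by auto
  define \<sigma> where "\<sigma> j = (1 / \<kappa>) *\<^sub>m F j" for j
  have F\<sigma>: "F j = \<kappa> *\<^sub>m \<sigma> j" for j using \<kappa> by (simp add: \<sigma>_def cscale_cscale)
  have "\<sigma> j ** \<sigma> j = mat 1" for j
    using \<kappa> by (simp add: \<sigma>_def cscale_mult_left cscale_mult_right FFj cscale_cscale \<kappa>2[symmetric])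
  moreover have "\<sigma> i ** \<sigma> j = \<sigma> j ** \<sigma> i" for i j
    unfolding \<sigma>_def cscale_mult_left cscale_mult_right commute[OF F F reflection_commute, of i j] ..
  \<comment> \<open>Otherwise \<open>F i ** F i\<close>, a power of \<open>d\<close>, would lie over
    the product of two different reflections, which would then act trivially.\<close>
  moreover have "\<sigma> i \<noteq> \<sigma> j" if "i \<noteq> j" for i j
  proof
    assume "\<sigma> i = \<sigma> j"
    then have "L (reflection_matrix i ** reflection_matrix j) (F i ** F i)"
      using mult[OF F F, of i j] F\<sigma> by metis
    then have "L (reflection_matrix i ** reflection_matrix j) (mat 1)"
      unfolding FFj by (rule scale_cancel)
    then have "reflection_matrix i ** reflection_matrix j = mat 1" by (rule faithful)
    then have "reflection_matrix i ** (reflection_matrix j ** reflection_matrix j) = reflection_matrix j"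
      by (simp add: matrix_mul_assoc)
    then show False using reflection_inj[of i j] that by (simp add: reflection_square)
  qed
  moreover have "invertible (W \<pi>)" if "bij \<pi>" for \<pi> using inv[OF W[OF that]] .
  moreover have "W \<pi> ** \<sigma> j = \<sigma> (\<pi> j) ** W \<pi>" if \<pi>: "bij \<pi>" for \<pi> j
  proof -
    have "W \<pi> ** F j ** matrix_inv (W \<pi>) = F (\<pi> j)"
    proof (rule uniq_det[OF conjugate_perm[OF F \<pi> W[OF \<pi>] perm_matrix_reflection[OF \<pi>]] F])
      show "norm (det (W \<pi> ** F j ** matrix_inv (W \<pi>))) = norm (det (F (\<pi> j)))"
        by (simp add: det_conjugate inv[OF W[OF \<pi>]] dF)
    qed
    then have "F (\<pi> j) ** W \<pi> = W \<pi> ** F j ** (matrix_inv (W \<pi>) ** W \<pi>)"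
      by (metis matrix_mul_assoc)
    then show ?thesis
      by (simp add: \<sigma>_def cscale_mult_left cscale_mult_right invertible_inv_mult[OF inv[OF W[OF \<pi>]]])
  qed
  ultimately obtain Q e where Q: "invertible Q" "e = 1 \<or> e = -1"
    "\<And>j. \<sigma> j ** Q = Q ** (e *\<^sub>m reflection_matrix j)"
    using involutions_diagonalize[OF dim, of \<sigma> W] by metis
  have "F j = Q ** ((\<kappa> * e) *\<^sub>m reflection_matrix j) ** matrix_inv Q" for j
  proof -
    have "Q ** ((\<kappa> * e) *\<^sub>m reflection_matrix j) = \<kappa> *\<^sub>m (Q ** (e *\<^sub>m reflection_matrix j))"
      by (simp only: cscale_mult_right cscale_cscale)
    also have "\<dots> = F j ** Q" unfolding Q(3)[symmetric] by (simp add: F\<sigma> cscale_mult_left)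
    finally show ?thesis
      using Q(1) by (simp add: matrix_mul_assoc[symmetric] invertible_mult_inv)
  qed
  then show ?thesis using that[of Q "\<kappa> * e"] Q \<kappa> F by auto
qed

end

text \<open>The basis is now the one in which each reflection lifts to a multiple of itself. The
  scalar \<kappa> is common to all reflections and includes the sign \<open>e\<close>.\<close>

locale normalized_lift_family = lift_family d L
  for d and L :: "complex^'n^'n \<Rightarrow> complex^'n^'n \<Rightarrow> bool" +
  fixes \<kappa> :: complex
  assumes \<kappa>: "\<kappa> \<noteq> 0" "\<And>j. L (reflection_matrix j) (\<kappa> *\<^sub>m reflection_matrix j)"
begin

text \<open>The lift commutes with the lifts of all reflections, and the entry (i, j) of the
  commutation relation with reflection j equates an off-diagonal entry with its negative.\<close>

lemma diagonal_lift:
  assumes "L (diag_matrix f) M"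
  obtains g where "M = diag_matrix g"
proof -
  have "M $ i $ j = 0" if "i \<noteq> j" for i j
  proof -
    have "diag_matrix f ** reflection_matrix j = reflection_matrix j ** diag_matrix f"
      by (simp add: reflection_matrix_def diag_matrix_mult mult.commute)
    then have "M ** (\<kappa> *\<^sub>m reflection_matrix j) = (\<kappa> *\<^sub>m reflection_matrix j) ** M"
      by (rule commute[OF assms \<kappa>(2)])
    then have "M ** reflection_matrix j = reflection_matrix j ** M"
      using \<kappa>(1) by (simp add: cscale_mult_left cscale_mult_right cscale_cancel)
    then have "(M ** reflection_matrix j) $ i $ j = (reflection_matrix j ** M) $ i $ j" by simp
    then show ?thesis
      using that by (simp add: reflection_matrix_def mult_diag_matrix_nth diag_matrix_mult_nth)
  qed
  then have "M = diag_matrix (\<lambda>i. M $ i $ i)" by (simp add: vec_eq_iff)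
  then show ?thesis using that by blast
qed

text \<open>The lift \<open>W\<close> permutes the reflections exactly as the permutation matrix
  does, which forces its nonzero entries to the same positions. Such a monomial matrix permutes the
  entries of every diagonal matrix.\<close>

lemma perm_lift_diag:
  assumes \<pi>: "bij \<pi>" and W: "L (perm_matrix \<pi>) W"
  shows "W ** diag_matrix (\<lambda>i. f (\<pi> i)) = diag_matrix f ** W"
proof -
  have 1: "W ** reflection_matrix j = reflection_matrix (\<pi> j) ** W" for j
  proof -
    have "W ** (\<kappa> *\<^sub>m reflection_matrix j) ** matrix_inv W = \<kappa> *\<^sub>m reflection_matrix (\<pi> j)"
    proof (rule uniq_det[OF conjugate_perm[OF \<kappa>(2) \<pi> W perm_matrix_reflection[OF \<pi>]] \<kappa>(2)])
      have "det (reflection_matrix i) = -1" for i :: 'n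
        by (simp add: reflection_matrix_def det_diag_matrix)
      then show "norm (det (W ** (\<kappa> *\<^sub>m reflection_matrix j) ** matrix_inv W)) =
          norm (det (\<kappa> *\<^sub>m reflection_matrix (\<pi> j)))"
        by (simp add: det_conjugate[OF inv[OF W]] det_cscale)
    qed
    then have "\<kappa> *\<^sub>m (W ** reflection_matrix j ** matrix_inv W) = \<kappa> *\<^sub>m reflection_matrix (\<pi> j)"
      by (simp only: cscale_mult_left cscale_mult_right)
    then have "W ** reflection_matrix j ** matrix_inv W = reflection_matrix (\<pi> j)"
      using \<kappa>(1) by (simp add: cscale_cancel)
    then have "reflection_matrix (\<pi> j) ** W = W ** reflection_matrix j ** (matrix_inv W ** W)"
      by (metis matrix_mul_assoc)
    then show ?thesis by (simp add: invertible_inv_mult[OF inv[OF W]])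
  qed
  have 2: "W $ i $ j = 0" if "i \<noteq> \<pi> j" for i j
  proof -
    have "(W ** reflection_matrix j) $ i $ j = (reflection_matrix (\<pi> j) ** W) $ i $ j" by (simp add: 1)
    then show ?thesis
      using that by (simp add: reflection_matrix_def mult_diag_matrix_nth diag_matrix_mult_nth)
  qed
  have "W $ i $ j * f (\<pi> j) = f i * W $ i $ j" for i j
    using 2[of i j] by (cases "i = \<pi> j") auto
  then show ?thesis by (simp add: vec_eq_iff mult_diag_matrix_nth diag_matrix_mult_nth)
qed

lemma permute_diagonal_lift:
  assumes \<pi>: "bij \<pi>" and L: "L (diag_matrix (\<lambda>i. f (\<pi> i))) (diag_matrix (\<lambda>i. g (\<pi> i)))"
  shows "L (diag_matrix f) (diag_matrix g)"
proof -
  obtain W where W: "L (perm_matrix \<pi>) W" using exists_lift[OF unitary_perm_matrix[OF \<pi>]] by blast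
  have "W ** diag_matrix (\<lambda>i. g (\<pi> i)) ** matrix_inv W = diag_matrix g"
    unfolding perm_lift_diag[OF \<pi> W]
    by (simp add: matrix_mul_assoc[symmetric] invertible_mult_inv[OF inv[OF W]])
  then show ?thesis using conjugate_perm[OF L \<pi> W perm_matrix_diag] by simp
qed

text \<open>A lift of the circle in coordinate m that starts at the identity is a one-parameter
  group of diagonal matrices, so its entries are exponentials. Permutations fixing m equate the
  exponents at the other coordinates, and moving m to j gives the same \<open>a\<close> and
  \<open>b\<close> for every j.\<close>

lemma coordinate_circle_lift:
  obtains a b where "\<And>j \<theta>. L (diag_matrix (\<lambda>i. if i = j then cis \<theta> else 1))
    (diag_matrix (\<lambda>i. exp ((if i = j then a else b) * of_real \<theta>)))"
proof -
  fix m :: 'n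
  define \<gamma> where "\<gamma> \<theta> = diag_matrix (\<lambda>i. if i = m then cis \<theta> else 1)" for \<theta>
  have "\<gamma> \<theta> = (\<chi> i j. if i = j then if i = m then cis \<theta> else 1 else 0)" for \<theta>
    by (simp add: \<gamma>_def diag_matrix_def)
  moreover have "continuous_on UNIV (\<lambda>\<theta>. \<chi> i j. if i = j then if i = m then cis \<theta> else 1 else 0)"
  proof (intro continuous_on_vec_lambda)
    show "continuous_on UNIV (\<lambda>\<theta>. if i = j then if i = m then cis \<theta> else 1 else 0)" for i j
      by (cases "i = j"; cases "i = m") (auto intro!: continuous_intros)
  qed
  ultimately have "continuous_on UNIV \<gamma>" by presburger
  moreover have "unitary_matrix (\<gamma> \<theta>)" for \<theta>
    unfolding \<gamma>_def by (rule unitary_diag_matrix) simp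
  ultimately obtain M where M: "continuous_on UNIV M" "\<And>\<theta>. L (\<gamma> \<theta>) (M \<theta>)" using path by blast
  have \<gamma>0: "\<gamma> 0 = mat 1" by (simp add: \<gamma>_def diag_matrix_one cong: if_cong)
  obtain k where k: "M 0 = (d powi k) *\<^sub>m mat 1" using uniq[OF one] M(2)[of 0] \<gamma>0 by auto
  \<comment> \<open>The lifted path may start at any power of \<open>d\<close>; dividing it out
    makes the path start at the identity.\<close>
  define N where "N \<theta> = (d powi (- k)) *\<^sub>m M \<theta>" for \<theta>
  have N0: "N 0 = mat 1" using d by (simp add: N_def k cscale_cscale power_int_minus)
  have N: "L (\<gamma> \<theta>) (N \<theta>)" for \<theta> unfolding N_def by (rule scale[OF M(2)])
  have "continuous_on UNIV (\<lambda>\<theta>. \<chi> i j. d powi (- k) * M \<theta> $ i $ j)"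
    by (intro continuous_on_vec_lambda continuous_intros M(1))
  then have contN: "continuous_on UNIV N" unfolding N_def map_matrix_def .
  have contN': "continuous_on UNIV (\<lambda>\<theta>. N \<theta> $ i $ j)" for i j
    by (intro continuous_intros contN)
  have cont_det: "continuous_on UNIV (\<lambda>\<theta>. det (N \<theta>))"
    unfolding det_def by (intro continuous_intros contN')
  have add: "N (\<theta> + \<phi>) = N \<theta> ** N \<phi>" for \<theta> \<phi>
  proof (rule uniq_det)
    have "\<gamma> \<theta> ** \<gamma> \<phi> = \<gamma> (\<theta> + \<phi>)" for \<theta> \<phi>
      unfolding \<gamma>_def diag_matrix_mult by (rule arg_cong[of _ _ diag_matrix]) (auto simp: cis_mult)
    then have prod: "L (\<gamma> (\<theta> + \<phi>)) (N \<theta> ** N \<phi>)" for \<theta> \<phi> using mult[OF N N, of \<theta> \<phi>] by simp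
    show "L (\<gamma> (\<theta> + \<phi>)) (N (\<theta> + \<phi>))" "L (\<gamma> (\<theta> + \<phi>)) (N \<theta> ** N \<phi>)" by (rule N, rule prod)
    \<comment> \<open>This ratio measures the failure of multiplicativity. Both matrices lie over
      \<open>\<gamma> (\<theta> + \<phi>)\<close>, so it is a power of the n-th power of |d|; it is
      continuous in \<theta> and equals 1 at 0.\<close>
    let ?r = "\<lambda>\<theta>. norm (det (N (\<theta> + \<phi>))) / (norm (det (N \<theta>)) * norm (det (N \<phi>)))"
    have "?r \<theta> = ?r 0"
    proof (rule continuous_power_int_valued_constant[of UNIV ?r "norm d ^ CARD('n)" \<theta> 0])
      show "continuous_on UNIV ?r"
        by (intro continuous_intros continuous_on_compose2[OF cont_det] cont_det)
          (auto simp: det_nonzero[OF N])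
      show "norm d ^ CARD('n) \<noteq> 1" using d power_eq_imp_eq_base[of "norm d" "CARD('n)" 1] by auto
      show "\<exists>k::int. ?r \<theta> = (norm d ^ CARD('n)) powi k" for \<theta>
      proof -
        obtain k :: int where "N (\<theta> + \<phi>) = (d powi k) *\<^sub>m (N \<theta> ** N \<phi>)" using uniq[OF prod N] by blast
        then have "?r \<theta> = norm (d powi k) ^ CARD('n)"
          using det_nonzero[OF N] by (simp add: det_cscale det_mul norm_mult norm_power)
        also have "\<dots> = (norm d ^ CARD('n)) powi k"
          by (simp add: norm_power_int power_int_power power_int_power' mult.commute)
        finally show ?thesis by blast
      qed
    qed (use d in auto)
    then have "?r \<theta> = 1" by (simp add: N0 det_nonzero[OF N])
    then show "norm (det (N (\<theta> + \<phi>))) = norm (det (N \<theta> ** N \<phi>))"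
      by (simp add: det_mul norm_mult det_nonzero[OF N] field_simps)
  qed
  define \<alpha> where "\<alpha> i \<theta> = N \<theta> $ i $ i" for i \<theta>
  have N\<alpha>: "N \<theta> = diag_matrix (\<lambda>i. \<alpha> i \<theta>)" for \<theta>
  proof -
    obtain g where "N \<theta> = diag_matrix g" using diagonal_lift N[of \<theta>] unfolding \<gamma>_def by blast
    then show ?thesis by (simp add: \<alpha>_def)
  qed
  have "\<exists>l. \<forall>\<theta>. \<alpha> i \<theta> = exp (l * of_real \<theta>)" for i
  proof -
    have "\<alpha> i (x + y) = \<alpha> i x * \<alpha> i y" for x y
      unfolding \<alpha>_def add by (simp add: N\<alpha>[of x] diag_matrix_mult_nth)
    moreover have "continuous_on UNIV (\<alpha> i)" unfolding \<alpha>_def by (rule contN')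
    moreover have "\<alpha> i 0 = 1" by (simp add: \<alpha>_def N0 mat_def)
    ultimately obtain l where "\<And>\<theta>. \<alpha> i \<theta> = exp (l * of_real \<theta>)"
      using one_parameter_exp[of "\<alpha> i"] by blast
    then show ?thesis by blast
  qed
  then obtain l where l: "\<And>i \<theta>. \<alpha> i \<theta> = exp (l i * of_real \<theta>)" by metis
  \<comment> \<open>Exchanging two coordinates other than m fixes the circle element, so the
    permuted lift lies over the same matrix and has the same determinant.\<close>
  have \<alpha>_eq: "\<alpha> i = \<alpha> j" if ij: "i \<noteq> m" "j \<noteq> m" for i j
  proof
    fix \<theta>
    let ?\<pi> = "Transposition.transpose i j"
    have "L (diag_matrix (\<lambda>i. if i = m then cis \<theta> else 1)) (diag_matrix (\<lambda>k. \<alpha> (?\<pi> k) \<theta>))"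
    proof (rule permute_diagonal_lift[of ?\<pi>])
      have "?\<pi> k = m \<longleftrightarrow> k = m" for k using ij by (auto simp: Transposition.transpose_def)
      then show "L (diag_matrix (\<lambda>k. if ?\<pi> k = m then cis \<theta> else 1)) (diag_matrix (\<lambda>k. \<alpha> (?\<pi> (?\<pi> k)) \<theta>))"
        using N[of \<theta>] by (simp add: \<gamma>_def N\<alpha>)
    qed simp
    then have "L (\<gamma> \<theta>) (diag_matrix (\<lambda>k. \<alpha> (?\<pi> k) \<theta>))" by (simp add: \<gamma>_def)
    then have "diag_matrix (\<lambda>k. \<alpha> (?\<pi> k) \<theta>) = N \<theta>"
    proof (rule uniq_det[OF _ N])
      have "(\<Prod>k\<in>UNIV. \<alpha> (?\<pi> k) \<theta>) = (\<Prod>k\<in>UNIV. \<alpha> k \<theta>)"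
        by (rule prod.reindex_bij_betw[of ?\<pi> UNIV UNIV "\<lambda>k. \<alpha> k \<theta>"]) simp
      then show "norm (det (diag_matrix (\<lambda>k. \<alpha> (?\<pi> k) \<theta>))) = norm (det (N \<theta>))"
        by (simp add: det_diag_matrix N\<alpha>)
    qed
    then have "diag_matrix (\<lambda>k. \<alpha> (?\<pi> k) \<theta>) $ j $ j = N \<theta> $ j $ j" by simp
    then show "\<alpha> i \<theta> = \<alpha> j \<theta>" by (simp add: N\<alpha>)
  qed
  obtain m' where m': "m' \<noteq> m"
    using obtain_subset_with_card_n[OF dim] by (metis card_2_iff)
  have \<alpha>: "\<alpha> i \<theta> = exp ((if i = m then l m else l m') * of_real \<theta>)" for i \<theta>
  proof (cases "i = m")
    case False
    then have "\<alpha> i \<theta> = \<alpha> m' \<theta>" using \<alpha>_eq m' by metis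
    then show ?thesis using False l[of m' \<theta>] by simp
  qed (simp add: l)
  show ?thesis
  proof (rule that[of "l m" "l m'"])
    fix j \<theta>
    let ?\<pi> = "Transposition.transpose m j"
    show "L (diag_matrix (\<lambda>i. if i = j then cis \<theta> else 1))
        (diag_matrix (\<lambda>i. exp ((if i = j then l m else l m') * of_real \<theta>)))"
    proof (rule permute_diagonal_lift[of ?\<pi>])
      have "?\<pi> k = j \<longleftrightarrow> k = m" for k by (auto simp: Transposition.transpose_def)
      then show "L (diag_matrix (\<lambda>k. if ?\<pi> k = j then cis \<theta> else 1))
          (diag_matrix (\<lambda>k. exp ((if ?\<pi> k = j then l m else l m') * of_real \<theta>)))"
        using N[of \<theta>] by (simp only: \<gamma>_def N\<alpha> \<alpha>)
    qed simp
  qed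
qed

text \<open>After a full turn the lift lies over the identity and is a scalar power of
  \<open>d\<close>. Hence exp(2 \<pi> a) = exp(2 \<pi> b), so a - b is an integer multiple q of the
  imaginary unit, and faithfulness leaves q = 1 or q = -1.\<close>

lemma diagonal_torus_lift:
  "\<exists>b k (q :: int). \<bar>q\<bar> = 1 \<and> exp (2 * of_real pi * b :: complex) = d powi k \<and>
    (\<forall>\<theta>. L (diag_matrix (\<lambda>i. cis (\<theta> i)))
       (exp (b * of_real (\<Sum>i\<in>UNIV. \<theta> i)) *\<^sub>m diag_matrix (\<lambda>i. cis (of_int q * \<theta> i))))"
proof -
  obtain a b where ab: "\<And>j \<theta>. L (diag_matrix (\<lambda>i. if i = j then cis \<theta> else 1))
    (diag_matrix (\<lambda>i. exp ((if i = j then a else b) * of_real \<theta>)))"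
    using coordinate_circle_lift by blast
  obtain i0 j0 :: 'n where ij: "i0 \<noteq> j0"
    using obtain_subset_with_card_n[OF dim] by (metis card_2_iff)
  have "L (mat 1) (diag_matrix (\<lambda>i. exp ((if i = i0 then a else b) * of_real (2 * pi))))"
    using ab[of i0 "2 * pi"] by (simp add: diag_matrix_one cong: if_cong)
  then obtain k :: int where k: "diag_matrix (\<lambda>i. exp ((if i = i0 then a else b) * of_real (2 * pi)))
      = (d powi k) *\<^sub>m mat 1"
    using uniq[OF one] by blast
  have "exp ((if i = i0 then a else b) * of_real (2 * pi)) = d powi k" for i
    using arg_cong[OF k, of "\<lambda>M. M $ i $ i"] by (simp add: mat_def)
  from this[of i0] this[of j0] have e: "exp (a * of_real (2 * pi)) = d powi k"
    "exp (b * of_real (2 * pi)) = d powi k" using ij by auto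
  obtain q :: int where "a * of_real (2 * pi) = b * of_real (2 * pi) + of_int (2 * q) * pi * \<i>"
    using e by (metis exp_eq)
  then have "(a - (b + \<i> * of_int q)) * of_real (2 * pi) = 0" by (simp add: algebra_simps)
  then have q: "a = b + \<i> * of_int q" by simp
  have ea: "exp (a * of_real x) = exp (b * of_real x) * cis (of_int q * x)" for x
    by (simp add: q cis_conv_exp exp_add[symmetric] algebra_simps)
  have "L (diag_matrix (\<lambda>i. if i \<in> J then cis (\<theta> i) else 1))
      (diag_matrix (\<lambda>i. exp (b * of_real (\<Sum>i\<in>J. \<theta> i)) * (if i \<in> J then cis (of_int q * \<theta> i) else 1)))"
    if "finite J" for J \<theta>
    using that
  proof (induction J)
    case empty
    then show ?case by (simp add: diag_matrix_one one)
  next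
    case (insert j J)
    have 1: "diag_matrix (\<lambda>i. if i = j then cis (\<theta> j) else 1) ** diag_matrix (\<lambda>i. if i \<in> J then cis (\<theta> i) else 1)
        = diag_matrix (\<lambda>i. if i \<in> insert j J then cis (\<theta> i) else 1)"
      unfolding diag_matrix_mult using insert.hyps(2) by (intro arg_cong[of _ _ diag_matrix]) auto
    have 2: "diag_matrix (\<lambda>i. exp ((if i = j then a else b) * of_real (\<theta> j))) **
        diag_matrix (\<lambda>i. exp (b * of_real (\<Sum>i\<in>J. \<theta> i)) * (if i \<in> J then cis (of_int q * \<theta> i) else 1))
        = diag_matrix (\<lambda>i. exp (b * of_real (\<Sum>i\<in>insert j J. \<theta> i)) *
            (if i \<in> insert j J then cis (of_int q * \<theta> i) else 1))"
      unfolding diag_matrix_mult using insert.hyps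
      by (intro arg_cong[of _ _ diag_matrix]) (auto simp: ea distrib_left exp_add)
    show ?case using mult[OF ab[of j "\<theta> j"] insert.IH] unfolding 1 2 .
  qed
  from this[OF finite[of UNIV]]
  have torus: "L (diag_matrix (\<lambda>i. cis (\<theta> i)))
      (exp (b * of_real (\<Sum>i\<in>UNIV. \<theta> i)) *\<^sub>m diag_matrix (\<lambda>i. cis (of_int q * \<theta> i)))" for \<theta>
    by (simp add: cscale_eq_diag diag_matrix_mult)
  \<comment> \<open>The angles x and -x at two coordinates have sum 0 and satisfy cis(q x) = 1, so
    this torus element lifts to the identity. Faithfulness gives cis x = 1, impossible for x =
    \<pi>; for nonzero q it makes 1 / q an integer.\<close>
  define x where "x = (if q = 0 then pi else 2 * pi / of_int q)"
  have cx: "cis (of_int q * x) = 1" by (simp add: x_def)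
  define \<theta> where "\<theta> i = (if i = i0 then x else 0) - (if i = j0 then x else 0)" for i
  have "cis (of_int q * \<theta> i) = 1" for i
    using ij cx by (auto simp: \<theta>_def cis_cnj[symmetric])
  moreover have "(\<Sum>i\<in>UNIV. \<theta> i) = 0" by (simp add: \<theta>_def sum_subtractf)
  ultimately have "L (diag_matrix (\<lambda>i. cis (\<theta> i))) (mat 1)"
    using torus[of \<theta>] by (simp add: diag_matrix_one)
  then have "diag_matrix (\<lambda>i. cis (\<theta> i)) = mat 1" by (rule faithful)
  then have "diag_matrix (\<lambda>i. cis (\<theta> i)) $ i0 $ i0 = mat 1 $ i0 $ i0" by simp
  then have "cis x = 1" using ij by (simp add: \<theta>_def mat_def)
  then obtain m :: int where m: "x = 2 * pi * of_int m" by (auto simp: cis_eq_one_iff)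
  have "q \<noteq> 0"
  proof
    assume "q = 0"
    then have "2 * real_of_int m = 1" using m by (simp add: x_def)
    then have "2 * m = 1" by linarith
    then show False by presburger
  qed
  then have "real_of_int (q * m) = 1" using m by (simp add: x_def field_simps)
  then have "q * m = 1" by linarith
  then have "\<bar>q\<bar> = 1" using zmult_eq_1_iff by auto
  moreover have "exp (2 * of_real pi * b) = d powi k" using e(2) by (simp add: mult_ac)
  moreover note allI[OF torus]
  ultimately show ?thesis by (intro exI conjI)
qed

text \<open>After the factor exp(b t) is split off, the condition
  \<open>det M = det (\<sigma> A)\<close> selects a unique lift \<open>\<Phi> A\<close>. It is
  multiplicative, fixes the reflections, and has the trace of \<open>\<sigma> A\<close> because A is
  conjugate to a torus element.\<close>

lemma standard_form:
  "\<exists>b k \<sigma> C. (\<sigma> = id \<or> \<sigma> = cnj_matrix) \<and> exp (2 * of_real pi * b :: complex) = d powi k \<and> invertible C \<and>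
    (\<forall>A t. unitary_matrix A \<longrightarrow> det A = cis t \<longrightarrow>
       L A (exp (b * of_real t) *\<^sub>m (C ** \<sigma> A ** matrix_inv C)))"
proof -
  obtain b k and q :: int where q: "\<bar>q\<bar> = 1" and bk: "exp (2 * of_real pi * b :: complex) = d powi k"
    and torus': "\<forall>\<theta>. L (diag_matrix (\<lambda>i. cis (\<theta> i)))
       (exp (b * of_real (\<Sum>i\<in>UNIV. \<theta> i)) *\<^sub>m diag_matrix (\<lambda>i. cis (of_int q * \<theta> i)))"
    using diagonal_torus_lift by (elim exE conjE)
  note torus = spec[OF torus']
  define \<sigma> :: "complex^'n^'n \<Rightarrow> complex^'n^'n" where "\<sigma> = (if q = 1 then id else cnj_matrix)"
  define s :: "complex \<Rightarrow> complex" where "s = (if q = 1 then id else cnj)"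
  have q': "q = 1 \<or> q = -1" using q by linarith
  have s_cis: "s (cis x) = cis (of_int q * x)" for x using q' by (auto simp: s_def cis_cnj)
  have \<sigma>_mult: "\<sigma> (A ** B) = \<sigma> A ** \<sigma> B" for A B by (simp add: \<sigma>_def cnj_matrix_mult)
  have \<sigma>\<sigma>: "\<sigma> (\<sigma> A) = A" for A by (simp add: \<sigma>_def vec_eq_iff)
  have \<sigma>_unitary: "unitary_matrix (\<sigma> A)" if "unitary_matrix A" for A
    using that by (simp add: \<sigma>_def unitary_cnj)
  have \<sigma>_refl: "\<sigma> (reflection_matrix j) = reflection_matrix j" for j
    by (simp add: \<sigma>_def vec_eq_iff reflection_matrix_def)
  have s_det: "det (\<sigma> A) = s (det A)" for A by (simp add: \<sigma>_def s_def det_cnj_matrix)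
  have s_trace: "trace (\<sigma> A) = s (trace A)" for A by (simp add: \<sigma>_def s_def trace_def)
  have s_sum: "s (sum f I) = (\<Sum>i\<in>I. s (f i))" for f :: "'n \<Rightarrow> complex" and I by (simp add: s_def)
  have s_prod: "s (prod f I) = (\<Prod>i\<in>I. s (f i))" for f :: "'n \<Rightarrow> complex" and I by (simp add: s_def)
  have ex: "\<exists>M. L A (exp (b * of_real t) *\<^sub>m M) \<and> det M = det (\<sigma> A) \<and> trace M = trace (\<sigma> A)"
    if A: "unitary_matrix A" and t: "det A = cis t" for A t
  proof -
    obtain U \<theta> where U: "unitary_matrix U" "A = U ** diag_matrix (\<lambda>i. cis (\<theta> i)) ** adjoint_matrix U"
      using unitary_spectral[OF A] .
    have iU: "adjoint_matrix U ** U = mat 1" using U(1) by (simp add: unitary_matrix_def)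
    have tr_inv: "trace (X ** Y ** Z) = trace Y" if "Z ** X = mat 1" for X Y Z :: "complex^'n^'n"
      using that by (simp add: trace_mul_sym[of _ Z] matrix_mul_assoc)
    have det_inv: "det (X ** Y ** Z) = det Y" if "Z ** X = mat 1" for X Y Z :: "complex^'n^'n"
    proof -
      have "det Z * det X = 1" using that by (simp flip: det_mul)
      moreover have "det (X ** Y ** Z) = det Y * (det Z * det X)" by (simp add: det_mul)
      ultimately show ?thesis by simp
    qed
    have dA: "det A = (\<Prod>i\<in>UNIV. cis (\<theta> i))" "trace A = (\<Sum>i\<in>UNIV. cis (\<theta> i))"
      unfolding U(2) det_inv[OF iU] tr_inv[OF iU] by (simp_all add: det_diag_matrix trace_def)
    then have "cis (\<Sum>i\<in>UNIV. \<theta> i) = cis t" using t by (simp add: prod_cis)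
    then obtain m :: int where m: "(\<Sum>i\<in>UNIV. \<theta> i) = t + 2 * pi * of_int m"
      by (auto simp: cis_eq_cis_iff)
    \<comment> \<open>The angles of the eigenvalues add up to t only modulo 2 \<pi>. The excess is
      removed from one angle, which changes neither the diagonal matrix nor the choice of t.\<close>
    fix i0 :: 'n
    define \<phi> where "\<phi> i = \<theta> i - (if i = i0 then 2 * pi * of_int m else 0)" for i
    have \<phi>t: "(\<Sum>i\<in>UNIV. \<phi> i) = t" by (simp add: \<phi>_def sum_subtractf m)
    have \<phi>: "cis (\<phi> i) = cis (\<theta> i)" for i
      by (simp add: \<phi>_def cis_divide[symmetric])
    obtain V where V: "L U V" using exists_lift[OF U(1)] by blast
    let ?D = "diag_matrix (\<lambda>i. cis (of_int q * \<phi> i))"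
    let ?M = "V ** ?D ** matrix_inv V"
    have "L A (exp (b * of_real t) *\<^sub>m ?M)"
      using conjugate[OF torus[of \<phi>] V U(1)] unfolding \<phi>t \<phi> U(2)[symmetric]
      by (simp add: cscale_mult_left cscale_mult_right)
    moreover have iV: "matrix_inv V ** V = mat 1" using inv[OF V] by (rule invertible_inv_mult)
    have "det ?M = det (\<sigma> A)" "trace ?M = trace (\<sigma> A)"
      unfolding det_inv[OF iV] tr_inv[OF iV] s_det s_trace dA s_sum s_prod
      by (simp_all add: det_diag_matrix trace_def s_cis[symmetric] \<phi>)
    ultimately show ?thesis by blast
  qed
  \<comment> \<open>Changing t by m full turns multiplies the factor by exp(2 \<pi> b m), a power of
    \<open>d\<close>, so any logarithm of the determinant may be used.\<close>
  have shift: "L A (exp (b * of_real t') *\<^sub>m M)" if h: "L A (exp (b * of_real t) *\<^sub>m M)" "cis t = cis t'" for A M t t'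
  proof -
    obtain m :: int where m: "t' = t + 2 * pi * of_int m" using h(2) cis_eq_cis_iff by metis
    have "exp (b * of_real t') = exp (of_int m * (2 * of_real pi * b)) * exp (b * of_real t)"
      by (simp add: m algebra_simps flip: exp_add)
    also have "exp (of_int m * (2 * of_real pi * b)) = d powi (k * m)"
      using exp_power_int[of "2 * of_real pi * b" m] bk by (simp add: power_int_mult)
    finally show ?thesis using scale[OF h(1), of "k * m"] by (simp add: cscale_cscale)
  qed
  define P where "P A M \<longleftrightarrow> (\<exists>t. det A = cis t \<and> L A (exp (b * of_real t) *\<^sub>m M)) \<and> det M = det (\<sigma> A)" for A M
  have P_unique: "M = N" if P: "P A M" "P A N" for A M N
  proof -
    obtain t t' where t: "det A = cis t" "L A (exp (b * of_real t) *\<^sub>m M)"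
      "det A = cis t'" "L A (exp (b * of_real t') *\<^sub>m N)" using P unfolding P_def by blast
    have "L A (exp (b * of_real t) *\<^sub>m N)" using shift[OF t(4)] t(1,3) by simp
    moreover have "norm (det (exp (b * of_real t) *\<^sub>m M)) = norm (det (exp (b * of_real t) *\<^sub>m N))"
      using P by (simp add: det_cscale P_def)
    ultimately have "exp (b * of_real t) *\<^sub>m M = exp (b * of_real t) *\<^sub>m N" using uniq_det[OF t(2)] by blast
    then show ?thesis using cscale_cancel[OF exp_not_eq_zero] by blast
  qed
  have det_cis: "\<exists>t. det A = cis t" if "unitary_matrix A" for A :: "complex^'n^'n"
  proof -
    have "cis (Arg (det A)) = det A"
      using norm_det_unitary[OF that]
      by (rule cis_Arg_norm_one)
    then show ?thesis by metis
  qed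
  have P_ex: "\<exists>M. P A M \<and> trace M = trace (\<sigma> A)" if "unitary_matrix A" for A
    using det_cis[OF that] ex[OF that] unfolding P_def by blast
  define \<Phi> where "\<Phi> A = (THE M. P A M)" for A
  have \<Phi>_eq: "\<Phi> A = M" if "P A M" for A M
    unfolding \<Phi>_def using that P_unique by (intro the_equality)
  have \<Phi>: "P A (\<Phi> A)" "trace (\<Phi> A) = trace (\<sigma> A)" if A: "unitary_matrix A" for A
  proof -
    obtain M where M: "P A M" "trace M = trace (\<sigma> A)" using P_ex[OF A] by blast
    then show "P A (\<Phi> A)" "trace (\<Phi> A) = trace (\<sigma> A)" using \<Phi>_eq[OF M(1)] by auto
  qed
  have \<Phi>_mult: "\<Phi> (A ** B) = \<Phi> A ** \<Phi> B" if AB: "unitary_matrix A" "unitary_matrix B" for A B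
  proof (rule \<Phi>_eq)
    obtain t t' where t: "det A = cis t" "L A (exp (b * of_real t) *\<^sub>m \<Phi> A)"
      "det B = cis t'" "L B (exp (b * of_real t') *\<^sub>m \<Phi> B)"
      using \<Phi>(1)[OF AB(1)] \<Phi>(1)[OF AB(2)] unfolding P_def by blast
    have "L (A ** B) (exp (b * of_real (t + t')) *\<^sub>m (\<Phi> A ** \<Phi> B))"
      using mult[OF t(2,4)] by (simp add: cscale_mult_left cscale_mult_right cscale_cscale distrib_left exp_add mult.commute)
    moreover have "det (A ** B) = cis (t + t')" using t(1,3) by (simp add: det_mul cis_mult)
    moreover have "det (\<Phi> A ** \<Phi> B) = det (\<sigma> (A ** B))"
      using \<Phi>(1)[OF AB(1)] \<Phi>(1)[OF AB(2)] unfolding P_def by (simp add: det_mul \<sigma>_mult)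
    ultimately show "P (A ** B) (\<Phi> A ** \<Phi> B)" unfolding P_def by blast
  qed
  have \<Phi>_refl: "\<Phi> (reflection_matrix j) = reflection_matrix j" for j
  proof (rule \<Phi>_eq)
    let ?\<theta> = "\<lambda>i. if i = j then pi else 0"
    have cq: "cis (of_int q * pi) = -1" using q' by (auto simp: cis_cnj[symmetric])
    have "diag_matrix (\<lambda>i. cis (?\<theta> i)) = reflection_matrix j"
      unfolding reflection_matrix_def by (rule arg_cong[of _ _ diag_matrix]) auto
    moreover have "diag_matrix (\<lambda>i. cis (of_int q * ?\<theta> i)) = reflection_matrix j"
      unfolding reflection_matrix_def by (rule arg_cong[of _ _ diag_matrix]) (auto simp: cq)
    ultimately have "L (reflection_matrix j) (exp (b * of_real pi) *\<^sub>m reflection_matrix j)"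
      using torus[of ?\<theta>] by simp
    moreover have "det (reflection_matrix j) = cis pi"
      by (simp add: reflection_matrix_def det_diag_matrix)
    ultimately show "P (reflection_matrix j) (reflection_matrix j)" unfolding P_def \<sigma>_refl by blast
  qed
  \<comment> \<open>Precomposition with \<sigma> removes the conjugation: since \<sigma> is an
    involution, \<open>\<Phi> (\<sigma> A)\<close> has the trace of A itself.\<close>
  obtain c where c: "\<And>i. c i \<noteq> 0"
    "\<And>A. unitary_matrix A \<Longrightarrow> \<Phi> (\<sigma> A) ** diag_matrix c = diag_matrix c ** A"
  proof (rule trace_preserving_conjugate[of "\<lambda>A. \<Phi> (\<sigma> A)"])
    show "\<Phi> (\<sigma> (A ** B)) = \<Phi> (\<sigma> A) ** \<Phi> (\<sigma> B)" if "unitary_matrix A" "unitary_matrix B" for A B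
      using that by (simp add: \<sigma>_mult \<Phi>_mult \<sigma>_unitary)
    show "\<Phi> (\<sigma> (reflection_matrix j)) = reflection_matrix j" for j by (simp add: \<sigma>_refl \<Phi>_refl)
    show "trace (\<Phi> (\<sigma> A)) = trace A" if "unitary_matrix A" for A
      using \<Phi>(2)[OF \<sigma>_unitary[OF that]] by (simp add: \<sigma>\<sigma>)
  qed blast
  have C: "invertible (diag_matrix c)"
    using c(1) by (simp add: invertible_det_nz det_diag_matrix)
  have "\<Phi> A = diag_matrix c ** \<sigma> A ** matrix_inv (diag_matrix c)" if A: "unitary_matrix A" for A
    using c(2)[OF \<sigma>_unitary[OF A], symmetric]
    by (simp add: \<sigma>\<sigma> matrix_mul_assoc[symmetric] invertible_mult_inv[OF C])
  moreover have "L A (exp (b * of_real t) *\<^sub>m \<Phi> A)" if A: "unitary_matrix A" "det A = cis t" for A t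
    using \<Phi>(1)[OF A(1)] A(2) shift unfolding P_def by metis
  ultimately have "\<forall>A t. unitary_matrix A \<longrightarrow> det A = cis t \<longrightarrow>
      L A (exp (b * of_real t) *\<^sub>m (diag_matrix c ** \<sigma> A ** matrix_inv (diag_matrix c)))"
    by simp
  moreover have "\<sigma> = id \<or> \<sigma> = cnj_matrix" by (simp add: \<sigma>_def)
  ultimately show ?thesis using C bk by blast
qed

end

theorem (in lift_family) standard_form_up_to_conjugation:
  "\<exists>b k \<sigma> C. (\<sigma> = id \<or> \<sigma> = cnj_matrix) \<and> exp (2 * of_real pi * b :: complex) = d powi k \<and> invertible C \<and>
    (\<forall>A t. unitary_matrix A \<longrightarrow> det A = cis t \<longrightarrow>
       L A (exp (b * of_real t) *\<^sub>m (C ** \<sigma> A ** matrix_inv C)))"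
proof -
  obtain Q \<kappa> where Q: "invertible Q" "\<kappa> \<noteq> 0"
    "\<And>j. L (reflection_matrix j) (Q ** (\<kappa> *\<^sub>m reflection_matrix j) ** matrix_inv Q)"
    using exists_normalization by blast
  interpret N: normalized_lift_family d "\<lambda>A M. L A (Q ** M ** matrix_inv Q)" \<kappa>
    by (intro normalized_lift_family.intro normalized_lift_family_axioms.intro conj_family Q)
  obtain b k \<sigma> C where C: "\<sigma> = id \<or> \<sigma> = cnj_matrix" "exp (2 * of_real pi * b :: complex) = d powi k" "invertible C"
    "\<forall>A t. unitary_matrix A \<longrightarrow> det A = cis t \<longrightarrow>
       L A (Q ** (exp (b * of_real t) *\<^sub>m (C ** \<sigma> A ** matrix_inv C)) ** matrix_inv Q)"
    using N.standard_form by (elim exE conjE)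
  have QC: "invertible (Q ** C)" using Q(1) C(3) by (rule invertible_mult)
  have "matrix_inv (Q ** C) = matrix_inv C ** matrix_inv Q"
  proof -
    have "(matrix_inv C ** matrix_inv Q) ** (Q ** C) = matrix_inv C ** (matrix_inv Q ** Q) ** C"
      by (simp only: matrix_mul_assoc)
    then have "(matrix_inv C ** matrix_inv Q) ** (Q ** C) = mat 1"
      using Q(1) C(3) by (simp add: invertible_inv_mult)
    then have "(matrix_inv C ** matrix_inv Q) ** ((Q ** C) ** matrix_inv (Q ** C)) = matrix_inv (Q ** C)"
      by (simp add: matrix_mul_assoc)
    then show ?thesis by (simp add: invertible_mult_inv[OF QC])
  qed
  then have eq: "Q ** (e *\<^sub>m (C ** X ** matrix_inv C)) ** matrix_inv Q
      = e *\<^sub>m ((Q ** C) ** X ** matrix_inv (Q ** C))" for e X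
    by (simp add: cscale_mult_left cscale_mult_right matrix_mul_assoc)
  show ?thesis using C(1,2,4) QC unfolding eq by blast
qed

section \<open>Homogeneous holomorphic maps\<close>

text \<open>Reduction to one complex variable: complex linearity of the derivative makes its
  restriction to the line multiplication by a number.\<close>

lemma vec_holomorphic_on_line:
  fixes G :: "complex^'n \<Rightarrow> complex^'n"
  assumes G: "G vec_holomorphic_on - {0}" and line: "\<And>l. z + l *s w \<noteq> 0"
  shows "(\<lambda>l. G (z + l *s w) $ i) holomorphic_on UNIV"
  unfolding holomorphic_on_def
proof
  fix l
  obtain f' where f': "(G has_derivative f') (at (z + l *s w))" "Vector_Spaces.linear (*s) (*s) f'"
    using G line[of l] unfolding vec_holomorphic_on_def by auto
  have "bounded_linear (\<lambda>m. m *s w)"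
    by (rule bounded_linear_intro[where K = "norm w"])
      (auto simp: vec_eq_iff algebra_simps norm_vec_smult)
  then have "((\<lambda>m. z + m *s w) has_derivative (\<lambda>m. m *s w)) (at l)"
    by (auto intro!: derivative_eq_intros bounded_linear_imp_has_derivative)
  from has_derivative_compose[OF this f'(1)]
  have "((\<lambda>m. G (z + m *s w)) has_derivative (\<lambda>m. f' (m *s w))) (at l)" .
  then have "((\<lambda>m. G (z + m *s w) $ i) has_derivative (\<lambda>m. f' (m *s w) $ i)) (at l)"
    by (rule bounded_linear.has_derivative[OF bounded_linear_vec_nth])
  moreover have "f' (m *s w) $ i = f' w $ i * m" for m
    using f'(2) by (simp add: Vector_Spaces.linear_iff mult.commute)
  ultimately have "((\<lambda>m. G (z + m *s w) $ i) has_field_derivative f' w $ i) (at l)"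
    by (simp add: has_field_derivative_def)
  then show "(\<lambda>m. G (z + m *s w) $ i) field_differentiable at l within UNIV"
    by (auto simp: field_differentiable_def)
qed

lemma vec_holomorphic_continuous_on:
  "G vec_holomorphic_on S \<Longrightarrow> continuous_on S G"
  unfolding vec_holomorphic_on_def
  by (meson continuous_at_imp_continuous_on has_derivative_continuous)

text \<open>A power of \<open>D\<close> brings every nonzero vector into the compact shell of norms
  between 1 and |D|, where the continuous function g is bounded.\<close>

lemma scale_invariant_bounded:
  fixes g :: "complex^'n \<Rightarrow> real"
  assumes D: "norm D > 1" and cont: "continuous_on (- {0}) g"
    and inv: "\<And>z. z \<noteq> 0 \<Longrightarrow> g (D *s z) = g z"
  obtains K where "K > 0" "\<And>z. z \<noteq> 0 \<Longrightarrow> g z \<le> K"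
proof -
  let ?S = "cball 0 (norm D) - ball (0 :: complex^'n) 1"
  have D0: "D \<noteq> 0" using D by auto
  have "compact ?S" by (intro compact_diff) auto
  moreover have "continuous_on ?S g" by (rule continuous_on_subset[OF cont]) auto
  ultimately have "bounded (g ` ?S)" by (intro compact_imp_bounded compact_continuous_image)
  then obtain K where "\<forall>y\<in>g ` ?S. norm y \<le> K" unfolding bounded_iff by blast
  then have K: "\<bar>g z\<bar> \<le> K" if "z \<in> ?S" for z using that by (metis image_eqI real_norm_def)
  have inv_nat: "g (D ^ k *s z) = g z" if "z \<noteq> 0" for z k
  proof (induction k)
    case (Suc k)
    have "D ^ Suc k *s z = D *s (D ^ k *s z)" by (simp add: vector_smult_assoc)
    moreover have "D ^ k *s z \<noteq> 0" using that D0 by simp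
    ultimately show ?case using inv Suc by metis
  qed simp
  have inv_int: "g (D powi k *s z) = g z" if "z \<noteq> 0" for z and k :: int
  proof (cases "k \<ge> 0")
    case True
    then show ?thesis using inv_nat[OF that] by (simp add: power_int_def)
  next
    case False
    have "D powi k *s z \<noteq> 0" using that D0 by simp
    then have "g (D powi k *s z) = g (D ^ nat (- k) *s (D powi k *s z))" by (rule inv_nat[symmetric])
    also have "D ^ nat (- k) *s (D powi k *s z) = z"
      using False D0 by (simp add: vector_smult_assoc power_int_def flip: power_mult_distrib)
    finally show ?thesis .
  qed
  have "g z \<le> \<bar>K\<bar> + 1" if z: "z \<noteq> 0" for z
  proof -
    \<comment> \<open>The integer part of the logarithm of |z| to base |D|, so that
      \<open>D powi (- m)\<close> moves z into the shell.\<close>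
    define m where "m = \<lfloor>ln (norm z) / ln (norm D)\<rfloor>"
    have lD: "ln (norm D) > 0" by (rule ln_gt_zero[OF D])
    let ?y = "D powi (- m) *s z"
    have "norm ?y = norm D powr (- of_int m) * norm z"
      using D0 by (simp add: norm_vec_smult norm_power_int powr_real_of_int'[symmetric] flip: of_int_minus)
    also have "\<dots> = exp (ln (norm z) - of_int m * ln (norm D))"
      using D0 z by (simp add: powr_def exp_diff exp_minus field_simps)
    finally have y: "norm ?y = exp (ln (norm z) - of_int m * ln (norm D))" .
    have m: "of_int m \<le> ln (norm z) / ln (norm D)" "ln (norm z) / ln (norm D) \<le> of_int m + 1"
      unfolding m_def by linarith+
    have "0 \<le> ln (norm z) - of_int m * ln (norm D)" "ln (norm z) - of_int m * ln (norm D) \<le> ln (norm D)"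
      using m lD by (simp_all add: field_simps)
    moreover have "exp (ln (norm D)) = norm D" using D0 by simp
    ultimately have "1 \<le> norm ?y" "norm ?y \<le> norm D" unfolding y by (simp, metis exp_le_cancel_iff)
    then have "?y \<in> ?S" by auto
    then have "\<bar>g ?y\<bar> \<le> K" by (rule K)
    then show ?thesis using inv_int[OF z] by simp
  qed
  then show ?thesis using that[of "\<bar>K\<bar> + 1"] by auto
qed

text \<open>A coordinate vector z in a direction other than that of some nonzero coordinate of w is
  linearly independent of w, so both affine lines miss the origin.\<close>

lemma exists_transversal:
  fixes w :: "complex^'n"
  assumes n: "CARD('n) \<ge> 2" and w: "w \<noteq> 0"
  obtains z where "z \<noteq> 0" "\<And>l. z + l *s w \<noteq> 0" "\<And>l. w + l *s z \<noteq> 0"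
proof -
  obtain i where i: "w $ i \<noteq> 0" using w by (auto simp: vec_eq_iff)
  obtain a b :: 'n where "a \<noteq> b"
    using obtain_subset_with_card_n[OF n] by (metis card_2_iff)
  then obtain j where j: "j \<noteq> i" by metis
  have "axis j 1 + l *s w \<noteq> 0" for l
  proof
    assume *: "axis j 1 + l *s w = 0"
    have "l * w $ i = 0" using arg_cong[OF *, of "\<lambda>v. v $ i"] j by (simp add: axis_def)
    then have "axis j 1 = (0 :: complex^'n)" using * i by simp
    then show False by simp
  qed
  moreover have "w + l *s axis j 1 \<noteq> 0" for l
  proof
    assume "w + l *s axis j 1 = 0"
    then have "(w + l *s axis j 1) $ i = 0" by simp
    then show False using i j by (simp add: axis_def)
  qed
  ultimately show ?thesis using that[of "axis j 1"] by simp
qed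

text \<open>Homogeneity bounds |G z| by a multiple of |z|, so G is affine on lines missing the
  origin. The slope in direction w is the limit of \<open>inverse D ^ k\<close> G(z +
  \<open>D ^ k\<close> w) = G(w + \<open>inverse D ^ k\<close> z), which is G(w). Additivity and
  homogeneity follow from comparing such lines.\<close>

lemma homogeneous_holomorphic_linear:
  fixes G :: "complex^'n \<Rightarrow> complex^'n"
  assumes n: "CARD('n) \<ge> 2" and D: "norm D > 1" and G: "G vec_holomorphic_on - {0}"
    and hom: "\<And>z. z \<noteq> 0 \<Longrightarrow> G (D *s z) = D *s G z"
  obtains M where "\<And>z. z \<noteq> 0 \<Longrightarrow> G z = M *v z"
proof -
  have D0: "D \<noteq> 0" using D by auto
  have contG: "continuous_on (- {0}) G" using G by (rule vec_holomorphic_continuous_on)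
  obtain K where K: "K > 0" "\<And>z. z \<noteq> 0 \<Longrightarrow> norm (G z) / norm z \<le> K"
  proof (rule scale_invariant_bounded[OF D])
    show "continuous_on (- {0}) (\<lambda>z. norm (G z) / norm z)" by (intro continuous_intros contG) auto
    show "norm (G (D *s z)) / norm (D *s z) = norm (G z) / norm z" if "z \<noteq> 0" for z
      using that D0 by (simp add: hom norm_vec_smult)
  qed blast
  have hom_pow: "G (D ^ k *s z) = D ^ k *s G z" if "z \<noteq> 0" for z k
  proof (induction k)
    case (Suc k)
    have "D ^ Suc k *s z = D *s (D ^ k *s z)" by (simp add: vector_smult_assoc)
    moreover have "D ^ k *s z \<noteq> 0" using that D0 by simp
    ultimately have "G (D ^ Suc k *s z) = D *s (D ^ k *s G z)" using hom Suc by metis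
    then show ?case by (simp add: vector_smult_assoc)
  qed simp
  have affine: "G (z + l *s w) = G z + l *s G w"
    if line: "\<And>l. z + l *s w \<noteq> 0" and w: "w \<noteq> 0" for z w l
  proof -
    have z: "z \<noteq> 0" using line[of 0] by simp
    have "G (z + l *s w) $ i = (G z + l *s G w) $ i" for i
    proof -
      let ?\<phi> = "\<lambda>l. G (z + l *s w) $ i"
      \<comment> \<open>For |l| at least 1 the constant |z| is absorbed into |l| |z|, giving growth
        of degree one.\<close>
      have bound: "norm (?\<phi> l) \<le> (K * (norm z + norm w)) * norm l ^ 1" if l: "1 \<le> norm l" for l
      proof -
        have "norm (?\<phi> l) \<le> norm (G (z + l *s w))" by (rule Finite_Cartesian_Product.norm_nth_le)
        also have "\<dots> \<le> K * norm (z + l *s w)" using K(2)[OF line[of l]] line[of l] by (simp add: field_simps)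
        also have "norm (z + l *s w) \<le> norm z + norm l * norm w"
          by (rule order.trans[OF norm_triangle_ineq]) (simp add: norm_vec_smult)
        also have "\<dots> \<le> norm l * norm z + norm l * norm w"
          using l mult_right_mono[OF l, of "norm z"] by simp
        finally show ?thesis using K(1) by (simp add: algebra_simps)
      qed
      define c where "c = deriv ?\<phi> 0"
      have \<phi>: "?\<phi> l = G z $ i + l * c" for l
        using Liouville_polynomial[OF vec_holomorphic_on_line[OF G line] bound, where \<xi> = l]
        by (simp add: c_def)
      have inv_lim: "(\<lambda>k. inverse D ^ k) \<longlonglongrightarrow> 0"
        by (rule LIMSEQ_power_zero) (use D in \<open>simp add: norm_inverse inverse_less_1_iff\<close>)
      have Dk: "D ^ k * inverse D ^ k = 1" for k using D0 by (simp flip: power_mult_distrib)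
      have e: "D ^ k *s (w + inverse D ^ k *s z) = z + D ^ k *s w" for k
        by (simp add: vec.scale_right_distrib vector_smult_assoc Dk)
      have nz: "w + inverse D ^ k *s z \<noteq> 0" for k
        using e[of k] line[of "D ^ k"] by (metis vec.scale_zero_right)
      have "(\<lambda>k. G (w + inverse D ^ k *s z)) \<longlonglongrightarrow> G w"
      proof (rule continuous_on_tendsto_compose[OF contG])
        have "(\<lambda>k. w $ j + inverse D ^ k * z $ j) \<longlonglongrightarrow> w $ j + 0 * z $ j" for j
          by (intro tendsto_intros inv_lim)
        then show "(\<lambda>k. w + inverse D ^ k *s z) \<longlonglongrightarrow> w" by (intro vec_tendstoI) simp
        show "\<forall>\<^sub>F k in sequentially. w + inverse D ^ k *s z \<in> - {0}" using nz by simp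
      qed (use w in simp)
      then have "(\<lambda>k. G (w + inverse D ^ k *s z) $ i) \<longlonglongrightarrow> G w $ i" by (rule tendsto_vec_nth)
      moreover have "G (w + inverse D ^ k *s z) $ i = inverse D ^ k * G z $ i + c" for k
      proof -
        have "D ^ k * G (w + inverse D ^ k *s z) $ i = ?\<phi> (D ^ k)"
          using hom_pow[OF nz, of k k] unfolding e by simp
        also have "\<dots> = G z $ i + D ^ k * c" by (rule \<phi>)
        finally have "inverse D ^ k * (D ^ k * G (w + inverse D ^ k *s z) $ i)
            = inverse D ^ k * (G z $ i + D ^ k * c)" by simp
        moreover have "inverse D ^ k * (D ^ k * x) = x" for x
          using Dk[of k] by (metis mult.assoc mult.commute mult.left_neutral)
        ultimately show ?thesis by (simp add: distrib_left)
      qed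
      moreover have "(\<lambda>k. inverse D ^ k * G z $ i + c) \<longlonglongrightarrow> 0 * G z $ i + c"
        by (intro tendsto_intros inv_lim)
      ultimately have "c = G w $ i" using LIMSEQ_unique by fastforce
      then show ?thesis using \<phi>[of l] by simp
    qed
    then show ?thesis by (simp add: vec_eq_iff)
  qed
  \<comment> \<open>The same point of a line is reached with direction w and parameter l, or with
    direction \<open>l *s w\<close> and parameter 1.\<close>
  have scale: "G (l *s w) = l *s G w" if "w \<noteq> 0" "l \<noteq> 0" for l w
  proof -
    obtain z where z: "\<And>l. z + l *s w \<noteq> 0" using exists_transversal[OF n \<open>w \<noteq> 0\<close>] by metis
    have "G (z + 1 *s (l *s w)) = G z + 1 *s G (l *s w)"
      by (rule affine) (use that z in \<open>simp_all add: vector_smult_assoc\<close>)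
    moreover have "G (z + l *s w) = G z + l *s G w" by (rule affine[OF z that(1)])
    ultimately show ?thesis by simp
  qed
  define G0 where "G0 z = (if z = 0 then 0 else G z)" for z
  have "G0 (z + w) = G0 z + G0 w" for z w
  proof (cases "z = 0 \<or> w = 0")
    case False
    show ?thesis
    proof (cases "\<forall>l. z + l *s w \<noteq> 0")
      case True
      then have "z + 1 *s w \<noteq> 0" by blast
      then show ?thesis using affine[of z w 1] True False by (simp add: G0_def)
    next
      case nt: False
      then obtain l where l: "z = (- l) *s w" by (auto simp: add_eq_0_iff2)
      then have "l \<noteq> 0" using False by auto
      then have "G z = (- l) *s G w" using scale[of w "- l"] l False by simp
      moreover have "G0 ((1 - l) *s w) = (1 - l) *s G w"
      proof (cases "l = 1")
        case l1: False
        have "w \<noteq> 0" "1 - l \<noteq> 0" using False l1 by auto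
        then have "(1 - l) *s w \<noteq> 0" by (metis vec.scale_eq_0_iff)
        then show ?thesis
          using scale[OF \<open>w \<noteq> 0\<close> \<open>1 - l \<noteq> 0\<close>] unfolding G0_def by (simp only: if_False)
      qed (simp add: G0_def)
      moreover have "z + w = (1 - l) *s w" unfolding l by (simp add: vec.scale_left_diff_distrib)
      ultimately have "G0 (z + w) = (1 - l) *s G w" "G z = (- l) *s G w" by simp_all
      then show ?thesis using False by (simp add: G0_def vec.scale_left_diff_distrib)
    qed
  qed (auto simp: G0_def)
  moreover have "G0 (l *s z) = l *s G0 z" for l z by (simp add: G0_def scale)
  ultimately have "Vector_Spaces.linear (*s) (*s) G0"
    by (auto simp: Vector_Spaces.linear_iff vec.vector_space_axioms)
  then have "G z = matrix G0 *v z" if "z \<noteq> 0" for z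
    using matrix_works[of G0 z] that by (simp add: G0_def)
  then show ?thesis using that by blast
qed

text \<open>Here the product of |G z| and |z| is invariant under \<open>D\<close>, hence bounded. So
  G tends to 0 at infinity on a line through z missing the origin, and Liouville's theorem makes it
  vanish there.\<close>

lemma inverse_homogeneous_holomorphic_zero:
  fixes G :: "complex^'n \<Rightarrow> complex^'n"
  assumes n: "CARD('n) \<ge> 2" and D: "norm D > 1" and G: "G vec_holomorphic_on - {0}"
    and hom: "\<And>z. z \<noteq> 0 \<Longrightarrow> G (D *s z) = inverse D *s G z" and z: "z \<noteq> 0"
  shows "G z = 0"
proof -
  have D0: "D \<noteq> 0" using D by auto
  have contG: "continuous_on (- {0}) G" using G by (rule vec_holomorphic_continuous_on)
  obtain K where K: "K > 0" "\<And>z. z \<noteq> 0 \<Longrightarrow> norm (G z) * norm z \<le> K"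
  proof (rule scale_invariant_bounded[OF D])
    show "continuous_on (- {0}) (\<lambda>z. norm (G z) * norm z)" by (intro continuous_intros contG)
    show "norm (G (D *s z)) * norm (D *s z) = norm (G z) * norm z" if "z \<noteq> 0" for z
      using that D0 by (simp add: hom norm_vec_smult norm_inverse)
  qed blast
  obtain w where w: "w \<noteq> 0" "\<And>l. z + l *s w \<noteq> 0" using exists_transversal[OF n z] by metis
  have "G (z + 0 *s w) $ i = 0" for i
  proof (rule Liouville_weak_0[OF vec_holomorphic_on_line[OF G w(2)]])
    show "((\<lambda>l. G (z + l *s w) $ i) \<longlongrightarrow> 0) at_infinity"
      unfolding Lim_at_infinity
    proof (intro allI impI)
      fix e :: real assume e: "0 < e"
      have "dist (G (z + l *s w) $ i) 0 < e" if l: "(K / e + norm z + 1) / norm w \<le> norm l" for l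
      proof -
        have "K / e + norm z + 1 \<le> norm (l *s w)"
          using l w(1) by (simp add: norm_vec_smult field_simps)
        moreover have "norm (l *s w) - norm z \<le> norm (z + l *s w)"
          using norm_triangle_ineq2[of "l *s w" "- z"] by (simp add: add.commute)
        ultimately have big: "K / e < norm (z + l *s w)" by linarith
        then have pos: "norm (z + l *s w) > 0" using w(2) by simp
        have "norm (G (z + l *s w) $ i) \<le> norm (G (z + l *s w))" by (rule Finite_Cartesian_Product.norm_nth_le)
        also have "\<dots> \<le> K / norm (z + l *s w)" using K(2)[OF w(2)[of l]] pos by (simp add: field_simps)
        also have "\<dots> < e" using big pos e by (simp add: field_simps)
        finally show ?thesis by simp
      qed
      then show "\<exists>b. \<forall>l. b \<le> norm l \<longrightarrow> dist (G (z + l *s w) $ i) 0 < e" by blast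
    qed
  qed
  then show ?thesis by (simp add: vec_eq_iff)
qed

section \<open>Lifting maps through the universal covering of the Hopf manifold\<close>

text \<open>The branch of log d with imaginary part in [0, 2 \<pi>), chosen so that its real
  multiples give \<open>real_power\<close>.\<close>

definition hopf_log :: "complex \<Rightarrow> complex" where
  "hopf_log d = Complex (ln (norm d)) (Arg2pi d)"

lemma real_power_exp: "d \<noteq> 0 \<Longrightarrow> real_power d x = exp (of_real x * hopf_log d)"
  unfolding real_power_def exp_eq_polar by (simp add: hopf_log_def powr_def)

lemma exp_hopf_log:
  assumes "d \<noteq> 0" shows "exp (hopf_log d) = d"
proof -
  have "exp (hopf_log d) = of_real (norm d) * exp (\<i> * of_real (Arg2pi d))"
    using assms unfolding exp_eq_polar by (simp add: hopf_log_def)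
  moreover have "is_Arg d (Arg2pi d)" using Arg2pi[of d] by simp
  ultimately show ?thesis unfolding is_Arg_def by simp
qed

lemma power_int_exp_hopf_log: "d \<noteq> 0 \<Longrightarrow> d powi k = exp (of_int k * hopf_log d)"
  using exp_power_int[of "hopf_log d" k] by (simp add: exp_hopf_log)

section \<open>Classes, heights and lifting of maps\<close>

lemma hopf_class_zero: "hopf_class d 0 = {}"
  by (simp add: hopf_class_def hopf_rel_def)

lemma hopf_class_in_points_iff: "hopf_class d z \<in> hopf_points d \<longleftrightarrow> z \<noteq> 0"
proof
  assume "hopf_class d z \<in> hopf_points d"
  then obtain w where "w \<noteq> 0" "hopf_class d z = hopf_class d w" by (auto simp: hopf_points_eq)
  then have "w \<in> hopf_class d z"
    by (auto simp: hopf_class_def hopf_rel_def intro!: exI[of _ "0 :: int"])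
  then show "z \<noteq> 0" by (auto simp: hopf_class_zero)
qed (auto simp: hopf_points_eq)

lemma hopf_class_smult:
  assumes "d \<noteq> 0" shows "hopf_class d ((d powi k) *s z) = hopf_class d z"
proof (cases "z = 0")
  case False
  then have "hopf_class d z = hopf_class d ((d powi k) *s z)"
    by (subst hopf_class_eq_iff) (use assms in auto)
  then show ?thesis by simp
qed simp

text \<open>The logarithm of |z| to base |d|; its class modulo the integers is a function on the
  manifold.\<close>

definition hopf_height :: "complex \<Rightarrow> complex^'n \<Rightarrow> real" where
  "hopf_height d z = ln (norm z) / ln (norm d)"

lemma hopf_height_smult:
  assumes "d \<noteq> 0" "norm d \<noteq> 1" "z \<noteq> 0"
  shows "hopf_height d ((d powi k) *s z) = hopf_height d z + of_int k"
proof -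
  have "ln (norm d) \<noteq> 0" using assms by simp
  then show ?thesis using assms
    by (simp add: hopf_height_def norm_vec_smult norm_power_int ln_mult ln_power_int field_simps)
qed

text \<open>The manifold is embedded into a vector space as \<open>S\<^sup>2\<^sup>n\<^sup>-\<^sup>1 \<times> S\<^sup>1\<close> by
  \<open>[z] \<mapsto> (d\<^sup>-\<^sup>s z, e\<^sup>2\<^sup>\<pi>\<^sup>i\<^sup>s)\<close>, where \<open>s\<close> is the height of \<open>z\<close>.\<close>

lemma exists_hopf_embedding:
  assumes d: "d \<noteq> 0" "norm d \<noteq> 1"
  obtains H1 :: "(complex^'n) set \<Rightarrow> complex^'n" and H2 :: "(complex^'n) set \<Rightarrow> complex"
  where "continuous_map (hopf_manifold d) euclidean H1" "continuous_map (hopf_manifold d) euclidean H2"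
    "\<And>z. z \<noteq> 0 \<Longrightarrow> H1 (hopf_class d z) = exp (- (of_real (hopf_height d z) * hopf_log d)) *s z"
    "\<And>z. z \<noteq> 0 \<Longrightarrow> H2 (hopf_class d z) = cis (2 * pi * hopf_height d z)"
proof -
  let ?rep = "\<lambda>x. SOME z :: complex^'n. z \<noteq> 0 \<and> hopf_class d z = x"
  let ?h1 = "\<lambda>z :: complex^'n. exp (- (of_real (hopf_height d z) * hopf_log d)) *s z"
  let ?h2 = "\<lambda>z :: complex^'n. cis (2 * pi * hopf_height d z)"
  have rep: "\<exists>k::int. ?rep (hopf_class d z) = (d powi k) *s z" if z: "z \<noteq> 0" for z
  proof -
    have "?rep (hopf_class d z) \<noteq> 0 \<and> hopf_class d (?rep (hopf_class d z)) = hopf_class d z"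
      by (rule someI[of _ z]) (use z in simp)
    then show ?thesis using hopf_class_eq_iff[OF d(1) z, of "?rep (hopf_class d z)"] by simp
  qed
  \<comment> \<open>Replacing z by \<open>d powi k\<close> times z raises the height by k. The
    factor \<open>d powi k\<close> is compensated by the exponential in the first formula, and the
    second sees only the height modulo 1.\<close>
  have eq: "?h1 (?rep (hopf_class d z)) = ?h1 z" "?h2 (?rep (hopf_class d z)) = ?h2 z" if z: "z \<noteq> 0" for z
  proof -
    obtain k :: int where k: "?rep (hopf_class d z) = (d powi k) *s z" using rep[OF z] by blast
    show "?h1 (?rep (hopf_class d z)) = ?h1 z"
      unfolding k hopf_height_smult[OF d z]
      by (simp add: vector_smult_assoc power_int_exp_hopf_log d algebra_simps flip: exp_add)
    show "?h2 (?rep (hopf_class d z)) = ?h2 z"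
      unfolding k hopf_height_smult[OF d z] by (simp add: distrib_left flip: cis_mult)
  qed
  have ch: "continuous_on (- {0}) (hopf_height d :: complex^'n \<Rightarrow> real)"
    unfolding hopf_height_def using d by (intro continuous_intros) auto
  have c1: "continuous_on (- {0}) ?h1"
    unfolding vector_scalar_mult_def by (intro continuous_intros ch)
  have c2: "continuous_on (- {0}) ?h2" by (intro continuous_intros ch)
  have "continuous_map (hopf_manifold d) euclidean (?h1 \<circ> ?rep)"
  proof (rule continuous_compose_quotient_map[OF quotient_map_hopf_class])
    show "continuous_map (top_of_set (- {0})) euclidean (?h1 \<circ> ?rep \<circ> hopf_class d)"
      by (rule continuous_map_eq[of _ _ ?h1]) (use c1 eq(1) in \<open>auto\<close>)
  qed
  moreover have "continuous_map (hopf_manifold d) euclidean (?h2 \<circ> ?rep)"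
  proof (rule continuous_compose_quotient_map[OF quotient_map_hopf_class])
    show "continuous_map (top_of_set (- {0})) euclidean (?h2 \<circ> ?rep \<circ> hopf_class d)"
      by (rule continuous_map_eq[of _ _ ?h2]) (use c2 eq(2) in \<open>auto\<close>)
  qed
  ultimately show ?thesis using that[of "?h1 \<circ> ?rep" "?h2 \<circ> ?rep"] eq by simp
qed

text \<open>The covering is the pull-back of the exponential covering of the circle along
  \<open>H2\<close>. So it suffices to take a continuous logarithm of the circle coordinate, read it
  as a height, and rescale the sphere coordinate \<open>H1\<close> by the corresponding power of
  \<open>d\<close>.\<close>

lemma exists_hopf_lift:
  fixes f :: "'a::real_normed_vector \<Rightarrow> (complex^'n) set"
  assumes d: "d \<noteq> 0" "norm d \<noteq> 1" and S: "simply_connected S" "locally path_connected S"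
    and f: "continuous_map (top_of_set S) (hopf_manifold d) f"
  obtains g where "continuous_on S g" "\<And>x. x \<in> S \<Longrightarrow> g x \<noteq> 0" "\<And>x. x \<in> S \<Longrightarrow> hopf_class d (g x) = f x"
proof -
  obtain H1 :: "(complex^'n) set \<Rightarrow> complex^'n" and H2 :: "(complex^'n) set \<Rightarrow> complex"
    where H: "continuous_map (hopf_manifold d) euclidean H1" "continuous_map (hopf_manifold d) euclidean H2"
    "\<And>z. z \<noteq> 0 \<Longrightarrow> H1 (hopf_class d z) = exp (- (of_real (hopf_height d z) * hopf_log d)) *s z"
    "\<And>z. z \<noteq> 0 \<Longrightarrow> H2 (hopf_class d z) = cis (2 * pi * hopf_height d z)"
    using exists_hopf_embedding[OF d] by blast
  have c: "continuous_on S (\<lambda>x. H1 (f x))" "continuous_on S (\<lambda>x. H2 (f x))"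
    using continuous_map_compose[OF f H(1)] continuous_map_compose[OF f H(2)] by (auto simp: o_def)
  have rep: "\<exists>z. z \<noteq> 0 \<and> f x = hopf_class d z" if "x \<in> S" for x
    using continuous_map_image_subset_topspace[OF f] that
    by (auto simp: topspace_hopf_manifold hopf_points_eq)
  have "H2 (f x) \<noteq> 0" if "x \<in> S" for x using rep[OF that] H(4) by auto
  then obtain l where l: "continuous_on S l" "\<And>x. x \<in> S \<Longrightarrow> H2 (f x) = exp (l x)"
    using continuous_logarithm_on_simply_connected[OF c(2) S] by blast
  define g where "g x = exp (of_real (Im (l x) / (2 * pi)) * hopf_log d) *s H1 (f x)" for x
  have "continuous_on S g"
    unfolding g_def vector_scalar_mult_def by (intro continuous_intros l(1) c(1)) auto
  moreover have "\<exists>z k. z \<noteq> 0 \<and> f x = hopf_class d z \<and> g x = (d powi (k::int)) *s z" if x: "x \<in> S" for x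
  proof -
    obtain z where z: "z \<noteq> 0" "f x = hopf_class d z" using rep[OF x] by blast
    have "exp (l x) = cis (2 * pi * hopf_height d z)" using l(2)[OF x] z H(4) by simp
    also have "\<dots> = exp (\<i> * of_real (2 * pi * hopf_height d z))" by (simp add: cis_conv_exp)
    finally obtain k :: int where "l x = \<i> * of_real (2 * pi * hopf_height d z) + of_int (2 * k) * pi * \<i>"
      by (auto simp: exp_eq)
    then have k: "Im (l x) / (2 * pi) = hopf_height d z + of_int k"
      by (simp add: field_simps)
    have "g x = (d powi k) *s z"
      unfolding g_def k using H(3)[OF z(1)] z(2)
      by (simp add: vector_smult_assoc power_int_exp_hopf_log d algebra_simps flip: exp_add)
    then show ?thesis using z by blast
  qed
  then have "g x \<noteq> 0 \<and> hopf_class d (g x) = f x" if "x \<in> S" for x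
    using d(1) that by (metis hopf_class_smult power_int_eq_0_iff vec.scale_eq_0_iff)
  ultimately show ?thesis using that by blast
qed

text \<open>The exponent k at a point is visible in the ratio of the norms, which is continuous and
  takes values in the powers of |d|.\<close>

lemma hopf_lifts_differ:
  fixes u v :: "'a::topological_space \<Rightarrow> complex^'n"
  assumes d: "d \<noteq> 0" "norm d \<noteq> 1" and T: "connected T" "continuous_on T u" "continuous_on T v"
    and nz: "\<And>x. x \<in> T \<Longrightarrow> u x \<noteq> 0" "\<And>x. x \<in> T \<Longrightarrow> v x \<noteq> 0"
    and eq: "\<And>x. x \<in> T \<Longrightarrow> hopf_class d (u x) = hopf_class d (v x)"
  obtains k :: int where "\<And>x. x \<in> T \<Longrightarrow> v x = (d powi k) *s u x"
proof (cases "T = {}")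
  case False
  then obtain x0 where x0: "x0 \<in> T" by blast
  have k: "\<exists>k::int. v x = (d powi k) *s u x" if "x \<in> T" for x
    using hopf_class_eq_iff[OF d(1) nz(1)[OF that] nz(2)[OF that]] eq[OF that] by blast
  have ratio: "norm (v x) / norm (u x) = norm d powi k" if "x \<in> T" "v x = (d powi k) *s u x" for x k
    using that nz(1)[of x] by (simp add: norm_vec_smult norm_power_int)
  obtain k :: int where k0: "v x0 = (d powi k) *s u x0" using k[OF x0] by blast
  have "v x = (d powi k) *s u x" if x: "x \<in> T" for x
  proof -
    obtain j :: int where j: "v x = (d powi j) *s u x" using k[OF x] by blast
    have "norm (v x) / norm (u x) = norm (v x0) / norm (u x0)"
    proof (rule continuous_power_int_valued_constant[OF T(1), of "\<lambda>x. norm (v x) / norm (u x)" "norm d"])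
      show "continuous_on T (\<lambda>x. norm (v x) / norm (u x))"
        using nz(1) by (intro continuous_intros T) auto
      show "\<exists>k::int. norm (v x) / norm (u x) = norm d powi k" if "x \<in> T" for x
        using k[OF that] ratio[OF that] by blast
    qed (use d x x0 in auto)
    then have "norm d powi j = norm d powi k" using ratio[OF x j] ratio[OF x0 k0] by simp
    then have "j = k" using d by (intro power_int_inj[of "norm d"]) auto
    then show ?thesis using j by simp
  qed
  then show ?thesis using that by blast
qed (use that in blast)

text \<open>Charts are local inverses of the projection. With the target chart chosen around G(z0),
  the coordinate expression of f near z0 is G itself.\<close>

lemma hopf_lift_holomorphic:
  fixes G :: "complex^'n \<Rightarrow> complex^'n"
  assumes d: "d \<noteq> 0" "norm d \<noteq> 1"
    and f: "holomorphic_map (hopf_manifold d) (hopf_atlas d) (hopf_manifold d) (hopf_atlas d) f"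
    and G: "continuous_on (- {0}) G" "\<And>z. z \<noteq> 0 \<Longrightarrow> G z \<noteq> 0"
      "\<And>z. z \<noteq> 0 \<Longrightarrow> hopf_class d (G z) = f (hopf_class d z)"
  shows "G vec_holomorphic_on - {0}"
  unfolding vec_holomorphic_on_def
proof
  fix z0 :: "complex^'n" assume "z0 \<in> - {0}"
  then have z0: "z0 \<noteq> 0" by simp
  let ?p = "hopf_class d :: complex^'n \<Rightarrow> _"
  obtain W where W: "open W" "z0 \<in> W" "0 \<notin> W" "inj_on ?p W"
    using hopf_class_locally_injective[OF d z0] .
  obtain W' where W': "open W'" "G z0 \<in> W'" "0 \<notin> W'" "inj_on ?p W'"
    using hopf_class_locally_injective[OF d G(2)[OF z0]] .
  have "(?p ` W, inv_into W ?p) \<in> hopf_atlas d" "(?p ` W', inv_into W' ?p) \<in> hopf_atlas d"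
    using W W' by (auto simp: hopf_atlas_def)
  then have hol: "(inv_into W' ?p \<circ> f \<circ> inv_into (?p ` W) (inv_into W ?p)) vec_holomorphic_on
      (inv_into W ?p ` {x \<in> ?p ` W. f x \<in> ?p ` W'})"
    using f unfolding holomorphic_map_def by blast
  have "f (?p z0) \<in> ?p ` W'" using G(3)[OF z0] W'(2) by (metis imageI)
  moreover have "inv_into W ?p (?p z0) = z0" using W by (simp add: inv_into_f_f)
  ultimately have "z0 \<in> inv_into W ?p ` {x \<in> ?p ` W. f x \<in> ?p ` W'}"
    using W(2) by (intro image_eqI[of _ _ "?p z0"]) auto
  then obtain f' where f': "((inv_into W' ?p \<circ> f \<circ> inv_into (?p ` W) (inv_into W ?p)) has_derivative f') (at z0)"
    "Vector_Spaces.linear (*s) (*s) f'"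
    using hol unfolding vec_holomorphic_on_def by blast
  have "continuous_on W G" by (rule continuous_on_subset[OF G(1)]) (use W(3) in auto)
  then have S: "open (W \<inter> G -` W')" "z0 \<in> W \<inter> G -` W'"
    using W W' by (auto intro: continuous_open_preimage)
  have eq: "(inv_into W' ?p \<circ> f \<circ> inv_into (?p ` W) (inv_into W ?p)) w = G w"
    if w: "w \<in> W \<inter> G -` W'" for w
  proof -
    have "inv_into (?p ` W) (inv_into W ?p) (inv_into W ?p (?p w)) = ?p w"
      using w by (intro inv_into_f_f inj_on_inv_into) auto
    moreover have "inv_into W ?p (?p w) = w" using w W by (simp add: inv_into_f_f)
    moreover have "w \<noteq> 0" using w W(3) by auto
    ultimately have "(inv_into W' ?p \<circ> f \<circ> inv_into (?p ` W) (inv_into W ?p)) w = inv_into W' ?p (?p (G w))"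
      using G(3) by simp
    then show ?thesis using w W'(4) by (simp add: inv_into_f_f)
  qed
  have "(G has_derivative f') (at z0)"
    using f'(1) S by (rule has_derivative_transform_within_open) (rule eq)
  then show "\<exists>f'. (G has_derivative f') (at z0) \<and> Vector_Spaces.linear (*s) (*s) f'" using f'(2) by blast
qed

text \<open>Real dimension at least 3 is what makes the complement of a point simply
  connected.\<close>

lemma dim_ge_3: "CARD('n) \<ge> 2 \<Longrightarrow> 3 \<le> DIM(complex^'n)"
  by simp

lemma homogeneous_power_int:
  fixes G :: "complex^'n \<Rightarrow> complex^'n"
  assumes d: "d \<noteq> 0" and hom: "\<And>z. z \<noteq> 0 \<Longrightarrow> G (d *s z) = (d powi a) *s G z" and z: "z \<noteq> 0"
  shows "G ((d powi j) *s z) = (d powi (a * j)) *s G z"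
proof (induction j rule: int_induct[where k = 0])
  case base
  then show ?case by simp
next
  case (step1 i)
  have "(d powi (i + 1)) *s z = d *s ((d powi i) *s z)"
    using d by (simp add: power_int_add vector_smult_assoc mult.commute)
  moreover have "(d powi i) *s z \<noteq> 0" using d z by simp
  ultimately have "G ((d powi (i + 1)) *s z) = (d powi a) *s ((d powi (a * i)) *s G z)"
    using hom step1 by metis
  then show ?case using d by (simp add: vector_smult_assoc distrib_left power_int_add mult.commute)
next
  case (step2 i)
  have "(d powi i) *s z = d *s ((d powi (i - 1)) *s z)"
    using d by (simp add: power_int_diff vector_smult_assoc)
  moreover have "(d powi (i - 1)) *s z \<noteq> 0" using d z by simp
  ultimately have "(d powi (a * i)) *s G z = (d powi a) *s G ((d powi (i - 1)) *s z)"
    using hom step2 by metis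
  then have "(d powi (- a)) *s ((d powi (a * i)) *s G z) = (d powi (- a) * d powi a) *s G ((d powi (i - 1)) *s z)"
    by (simp add: vector_smult_assoc)
  moreover have "d powi (- a) * d powi a = 1" using d by (simp add: power_int_minus)
  ultimately show ?case
    using d by (simp add: vector_smult_assoc right_diff_distrib power_int_diff power_int_minus field_simps)
qed

text \<open>G and K scale by exponents a and b under \<open>d\<close>, while K after G lies over the
  identity and is a power of \<open>d\<close>. Hence a b = 1. For a = -1 the lift would have to
  vanish, so a = 1 and G is linear.\<close>

lemma hopf_lift_linear:
  fixes G K :: "complex^'n \<Rightarrow> complex^'n"
  assumes n: "CARD('n) \<ge> 2" and d: "d \<noteq> 0" "norm d \<noteq> 1"
    and f: "holomorphic_map (hopf_manifold d) (hopf_atlas d) (hopf_manifold d) (hopf_atlas d) f"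
    and G: "continuous_on (- {0}) G" "\<And>z. z \<noteq> 0 \<Longrightarrow> G z \<noteq> 0"
      "\<And>z. z \<noteq> 0 \<Longrightarrow> hopf_class d (G z) = f (hopf_class d z)"
    and K: "continuous_on (- {0}) K" "\<And>z. z \<noteq> 0 \<Longrightarrow> K z \<noteq> 0"
      "\<And>z. z \<noteq> 0 \<Longrightarrow> hopf_class d (K z) = f' (hopf_class d z)"
    and inv: "\<And>x. x \<in> hopf_points d \<Longrightarrow> f' (f x) = x"
  obtains M where "\<And>z. z \<noteq> 0 \<Longrightarrow> G z = M *v z"
proof -
  have conn: "connected (- {0 :: complex^'n})"
    by (intro simply_connected_imp_connected simply_connected_punctured_universe dim_ge_3 n)
  have cont_d: "continuous_on (- {0}) (\<lambda>z :: complex^'n. d *s z)"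
    unfolding vector_scalar_mult_def by (intro continuous_intros)
  have scale: "\<exists>a::int. \<forall>z. z \<noteq> 0 \<longrightarrow> F (d *s z) = (d powi a) *s F z"
    if F: "continuous_on (- {0}) F" "\<And>z. z \<noteq> 0 \<Longrightarrow> F z \<noteq> 0"
      "\<And>z. z \<noteq> 0 \<Longrightarrow> hopf_class d (F z) = h (hopf_class d z)" for F :: "complex^'n \<Rightarrow> complex^'n" and h
  proof -
    obtain a :: int where "\<And>z. z \<in> - {0} \<Longrightarrow> F (d *s z) = (d powi a) *s F z"
    proof (rule hopf_lifts_differ[OF d conn F(1)])
      show "continuous_on (- {0}) (\<lambda>z. F (d *s z))"
        by (rule continuous_on_compose2[OF F(1) cont_d]) (use d in auto)
      show "hopf_class d (F z) = hopf_class d (F (d *s z))" if "z \<in> - {0}" for z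
        using that d F(3) hopf_class_smult[OF d(1), of 1 z] by simp
    qed (use F(2) d in auto)
    then show ?thesis by auto
  qed
  obtain a :: int where a: "\<And>z. z \<noteq> 0 \<Longrightarrow> G (d *s z) = (d powi a) *s G z"
    using scale[OF G] by blast
  obtain b :: int where b: "\<And>z. z \<noteq> 0 \<Longrightarrow> K (d *s z) = (d powi b) *s K z"
    using scale[OF K] by blast
  have "G ` (- {0}) \<subseteq> - {0}" by (rule image_subsetI) (simp add: G(2))
  then have cKG: "continuous_on (- {0}) (\<lambda>z. K (G z))" by (rule continuous_on_compose2[OF K(1) G(1)])
  have KG0: "K (G z) \<noteq> 0" if "z \<in> - {0}" for z using K(2)[OF G(2)] that by simp
  have KG: "hopf_class d z = hopf_class d (K (G z))" if "z \<in> - {0}" for z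
    using that K(3)[OF G(2), of z] G(3)[of z] inv[of "hopf_class d z"]
    by (simp add: hopf_class_in_points_iff)
  obtain m :: int where m: "\<And>z. z \<in> - {0} \<Longrightarrow> K (G z) = (d powi m) *s z"
    by (rule hopf_lifts_differ[OF d conn continuous_on_id cKG _ KG0 KG]) auto
  \<comment> \<open>Any nonzero vector serves; \<open>undefined\<close> merely names some
    index.\<close>
  obtain e0 :: "complex^'n" where e0: "e0 \<noteq> 0" using exists_transversal[OF n, of "axis undefined 1"] by auto
  have "K (G (d *s e0)) = (d powi (b * a)) *s K (G e0)"
    unfolding a[OF e0] by (rule homogeneous_power_int[where G = K and a = b and d = d, OF d(1) b G(2)[OF e0]])
  then have "(d powi m) *s (d *s e0) = (d powi (b * a)) *s ((d powi m) *s e0)"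
    using m e0 d by simp
  then have "d powi m * d = d powi (b * a) * d powi m"
    using e0 by (simp add: vector_smult_assoc)
  then have "d powi 1 = d powi (b * a)" using d by simp
  then have "norm d powi 1 = norm d powi (b * a)" by (metis norm_power_int)
  then have "1 = b * a" using d by (intro power_int_inj[of "norm d"]) auto
  then have a1: "a = 1 \<or> a = -1" using zmult_eq_1_iff[of b a] by auto
  \<comment> \<open>The growth arguments need an expanding scalar, so \<open>D\<close> is
    \<open>d\<close> or its inverse, whichever has norm above 1.\<close>
  obtain e :: int and D where e: "e = 1 \<or> e = -1" and D: "D = d powi e" "norm D > 1"
  proof (cases "norm d > 1")
    case True
    then show ?thesis using that[of 1 d] by simp
  next
    case False
    then have "norm (inverse d) > 1" using d by (simp add: norm_inverse one_less_inverse_iff)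
    then show ?thesis using that[of "-1" "inverse d"] by (simp add: power_int_minus)
  qed
  have hol: "G vec_holomorphic_on - {0}" by (rule hopf_lift_holomorphic[OF d f G])
  have hom: "G (D *s z) = (d powi (a * e)) *s G z" if "z \<noteq> 0" for z
    unfolding D by (rule homogeneous_power_int[where G = G and a = a and d = d, OF d(1) a that])
  show ?thesis
  proof (cases "a = 1")
    case True
    then have "G (D *s z) = D *s G z" if "z \<noteq> 0" for z using hom[OF that] D by simp
    then show ?thesis using homogeneous_holomorphic_linear[OF n D(2) hol] that by metis
  next
    case False
    then have "G (D *s z) = inverse D *s G z" if "z \<noteq> 0" for z
      using hom[OF that] D a1 by (simp add: power_int_minus)
    then have "G e0 = 0" using inverse_homogeneous_holomorphic_zero[OF n D(2) hol _ e0] by metis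
    then show ?thesis using G(2)[OF e0] by simp
  qed
qed

section \<open>Linear lifts of transformations of the Hopf manifold\<close>

definition hopf_lift :: "complex \<Rightarrow> ((complex^'n) set \<Rightarrow> (complex^'n) set) \<Rightarrow> complex^'n^'n \<Rightarrow> bool" where
  "hopf_lift d f M \<longleftrightarrow> invertible M \<and> (\<forall>z. z \<noteq> 0 \<longrightarrow> f (hopf_class d z) = hopf_class d (M *v z))"

lemma invertible_mult_vec_eq_0_iff:
  fixes M :: "complex^'n^'n"
  assumes "invertible M" shows "M *v z = 0 \<longleftrightarrow> z = 0"
  by (metis assms invertible_inv_mult matrix_vector_mul_assoc matrix_vector_mul_lid matrix_vector_mult_0_right)

lemma hopf_lift_unique:
  fixes M N :: "complex^'n^'n"
  assumes n: "CARD('n) \<ge> 2" and d: "d \<noteq> 0" "norm d \<noteq> 1" and M: "hopf_lift d f M" and N: "hopf_lift d f N"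
  shows "\<exists>k::int. N = (d powi k) *\<^sub>m M"
proof -
  have conn: "connected (- {0 :: complex^'n})"
    by (intro simply_connected_imp_connected simply_connected_punctured_universe dim_ge_3 n)
  have cont: "continuous_on (- {0}) (\<lambda>z. X *v z)" for X :: "complex^'n^'n"
    unfolding matrix_vector_mult_def by (intro continuous_intros)
  obtain k :: int where k: "\<And>z. z \<in> - {0} \<Longrightarrow> N *v z = (d powi k) *s (M *v z)"
    by (rule hopf_lifts_differ[OF d conn cont[of M] cont[of N]])
      (use M N in \<open>auto simp: hopf_lift_def invertible_mult_vec_eq_0_iff\<close>)
  have "N = (d powi k) *\<^sub>m M"
    by (rule matrix_eqI_axis) (simp add: k cscale_mult_vec)
  then show ?thesis by blast
qed

lemma hopf_lift_cscale:
  assumes "d \<noteq> 0" "hopf_lift d f M" shows "hopf_lift d f ((d powi k) *\<^sub>m M)"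
  using assms by (auto simp: hopf_lift_def cscale_mult_vec hopf_class_smult invertible_det_nz det_cscale)

lemma hopf_lift_cong:
  "(\<And>x. x \<in> hopf_points d \<Longrightarrow> f x = g x) \<Longrightarrow> hopf_lift d f M \<longleftrightarrow> hopf_lift d g M"
  by (simp add: hopf_lift_def hopf_class_in_points_iff)

lemma hopf_lift_compose:
  "hopf_lift d f M \<Longrightarrow> hopf_lift d g N \<Longrightarrow> hopf_lift d (\<lambda>x. f (g x)) (M ** N)"
  by (simp add: hopf_lift_def invertible_mult invertible_mult_vec_eq_0_iff flip: matrix_vector_mul_assoc)

text \<open>The lift is taken over the product of the line with the punctured space at once:
  separate lifts for each \<theta> would leave unrelated powers of \<open>d\<close> and no
  continuity in \<theta>.\<close>

lemma continuous_unitary_path_lift: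
  fixes \<rho> :: "complex^'n^'n \<Rightarrow> (complex^'n) set \<Rightarrow> (complex^'n) set"
  assumes n: "CARD('n) \<ge> 2" and d: "d \<noteq> 0" "norm d \<noteq> 1"
    and \<rho>: "unitary_holomorphic_action (hopf_manifold d) (hopf_atlas d) \<rho>"
    and \<gamma>: "continuous_on UNIV \<gamma>" "\<And>\<theta>::real. unitary_matrix (\<gamma> \<theta>)"
  obtains g where "continuous_on (UNIV \<times> - {0}) g" "\<And>\<theta> z. z \<noteq> 0 \<Longrightarrow> g (\<theta>, z) \<noteq> 0"
    "\<And>\<theta> z. z \<noteq> 0 \<Longrightarrow> hopf_class d (g (\<theta>, z)) = \<rho> (\<gamma> \<theta>) (hopf_class d z)"
proof -
  let ?S = "UNIV \<times> - {0 :: complex^'n} :: (real \<times> (complex^'n)) set"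
  let ?U = "top_of_set (carrier unitary_group :: (complex^'n^'n) set)"
  have "continuous_map (prod_topology ?U (hopf_manifold d)) (hopf_manifold d) (\<lambda>(A, x). \<rho> A x)"
    using \<rho> by (simp add: unitary_holomorphic_action_def)
  moreover have "continuous_map (top_of_set ?S) (prod_topology ?U (hopf_manifold d))
      (\<lambda>p. (\<gamma> (fst p), hopf_class d (snd p)))"
  proof (rule continuous_map_pairedI)
    have "continuous_on ?S (\<lambda>p. \<gamma> (fst p))"
      by (rule continuous_on_compose2[OF \<gamma>(1) continuous_on_fst[OF continuous_on_id]]) auto
    then show "continuous_map (top_of_set ?S) ?U (\<lambda>p. \<gamma> (fst p))"
      using \<gamma>(2) by (auto simp: continuous_map_in_subtopology unitary_group_simps)
    have "continuous_map (top_of_set ?S) (top_of_set (- {0})) snd"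
      by (auto simp: continuous_map_in_subtopology intro!: continuous_on_snd continuous_on_id)
    from continuous_map_compose[OF this quotient_imp_continuous_map[OF quotient_map_hopf_class[of d]]]
    show "continuous_map (top_of_set ?S) (hopf_manifold d) (\<lambda>p. hopf_class d (snd p))"
      by (simp only: o_def)
  qed
  ultimately have "continuous_map (top_of_set ?S) (hopf_manifold d)
      ((\<lambda>(A, x). \<rho> A x) \<circ> (\<lambda>p. (\<gamma> (fst p), hopf_class d (snd p))))"
    using continuous_map_compose by blast
  then have f: "continuous_map (top_of_set ?S) (hopf_manifold d) (\<lambda>p. \<rho> (\<gamma> (fst p)) (hopf_class d (snd p)))"
    by (simp add: o_def)
  have "simply_connected ?S"
    by (intro simply_connected_Times simply_connected_punctured_universe dim_ge_3 n)
      (simp add: convex_imp_simply_connected)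
  moreover have "locally path_connected ?S"
    by (intro open_imp_locally_path_connected open_Times) auto
  ultimately obtain g where "continuous_on ?S g" "\<And>x. x \<in> ?S \<Longrightarrow> g x \<noteq> 0"
    "\<And>x. x \<in> ?S \<Longrightarrow> hopf_class d (g x) = \<rho> (\<gamma> (fst x)) (hopf_class d (snd x))"
    using exists_hopf_lift[OF d _ _ f] by blast
  then show ?thesis using that[of g] by auto
qed

text \<open>Unitarity of A is part of the relation because the action says nothing about \<rho> at
  other matrices. The path property is the substantial one; it combines joint lifting with linearity
  of each slice.\<close>

theorem unitary_action_lift_family:
  fixes \<rho> :: "complex^'n^'n \<Rightarrow> (complex^'n) set \<Rightarrow> (complex^'n) set"
  assumes n: "CARD('n) \<ge> 2" and d: "d \<noteq> 0" "norm d \<noteq> 1"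
    and \<rho>: "unitary_holomorphic_action (hopf_manifold d) (hopf_atlas d) \<rho>"
    and eff: "effective_action unitary_group (topspace (hopf_manifold d)) \<rho>"
  shows "lift_family d (\<lambda>A M. unitary_matrix A \<and> hopf_lift d (\<rho> A) M)"
proof
  have act: "group_action unitary_group (hopf_points d) \<rho>"
    using \<rho> by (simp add: unitary_holomorphic_action_def topspace_hopf_manifold)
  have \<rho>_mult: "\<rho> (A ** B) x = \<rho> A (\<rho> B x)"
    if "unitary_matrix A" "unitary_matrix B" "x \<in> hopf_points d" for A B x
    using group_action.composition_rule[OF act that(3), of A B] that by (simp add: unitary_group_simps)
  have \<rho>_one: "\<rho> (mat 1) x = x" if "x \<in> hopf_points d" for x
    using group_action.id_eq_one[OF act] that unfolding unitary_group_simps by (metis restrict_apply')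
  show "CARD('n) \<ge> 2" "d \<noteq> 0" "norm d \<noteq> 1" by (fact n, fact d, fact d)
  show "invertible M" if "unitary_matrix A \<and> hopf_lift d (\<rho> A) M" for A M
    using that by (simp add: hopf_lift_def)
  show "unitary_matrix (A ** B) \<and> hopf_lift d (\<rho> (A ** B)) (M ** N)"
    if "unitary_matrix A \<and> hopf_lift d (\<rho> A) M" "unitary_matrix B \<and> hopf_lift d (\<rho> B) N" for A B M N
    using that hopf_lift_compose[of d "\<rho> A" M "\<rho> B" N]
      hopf_lift_cong[of d "\<rho> (A ** B)" "\<lambda>x. \<rho> A (\<rho> B x)" "M ** N"]
    by (simp add: unitary_mult \<rho>_mult)
  show "\<exists>k::int. N = (d powi k) *\<^sub>m M"
    if "unitary_matrix A \<and> hopf_lift d (\<rho> A) M" "unitary_matrix A \<and> hopf_lift d (\<rho> A) N" for A M N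
    using hopf_lift_unique[OF n d] that by blast
  show "unitary_matrix A \<and> hopf_lift d (\<rho> A) ((d powi k) *\<^sub>m M)"
    if "unitary_matrix A \<and> hopf_lift d (\<rho> A) M" for A M k
    using hopf_lift_cscale[OF d(1)] that by blast
  show "A = mat 1" if "unitary_matrix A \<and> hopf_lift d (\<rho> A) (mat 1)" for A
    using that eff
    by (auto simp: effective_action_def unitary_group_simps topspace_hopf_manifold hopf_points_eq hopf_lift_def)
  fix \<gamma> :: "real \<Rightarrow> complex^'n^'n"
  assume \<gamma>: "continuous_on UNIV \<gamma>" "\<And>\<theta>. unitary_matrix (\<gamma> \<theta>)"
  obtain g where g: "continuous_on (UNIV \<times> - {0}) g" "\<And>\<theta> z. z \<noteq> 0 \<Longrightarrow> g (\<theta>, z) \<noteq> 0"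
    "\<And>\<theta> z. z \<noteq> 0 \<Longrightarrow> hopf_class d (g (\<theta>, z)) = \<rho> (\<gamma> \<theta>) (hopf_class d z)"
    using continuous_unitary_path_lift[OF n d \<rho> \<gamma>] by blast
  have slice: "continuous_on (- {0}) (\<lambda>z. h (\<theta>, z))"
    if "continuous_on (UNIV \<times> - {0}) h" for h :: "real \<times> (complex^'n) \<Rightarrow> complex^'n" and \<theta>
    by (rule continuous_on_compose2[OF that]) (auto intro!: continuous_intros)
  have "\<exists>M. \<forall>z. z \<noteq> 0 \<longrightarrow> g (\<theta>, z) = M *v z" for \<theta>
  proof -
    \<comment> \<open>The linearity lemma asks for a lift of the inverse transformation; the
      constant path at the adjoint supplies it.\<close>
    let ?B = "adjoint_matrix (\<gamma> \<theta>)"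
    have B: "unitary_matrix ?B" by (rule unitary_adjoint[OF \<gamma>(2)])
    obtain h :: "real \<times> (complex^'n) \<Rightarrow> complex^'n" where h: "continuous_on (UNIV \<times> - {0}) h" "\<And>\<phi> z. z \<noteq> 0 \<Longrightarrow> h (\<phi>, z) \<noteq> 0"
      "\<And>\<phi> z. z \<noteq> 0 \<Longrightarrow> hopf_class d (h (\<phi>, z)) = \<rho> ?B (hopf_class d z)"
      using continuous_unitary_path_lift[OF n d \<rho> continuous_on_const B] by blast
    have hol: "holomorphic_map (hopf_manifold d) (hopf_atlas d) (hopf_manifold d) (hopf_atlas d) (\<rho> (\<gamma> \<theta>))"
      using \<rho> \<gamma>(2) by (simp add: unitary_holomorphic_action_def biholomorphic_map_def unitary_group_simps)
    have "\<rho> ?B (\<rho> (\<gamma> \<theta>) x) = x" if "x \<in> hopf_points d" for x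
      using \<rho>_mult[OF B \<gamma>(2)[of \<theta>] that] \<gamma>(2)[of \<theta>] \<rho>_one[OF that] by (simp add: unitary_matrix_def)
    then obtain M where "\<And>z. z \<noteq> 0 \<Longrightarrow> g (\<theta>, z) = M *v z"
      using hopf_lift_linear[OF n d hol slice[OF g(1), of \<theta>] g(2) g(3) slice[OF h(1), of 0] h(2) h(3)] by blast
    then show ?thesis by blast
  qed
  then obtain M where M: "\<And>\<theta> z. z \<noteq> 0 \<Longrightarrow> g (\<theta>, z) = M \<theta> *v z" by metis
  \<comment> \<open>The columns of \<open>M \<theta>\<close> are values of the jointly continuous
    lift at the basis vectors, whence continuity in \<theta>.\<close>
  have "g (\<theta>, axis j 1) = M \<theta> *v axis j 1" for \<theta> j by (rule M) simp
  then have "M \<theta> = (\<chi> i j. g (\<theta>, axis j 1) $ i)" for \<theta>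
    by (simp add: vec_eq_iff mult_axis_nth)
  moreover have "continuous_on UNIV (\<lambda>\<theta>. \<chi> i j. g (\<theta>, axis j 1) $ i)"
  proof (intro continuous_on_vec_lambda continuous_on_component)
    fix j :: 'n
    show "continuous_on UNIV (\<lambda>\<theta>. g (\<theta>, axis j 1))"
      by (rule continuous_on_compose2[OF g(1)]) (auto intro!: continuous_intros)
  qed
  ultimately have "continuous_on UNIV M" by presburger
  moreover have "hopf_lift d (\<rho> (\<gamma> \<theta>)) (M \<theta>)" for \<theta>
  proof -
    have "\<forall>x. M \<theta> *v x = 0 \<longrightarrow> x = 0" using g(2) M by metis
    then have "invertible (M \<theta>)" using matrix_left_invertible_ker invertible_left_inverse by blast
    then show ?thesis using g(3) M by (simp add: hopf_lift_def)
  qed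
  ultimately show "\<exists>M. continuous_on UNIV M \<and> (\<forall>\<theta>. unitary_matrix (\<gamma> \<theta>) \<and> hopf_lift d (\<rho> (\<gamma> \<theta>)) (M \<theta>))"
    using \<gamma>(2) by blast
qed

section \<open>The two families in a uniform parametrisation\<close>

text \<open>Writing \<open>A = e\<^sup>i\<^sup>t B\<close>, both families take the form \<open>A[z] = [e\<^sup>b\<^sup>s C \<sigma>(A) C\<^sup>-\<^sup>1 z]\<close> with \<open>det A = e\<^sup>i\<^sup>s\<close>
  and \<open>\<sigma>\<close> the identity or complex conjugation: the factor \<open>e\<^sup>\<plusminus>\<^sup>i\<^sup>t\<close> is absorbed by \<open>\<sigma>(A)\<close>.\<close>

definition det_form :: "(complex^'n^'n \<Rightarrow> complex^'n^'n) \<Rightarrow> complex \<Rightarrow> complex \<Rightarrow> complex^'n^'n \<Rightarrow>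
   (complex^'n^'n \<Rightarrow> (complex^'n) set \<Rightarrow> (complex^'n) set) \<Rightarrow> bool" where
  "det_form \<sigma> d b C \<rho> \<longleftrightarrow>
     (\<forall>A t. unitary_matrix A \<longrightarrow> det A = cis t \<longrightarrow>
        (\<forall>z. z \<noteq> 0 \<longrightarrow> \<rho> A (hopf_class d z) =
           hopf_class d ((exp (b * of_real t) *\<^sub>m (C ** \<sigma> A ** matrix_inv C)) *v z)))"

text \<open>The general solution b of exp(2 \<pi> b) = \<open>d powi r\<close>; p counts the
  branches of the logarithm.\<close>

definition form_exponent :: "complex \<Rightarrow> int \<Rightarrow> int \<Rightarrow> complex" where
  "form_exponent d p r = \<i> * of_int p + of_int r * hopf_log d / (2 * of_real pi)"

definition conj_sign :: "(complex^'n^'n \<Rightarrow> complex^'n^'n) \<Rightarrow> int \<Rightarrow> bool" where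
  "conj_sign \<sigma> \<epsilon> \<longleftrightarrow> \<sigma> = id \<and> \<epsilon> = 1 \<or> \<sigma> = cnj_matrix \<and> \<epsilon> = -1"

lemma conj_sign_cis: "conj_sign \<sigma> \<epsilon> \<Longrightarrow> \<sigma> (cis t *\<^sub>m B) = cis (of_int \<epsilon> * t) *\<^sub>m \<sigma> B"
  by (auto simp: conj_sign_def vec_eq_iff cis_cnj)

lemma conj_sign_mult: "conj_sign \<sigma> \<epsilon> \<Longrightarrow> \<sigma> (A ** B) = \<sigma> A ** \<sigma> B"
  by (auto simp: conj_sign_def cnj_matrix_mult)

lemma conj_sign_unitary: "conj_sign \<sigma> \<epsilon> \<Longrightarrow> unitary_matrix A \<Longrightarrow> unitary_matrix (\<sigma> A)"
  by (auto simp: conj_sign_def unitary_cnj)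

lemma conj_sign_involution: "conj_sign \<sigma> \<epsilon> \<Longrightarrow> \<sigma> (\<sigma> A) = A"
  by (auto simp: conj_sign_def vec_eq_iff)

lemma conj_sign_one: "conj_sign \<sigma> \<epsilon> \<Longrightarrow> \<sigma> (mat 1) = mat 1"
  by (auto simp: conj_sign_def vec_eq_iff mat_def)

lemma exp_form_exponent:
  fixes x :: real
  assumes "d \<noteq> 0"
  shows "exp (form_exponent d p r * of_real x) = cis (of_int p * x) * real_power d (of_int r * x / (2 * pi))"
  by (simp add: real_power_exp[OF assms] form_exponent_def cis_conv_exp flip: exp_add)
    (simp add: algebra_simps)

lemma cscale_unitary: "norm c = 1 \<Longrightarrow> unitary_matrix A \<Longrightarrow> unitary_matrix (c *\<^sub>m A)"
  unfolding cscale_eq_diag by (intro unitary_mult unitary_diag_matrix)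

text \<open>The substitution is s = n t: det(\<open>cis t *\<^sub>m B\<close>) is cis(n t), and
  dividing A by cis(s / n) gives determinant 1. Each representation of A thus corresponds to one
  choice of logarithm of its determinant.\<close>

lemma det_form_iff:
  fixes C :: "complex^'n^'n"
  assumes d: "d \<noteq> 0" and \<sigma>: "conj_sign \<sigma> \<epsilon>"
  shows "det_form \<sigma> d (form_exponent d p r) C \<rho> \<longleftrightarrow>
     (\<forall>A\<in>carrier unitary_group. \<forall>t. \<forall>B\<in>special_unitary. A = map_matrix ((*) (cis t)) B \<longrightarrow>
        (\<forall>z. z \<noteq> 0 \<longrightarrow> \<rho> A (hopf_class d z) =
           hopf_class d ((cis ((of_int \<epsilon> + real_of_int p * CARD('n)) * t) *
              real_power d (CARD('n) * real_of_int r * t / (2 * pi))) *s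
              ((C ** \<sigma> B ** matrix_inv C) *v z))))" (is "?L \<longleftrightarrow> ?R")
proof -
  let ?n = "CARD('n)" and ?b = "form_exponent d p r"
  have eq: "(exp (?b * of_real (real ?n * t)) *\<^sub>m (C ** \<sigma> (cis t *\<^sub>m B) ** matrix_inv C)) *v z =
      (cis ((of_int \<epsilon> + real_of_int p * ?n) * t) * real_power d (?n * real_of_int r * t / (2 * pi))) *s
        ((C ** \<sigma> B ** matrix_inv C) *v z)" for t B z
  proof -
    have "(exp (?b * of_real (real ?n * t)) *\<^sub>m (C ** \<sigma> (cis t *\<^sub>m B) ** matrix_inv C)) *v z =
        (exp (?b * of_real (real ?n * t)) * cis (of_int \<epsilon> * t)) *s ((C ** \<sigma> B ** matrix_inv C) *v z)"
      by (simp add: conj_sign_cis[OF \<sigma>] cscale_mult_left cscale_mult_right cscale_cscale cscale_mult_vec)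
    moreover have "exp (?b * of_real (real ?n * t)) * cis (of_int \<epsilon> * t) =
        cis ((of_int \<epsilon> + real_of_int p * ?n) * t) * real_power d (?n * real_of_int r * t / (2 * pi))"
    proof -
      have "cis ((of_int \<epsilon> + real_of_int p * ?n) * t) = cis (of_int p * (real ?n * t)) * cis (of_int \<epsilon> * t)"
        by (simp add: cis_mult algebra_simps)
      then show ?thesis unfolding exp_form_exponent[OF d] by (simp add: mult_ac)
    qed
    ultimately show ?thesis by simp
  qed
  show ?thesis
  proof
    assume L: ?L
    show ?R
    proof (intro ballI allI impI)
      fix A :: "complex^'n^'n" and t B and z :: "complex^'n"
      assume "A \<in> carrier unitary_group" "B \<in> special_unitary" and A: "A = cis t *\<^sub>m B" and z: "z \<noteq> 0"
      then have uA: "unitary_matrix A" and "det B = 1" by (auto simp: unitary_group_simps special_unitary_def)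
      then have "det A = cis (real ?n * t)" by (simp add: A det_cscale Complex.DeMoivre)
      then show "\<rho> A (hopf_class d z) = hopf_class d ((cis ((of_int \<epsilon> + real_of_int p * ?n) * t) *
          real_power d (?n * real_of_int r * t / (2 * pi))) *s ((C ** \<sigma> B ** matrix_inv C) *v z))"
        using L uA z unfolding det_form_def eq[symmetric] A by blast
    qed
  next
    assume R: ?R
    show ?L
      unfolding det_form_def
    proof (intro allI impI)
      fix A :: "complex^'n^'n" and s and z :: "complex^'n"
      assume A: "unitary_matrix A" "det A = cis s" and z: "z \<noteq> 0"
      define t where "t = s / real ?n"
      define B where "B = cis (- t) *\<^sub>m A"
      have s: "s = real ?n * t" by (simp add: t_def)
      have AB: "A = cis t *\<^sub>m B" by (simp add: B_def cscale_cscale cis_mult)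
      have "det B = 1" by (simp add: B_def det_cscale Complex.DeMoivre A(2) cis_mult s)
      moreover have "unitary_matrix B" unfolding B_def by (rule cscale_unitary) (use A in auto)
      ultimately have "B \<in> special_unitary" by (simp add: special_unitary_def)
      then show "\<rho> A (hopf_class d z) = hopf_class d ((exp (?b * of_real s) *\<^sub>m (C ** \<sigma> A ** matrix_inv C)) *v z)"
        using R A(1) AB z unfolding s AB eq by (auto simp: unitary_group_simps)
    qed
  qed
qed

lemma hopf_form_I_iff:
  "d \<noteq> 0 \<Longrightarrow> hopf_form_I d p r C \<rho> \<longleftrightarrow> det_form id d (form_exponent d p r) C \<rho>"
  by (simp add: det_form_iff[of d id 1] conj_sign_def hopf_form_I_def)

lemma hopf_form_II_iff:
  "d \<noteq> 0 \<Longrightarrow> hopf_form_II d p r C \<rho> \<longleftrightarrow> det_form cnj_matrix d (form_exponent d p r) C \<rho>"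
  by (simp add: det_form_iff[of d cnj_matrix "-1"] conj_sign_def hopf_form_II_def)

section \<open>Effectiveness\<close>

lemma invertible_matrix_inv:
  fixes A :: "complex^'n^'n"
  assumes "invertible A" shows "invertible (matrix_inv A)"
  using invertible_inv_mult[OF assms] invertible_mult_inv[OF assms] unfolding invertible_def by blast

lemma hopf_lift_det_form:
  assumes "det_form \<sigma> d b C \<rho>" "conj_sign \<sigma> \<epsilon>" "invertible C" "unitary_matrix A" "det A = cis t"
  shows "hopf_lift d (\<rho> A) (exp (b * of_real t) *\<^sub>m (C ** \<sigma> A ** matrix_inv C))"
proof -
  have "invertible (matrix_inv C)" using assms(3) by (rule invertible_matrix_inv)
  then have "invertible (C ** \<sigma> A ** matrix_inv C)"
    using assms(3) unitary_invertible[OF conj_sign_unitary[OF assms(2,4)]] by (intro invertible_mult)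
  then show ?thesis
    using assms(1,4,5) by (simp add: hopf_lift_def det_form_def invertible_det_nz det_cscale)
qed

lemma hopf_lift_identity_iff:
  "hopf_lift d f (mat 1) \<longleftrightarrow> (\<forall>x\<in>hopf_points d. f x = x)"
  by (auto simp: hopf_lift_def hopf_points_eq invertible_det_nz)

text \<open>A matrix acting trivially has a scalar lift, so \<sigma>(A), and with it A, is scalar.
  It remains to test the scalars cis \<phi>, whose lifts are the displayed numbers.\<close>

lemma effective_det_form_cis:
  fixes C :: "complex^'n^'n"
  assumes n: "CARD('n) \<ge> 2" and d: "d \<noteq> 0" "norm d \<noteq> 1" and C: "invertible C" and \<sigma>: "conj_sign \<sigma> \<epsilon>"
    and form: "det_form \<sigma> d b C \<rho>"
  shows "effective_action unitary_group (topspace (hopf_manifold d)) \<rho> \<longleftrightarrow>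
    (\<forall>\<phi>. (\<exists>m::int. exp (b * of_real (real CARD('n) * \<phi>)) * cis (of_int \<epsilon> * \<phi>) = d powi m) \<longrightarrow> cis \<phi> = 1)"
proof -
  have scalar_conj: "C ** (c *\<^sub>m mat 1) ** matrix_inv C = c *\<^sub>m mat 1" for c
    by (simp add: cscale_mult_left cscale_mult_right invertible_mult_inv[OF C])
  let ?\<mu> = "\<lambda>\<phi>. exp (b * of_real (real CARD('n) * \<phi>)) * cis (of_int \<epsilon> * \<phi>)"
  have scalar_unitary: "unitary_matrix (cis \<phi> *\<^sub>m mat 1)" for \<phi>
    by (rule cscale_unitary) (simp_all add: unitary_mat_1)
  have scalar_lift: "hopf_lift d (\<rho> (cis \<phi> *\<^sub>m mat 1)) (?\<mu> \<phi> *\<^sub>m mat 1)" for \<phi>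
  proof -
    have "det (cis \<phi> *\<^sub>m mat 1 :: complex^'n^'n) = cis (real CARD('n) * \<phi>)"
      by (simp add: det_cscale Complex.DeMoivre)
    from hopf_lift_det_form[OF form \<sigma> C scalar_unitary this]
    show ?thesis
      by (simp add: conj_sign_cis[OF \<sigma>] conj_sign_one[OF \<sigma>] scalar_conj cscale_cscale)
  qed
  have scalar_trivial: "hopf_lift d (\<rho> (cis \<phi> *\<^sub>m mat 1)) (mat 1) \<longleftrightarrow> (\<exists>m::int. ?\<mu> \<phi> = d powi m)" for \<phi>
  proof
    assume "hopf_lift d (\<rho> (cis \<phi> *\<^sub>m mat 1)) (mat 1)"
    then obtain m :: int where "?\<mu> \<phi> *\<^sub>m mat 1 = (d powi m) *\<^sub>m (mat 1 :: complex^'n^'n)"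
      using hopf_lift_unique[OF n d _ scalar_lift] by blast
    then have "(?\<mu> \<phi> *\<^sub>m (mat 1 :: complex^'n^'n)) $ i $ i = ((d powi m) *\<^sub>m mat 1) $ i $ i" for i by simp
    then have "?\<mu> \<phi> = d powi m" by (simp add: mat_def)
    then show "\<exists>m::int. ?\<mu> \<phi> = d powi m" by blast
  next
    assume "\<exists>m::int. ?\<mu> \<phi> = d powi m"
    then obtain m :: int where "hopf_lift d (\<rho> (cis \<phi> *\<^sub>m mat 1)) ((d powi m) *\<^sub>m mat 1)"
      using scalar_lift[of \<phi>] by auto
    from hopf_lift_cscale[OF d(1) this, of "- m"]
    show "hopf_lift d (\<rho> (cis \<phi> *\<^sub>m mat 1)) (mat 1)" using d by (simp add: cscale_cscale power_int_minus)
  qed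
  have trivial_scalar: "\<exists>\<phi>. A = cis \<phi> *\<^sub>m mat 1"
    if A: "unitary_matrix A" and triv: "hopf_lift d (\<rho> A) (mat 1)" for A
  proof -
    have "cis (Arg (det A)) = det A"
      using norm_det_unitary[OF A] by (rule cis_Arg_norm_one)
    then obtain t where t: "det A = cis t" by metis
    obtain m :: int where "exp (b * of_real t) *\<^sub>m (C ** \<sigma> A ** matrix_inv C) = (d powi m) *\<^sub>m mat 1"
      using hopf_lift_unique[OF n d triv hopf_lift_det_form[OF form \<sigma> C A t]] by blast
    then have "matrix_inv C ** (exp (b * of_real t) *\<^sub>m (C ** \<sigma> A ** matrix_inv C)) ** C
        = matrix_inv C ** ((d powi m) *\<^sub>m mat 1) ** C" by simp
    moreover have "matrix_inv C ** (C ** \<sigma> A ** matrix_inv C) ** C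
        = (matrix_inv C ** C) ** \<sigma> A ** (matrix_inv C ** C)" by (simp only: matrix_mul_assoc)
    ultimately have e: "exp (b * of_real t) *\<^sub>m \<sigma> A = (d powi m) *\<^sub>m mat 1"
      by (simp add: cscale_mult_left cscale_mult_right invertible_inv_mult[OF C])
    define c where "c = exp (- (b * of_real t)) * d powi m"
    have "\<sigma> A = exp (- (b * of_real t)) *\<^sub>m (exp (b * of_real t) *\<^sub>m \<sigma> A)"
      by (simp add: cscale_cscale flip: exp_add)
    also have "\<dots> = c *\<^sub>m mat 1" unfolding e by (simp add: c_def cscale_cscale)
    finally have \<sigma>A: "\<sigma> A = c *\<^sub>m mat 1" .
    have "norm (det (\<sigma> A)) = 1" by (rule norm_det_unitary[OF conj_sign_unitary[OF \<sigma> A]])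
    then have "norm c ^ CARD('n) = 1" by (simp add: \<sigma>A det_cscale norm_power)
    then have "norm c = 1" using power_eq_imp_eq_base[of "norm c" "CARD('n)" 1] by simp
    then have "cis (Arg c) = c" by (rule cis_Arg_norm_one)
    then have "A = \<sigma> (cis (Arg c) *\<^sub>m mat 1)" using conj_sign_involution[OF \<sigma>, of A] \<sigma>A by simp
    then show ?thesis by (metis conj_sign_cis[OF \<sigma>] conj_sign_one[OF \<sigma>])
  qed
  have eff: "effective_action unitary_group (topspace (hopf_manifold d)) \<rho> \<longleftrightarrow>
      (\<forall>A. unitary_matrix A \<longrightarrow> hopf_lift d (\<rho> A) (mat 1) \<longrightarrow> A = mat 1)"
    by (auto simp: effective_action_def unitary_group_simps topspace_hopf_manifold hopf_lift_identity_iff)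
  have "(cis \<phi> *\<^sub>m mat 1 :: complex^'n^'n) = mat 1 \<longleftrightarrow> cis \<phi> = 1" for \<phi>
    by (auto simp: vec_eq_iff mat_def)
  then show ?thesis
    unfolding eff using trivial_scalar scalar_trivial scalar_unitary by metis
qed

text \<open>Taking norms separates the two conditions: |d| to the power x equals |d| to the power m
  only for x = m, and then \<open>real_power d x\<close> cancels against
  \<open>d powi m\<close>.\<close>

lemma scalar_cis_iff:
  fixes n r p \<epsilon> :: int
  assumes d: "d \<noteq> 0" "norm d \<noteq> 1"
  shows "(\<exists>m::int. exp (form_exponent d p r * of_real (of_int n * \<phi>)) * cis (of_int \<epsilon> * \<phi>) = d powi m) \<longleftrightarrow>
    (\<exists>m::int. of_int (n * r) * \<phi> = 2 * pi * of_int m \<and> cis (of_int (\<epsilon> + n * p) * \<phi>) = 1)"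
proof -
  define x where "x = of_int (n * r) * \<phi> / (2 * pi)"
  have e: "exp (form_exponent d p r * of_real (of_int n * \<phi>)) * cis (of_int \<epsilon> * \<phi>)
      = cis (of_int (\<epsilon> + n * p) * \<phi>) * real_power d x"
  proof -
    have "cis (of_int (\<epsilon> + n * p) * \<phi>) = cis (of_int p * (of_int n * \<phi>)) * cis (of_int \<epsilon> * \<phi>)"
      by (simp add: cis_mult algebra_simps)
    then show ?thesis unfolding exp_form_exponent[OF d(1)] by (simp add: x_def mult_ac)
  qed
  have rp: "real_power d (of_int m) = d powi m" for m :: int
    by (simp add: real_power_exp power_int_exp_hopf_log d)
  have "cis (of_int (\<epsilon> + n * p) * \<phi>) * real_power d x = d powi m \<longleftrightarrow>
      x = of_int m \<and> cis (of_int (\<epsilon> + n * p) * \<phi>) = 1" for m :: int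
  proof
    assume *: "cis (of_int (\<epsilon> + n * p) * \<phi>) * real_power d x = d powi m"
    then have "norm (cis (of_int (\<epsilon> + n * p) * \<phi>) * real_power d x) = norm (d powi m)" by simp
    then have "norm d powr x = norm d powr (of_int m)"
      using d by (simp add: norm_mult real_power_def norm_power_int powr_real_of_int')
    then have x: "x = of_int m" using d by (simp add: powr_inj)
    then show "x = of_int m \<and> cis (of_int (\<epsilon> + n * p) * \<phi>) = 1" using * d by (simp add: rp)
  qed (simp add: rp)
  then have "(\<exists>m::int. cis (of_int (\<epsilon> + n * p) * \<phi>) * real_power d x = d powi m) \<longleftrightarrow>
      (\<exists>m::int. x = of_int m \<and> cis (of_int (\<epsilon> + n * p) * \<phi>) = 1)" by simp
  moreover have "x = of_int m \<longleftrightarrow> of_int (n * r) * \<phi> = 2 * pi * of_int m" for m :: int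
    by (auto simp: x_def field_simps)
  ultimately show ?thesis unfolding e by simp
qed

text \<open>The angles in question are 2 \<pi> m / N with m an integer, and cis of K times such an
  angle is 1 exactly if N divides K m.\<close>

lemma cis_divisibility_iff:
  fixes N K :: int
  assumes N: "N \<noteq> 0"
  shows "(\<forall>\<phi>. (\<exists>m::int. of_int N * \<phi> = 2 * pi * of_int m \<and> cis (of_int K * \<phi>) = 1) \<longrightarrow> cis \<phi> = 1) \<longleftrightarrow>
    (\<forall>m. N dvd K * m \<longrightarrow> N dvd m)"
proof -
  have key: "cis (of_int K * \<phi>) = 1 \<longleftrightarrow> N dvd K * m" if "of_int N * \<phi> = 2 * pi * of_int m" for \<phi> K m
  proof -
    have \<phi>: "\<phi> = 2 * pi * of_int m / of_int N" using that N by (simp add: field_simps)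
    have "cis (of_int K * \<phi>) = 1 \<longleftrightarrow> (\<exists>j::int. of_int K * \<phi> = 2 * pi * of_int j)" by (rule cis_eq_one_iff)
    also have "\<dots> \<longleftrightarrow> (\<exists>j::int. real_of_int (K * m) = of_int (N * j))"
      unfolding \<phi> using N by (simp add: field_simps)
    also have "\<dots> \<longleftrightarrow> (\<exists>j. K * m = N * j)" by (simp only: of_int_eq_iff)
    finally show ?thesis by (simp add: dvd_def)
  qed
  have key1: "cis \<phi> = 1 \<longleftrightarrow> N dvd m" if "of_int N * \<phi> = 2 * pi * of_int m" for \<phi> m
    using key[OF that, of 1] by simp
  have ex: "\<exists>\<phi>. of_int N * \<phi> = 2 * pi * of_int m" for m :: int
    using N by (intro exI[of _ "2 * pi * of_int m / of_int N"]) simp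
  show ?thesis using key key1 ex by metis
qed

text \<open>Any m satisfying the premise on the left is a multiple n l, and cancelling n turns that
  premise into the one on the right. There, r divides both l(\<epsilon> + p n) and l p exactly if it
  divides l, because \<epsilon> is a unit.\<close>

lemma divisibility_criterion:
  fixes n r p \<epsilon> :: int
  assumes n: "n \<noteq> 0" and \<epsilon>: "\<epsilon> = 1 \<or> \<epsilon> = -1"
  shows "(\<forall>m. n * r dvd (\<epsilon> + n * p) * m \<longrightarrow> n * r dvd m) \<longleftrightarrow>
    \<not> (\<exists>l. r dvd l * (\<epsilon> + p * n) \<and> \<not> r dvd l * p)"
proof -
  have \<epsilon>2: "\<epsilon> * \<epsilon> = 1" using \<epsilon> by auto
  have sc: "n * r dvd (\<epsilon> + n * p) * (n * l) \<longleftrightarrow> r dvd l * (\<epsilon> + p * n)" for l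
    using n dvd_mult_cancel_left[of n r "l * (\<epsilon> + p * n)"] by (simp add: algebra_simps)
  show ?thesis
  proof
    assume L: "\<forall>m. n * r dvd (\<epsilon> + n * p) * m \<longrightarrow> n * r dvd m"
    have "r dvd l * p" if "r dvd l * (\<epsilon> + p * n)" for l
    proof -
      have "n * r dvd n * l" using L that sc by blast
      then show ?thesis using n by simp
    qed
    then show "\<not> (\<exists>l. r dvd l * (\<epsilon> + p * n) \<and> \<not> r dvd l * p)" by blast
  next
    assume R: "\<not> (\<exists>l. r dvd l * (\<epsilon> + p * n) \<and> \<not> r dvd l * p)"
    show "\<forall>m. n * r dvd (\<epsilon> + n * p) * m \<longrightarrow> n * r dvd m"
    proof (intro allI impI)
      fix m assume m: "n * r dvd (\<epsilon> + n * p) * m"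
      then have "n dvd (\<epsilon> + n * p) * m" by (rule dvd_mult_left)
      \<comment> \<open>Modulo n the factor \<epsilon> + n p is the unit \<epsilon>, so multiplying
        by \<epsilon> recovers m.\<close>
      then have "n dvd \<epsilon> * ((\<epsilon> + n * p) * m) - n * (\<epsilon> * p * m)" by simp
      also have "\<epsilon> * ((\<epsilon> + n * p) * m) - n * (\<epsilon> * p * m) = (\<epsilon> * \<epsilon>) * m" by (simp add: algebra_simps)
      finally obtain l where l: "m = n * l" using \<epsilon>2 by (auto elim: dvdE)
      have 1: "r dvd l * (\<epsilon> + p * n)" using m sc unfolding l by blast
      then have 2: "r dvd l * p" using R by blast
      have "r dvd l * (\<epsilon> + p * n) - (l * p) * n" by (rule dvd_diff[OF 1 dvd_mult2[OF 2]])
      moreover have "l * (\<epsilon> + p * n) - (l * p) * n = l * \<epsilon>" by (simp add: algebra_simps)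
      ultimately have "r dvd (l * \<epsilon>) * \<epsilon>" by simp
      then have "r dvd l" using \<epsilon>2 by (simp add: mult.assoc)
      then show "n * r dvd m" unfolding l by simp
    qed
  qed
qed

lemma effective_det_form_iff:
  fixes C :: "complex^'n^'n"
  assumes n: "CARD('n) \<ge> 2" and d: "d \<noteq> 0" "norm d \<noteq> 1" and C: "invertible C" and \<sigma>: "conj_sign \<sigma> \<epsilon>"
    and form: "det_form \<sigma> d (form_exponent d p r) C \<rho>" and r: "r \<noteq> 0"
  shows "effective_action unitary_group (topspace (hopf_manifold d)) \<rho> \<longleftrightarrow>
    \<not> (\<exists>l::int. r dvd l * (\<epsilon> + p * int CARD('n)) \<and> \<not> r dvd l * p)"
proof -
  have \<epsilon>: "\<epsilon> = 1 \<or> \<epsilon> = -1" using \<sigma> by (auto simp: conj_sign_def)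
  have N: "int CARD('n) * r \<noteq> 0" using n r by simp
  have nn: "real CARD('n) = of_int (int CARD('n))" by simp
  show ?thesis
    unfolding effective_det_form_cis[OF n d C \<sigma> form] nn scalar_cis_iff[OF d] cis_divisibility_iff[OF N]
    by (rule divisibility_criterion[OF _ \<epsilon>]) simp
qed

section \<open>Classification of effective transitive actions\<close>

lemma norm_unitary_mult_vec:
  fixes x :: "complex^'n"
  assumes U: "unitary_matrix U"
  shows "norm (U *v x) = norm x"
proof -
  have sq: "of_real ((norm y)\<^sup>2) = (\<Sum>i\<in>UNIV. y $ i * cnj (y $ i))" for y :: "complex^'n"
  proof -
    have "(norm y)\<^sup>2 = (\<Sum>i\<in>UNIV. (norm (y $ i))\<^sup>2)" by (simp add: norm_vec_def L2_set_def sum_nonneg)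
    then show ?thesis unfolding complex_norm_square[symmetric] by simp
  qed
  have UU: "(\<Sum>i\<in>UNIV. U $ i $ j * cnj (U $ i $ k)) = (if j = k then 1 else 0)" for j k
  proof -
    have "(adjoint_matrix U ** U) $ k $ j = mat 1 $ k $ j" using U by (simp add: unitary_matrix_def)
    then show ?thesis by (simp add: matrix_matrix_mult_def transpose_def mat_def mult.commute eq_commute)
  qed
  have "complex_of_real ((norm (U *v x))\<^sup>2)
      = (\<Sum>i\<in>UNIV. \<Sum>j\<in>UNIV. \<Sum>k\<in>UNIV. x $ j * cnj (x $ k) * (U $ i $ j * cnj (U $ i $ k)))"
    unfolding sq by (simp add: matrix_vector_mult_def cnj_sum sum_product mult_ac)
  also have "\<dots> = (\<Sum>j\<in>UNIV. \<Sum>i\<in>UNIV. \<Sum>k\<in>UNIV. x $ j * cnj (x $ k) * (U $ i $ j * cnj (U $ i $ k)))"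
    by (rule sum.swap)
  also have "\<dots> = (\<Sum>j\<in>UNIV. \<Sum>k\<in>UNIV. x $ j * cnj (x $ k) * (\<Sum>i\<in>UNIV. U $ i $ j * cnj (U $ i $ k)))"
    unfolding sum_distrib_left by (rule sum.cong[OF refl], rule sum.swap)
  also have "\<dots> = (\<Sum>j\<in>UNIV. x $ j * cnj (x $ j))"
    unfolding UU by (simp add: if_distrib[of "\<lambda>c. _ * c"] cong: if_cong)
  also have "\<dots> = complex_of_real ((norm x)\<^sup>2)" by (rule sq[symmetric])
  finally have "(norm (U *v x))\<^sup>2 = (norm x)\<^sup>2" by (simp only: of_real_eq_iff)
  then show ?thesis by (simp add: power2_eq_iff_nonneg)
qed

text \<open>For r = 0 the factor exp(b t) has norm 1, so in the basis C the norm is preserved up to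
  powers of |d|. A vector cannot then be moved to its multiple by the square root of |d|.\<close>

lemma det_form_exponent_zero_not_transitive:
  fixes C :: "complex^'n^'n"
  assumes d: "d \<noteq> 0" "norm d \<noteq> 1" and C: "invertible C" and \<sigma>: "conj_sign \<sigma> \<epsilon>"
    and form: "det_form \<sigma> d (form_exponent d p 0) C \<rho>"
  shows "\<not> transitive_action unitary_group (topspace (hopf_manifold d)) \<rho>"
proof
  assume tr: "transitive_action unitary_group (topspace (hopf_manifold d)) \<rho>"
  fix j :: 'n
  define e :: "complex^'n" where "e = axis j 1"
  \<comment> \<open>Half a power of |d|: an orbit relation would give 1 = 2 k for an integer
    k.\<close>
  define s where "s = complex_of_real (sqrt (norm d))"
  have s0: "s \<noteq> 0" using d by (simp add: s_def)
  have e0: "e \<noteq> 0" by (simp add: e_def)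
  have z: "C *v e \<noteq> 0" "s *s (C *v e) \<noteq> 0"
    using e0 s0 by (simp_all add: invertible_mult_vec_eq_0_iff[OF C])
  then obtain A where A: "unitary_matrix A" "\<rho> A (hopf_class d (C *v e)) = hopf_class d (s *s (C *v e))"
    using transitive_action.unique_orbit[OF tr, of "hopf_class d (C *v e)" "hopf_class d (s *s (C *v e))"]
    by (auto simp: topspace_hopf_manifold hopf_class_in_points_iff unitary_group_simps)
  have "cis (Arg (det A)) = det A"
    using norm_det_unitary[OF A(1)] by (rule cis_Arg_norm_one)
  then obtain t where t: "det A = cis t" by metis
  let ?b = "form_exponent d p 0"
  let ?M = "exp (?b * of_real t) *\<^sub>m (C ** \<sigma> A ** matrix_inv C)"
  have lift: "hopf_lift d (\<rho> A) ?M" by (rule hopf_lift_det_form[OF form \<sigma> C A(1) t])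
  have "?M *v (C *v e) \<noteq> 0" using lift z(1) by (simp add: hopf_lift_def invertible_mult_vec_eq_0_iff)
  moreover have "hopf_class d (?M *v (C *v e)) = hopf_class d (s *s (C *v e))"
    using lift A(2) z(1) by (simp add: hopf_lift_def)
  ultimately obtain k :: int where k: "s *s (C *v e) = (d powi k) *s (?M *v (C *v e))"
    using hopf_class_eq_iff[OF d(1)] z(2) by metis
  have "?M *v (C *v e) = exp (?b * of_real t) *s ((C ** \<sigma> A ** (matrix_inv C ** C)) *v e)"
    by (simp add: cscale_mult_vec cscale_mult_left matrix_vector_mul_assoc matrix_mul_assoc)
  then have M: "?M *v (C *v e) = exp (?b * of_real t) *s (C *v (\<sigma> A *v e))"
    by (simp add: invertible_inv_mult[OF C] matrix_vector_mul_assoc)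
  have "matrix_inv C *v (s *s (C *v e)) = matrix_inv C *v ((d powi k) *s (exp (?b * of_real t) *s (C *v (\<sigma> A *v e))))"
    using k unfolding M by simp
  then have "s *s e = (d powi k) *s (exp (?b * of_real t) *s (\<sigma> A *v e))"
    by (simp add: vec.scale matrix_vector_mul_assoc[of "matrix_inv C"] matrix_mul_assoc invertible_inv_mult[OF C])
  then have "norm (s *s e) = norm ((d powi k) *s (exp (?b * of_real t) *s (\<sigma> A *v e)))" by simp
  moreover have "norm (exp (?b * of_real t)) = 1" by (simp add: form_exponent_def)
  ultimately have "norm s = norm d powi k"
    using norm_unitary_mult_vec[OF conj_sign_unitary[OF \<sigma> A(1)], of e] e0
    by (simp add: norm_vec_smult norm_mult norm_power_int del: norm_exp_eq_Re)
  then have "sqrt (norm d) = norm d powi k" by (simp add: s_def)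
  then have "norm d = (norm d powi k) * (norm d powi k)" by (metis norm_ge_zero real_sqrt_mult_self abs_of_nonneg)
  moreover have "norm d powi (k + k) = norm d powi k * norm d powi k"
    by (rule power_int_add) (use d in simp)
  ultimately have "norm d powi 1 = norm d powi (k + k)" by (metis power_int_1_right)
  then have "1 = k + k" using d by (intro power_int_inj[of "norm d"]) auto
  then show False by presburger
qed

theorem effective_transitive_classification:
  fixes \<rho> :: "complex^'n^'n \<Rightarrow> (complex^'n) set \<Rightarrow> (complex^'n) set"
  assumes n: "CARD('n) \<ge> 2" and d: "d \<noteq> 0" "norm d \<noteq> 1"
    and \<rho>: "unitary_holomorphic_action (hopf_manifold d) (hopf_atlas d) \<rho>"
    and eff: "effective_action unitary_group (topspace (hopf_manifold d)) \<rho>"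
    and tr: "transitive_action unitary_group (topspace (hopf_manifold d)) \<rho>"
  shows "\<exists>p r C. r \<noteq> 0 \<and> invertible C \<and>
    (det_form id d (form_exponent d p r) C \<rho> \<or> det_form cnj_matrix d (form_exponent d p r) C \<rho>)"
proof -
  interpret lift_family d "\<lambda>A M. unitary_matrix A \<and> hopf_lift d (\<rho> A) M"
    by (rule unitary_action_lift_family[OF n d \<rho> eff])
  obtain b k \<sigma> C where \<sigma>: "\<sigma> = id \<or> \<sigma> = cnj_matrix" and b: "exp (2 * of_real pi * b :: complex) = d powi k"
    and C: "invertible C" and lift: "\<forall>A t. unitary_matrix A \<longrightarrow> det A = cis t \<longrightarrow>
       unitary_matrix A \<and> hopf_lift d (\<rho> A) (exp (b * of_real t) *\<^sub>m (C ** \<sigma> A ** matrix_inv C))"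
    using standard_form_up_to_conjugation by (elim exE conjE)
  \<comment> \<open>Equality of exponentials leaves a multiple of 2 \<pi> i; this multiple is p, and
    the winding exponent k plays the part of r.\<close>
  obtain p :: int where "2 * of_real pi * b = of_int k * hopf_log d + of_int (2 * p) * pi * \<i>"
    using b unfolding power_int_exp_hopf_log[OF d(1)] exp_eq by blast
  then have "b = form_exponent d p k" by (simp add: form_exponent_def field_simps)
  then have form: "det_form \<sigma> d (form_exponent d p k) C \<rho>"
    using lift unfolding det_form_def hopf_lift_def by blast
  obtain \<epsilon> where "conj_sign \<sigma> \<epsilon>" using \<sigma> by (auto simp: conj_sign_def)
  then have "k \<noteq> 0" using det_form_exponent_zero_not_transitive[OF d C] form tr by metis
  then show ?thesis using form \<sigma> C by blast
qed

section \<open>Construction of the actions\<close>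

text \<open>The choice of representative is immaterial since M is linear. The restriction makes the
  map extensional, as membership in \<open>Bij\<close> demands.\<close>

definition hopf_map :: "complex \<Rightarrow> complex^'n^'n \<Rightarrow> (complex^'n) set \<Rightarrow> (complex^'n) set" where
  "hopf_map d M = (\<lambda>x\<in>hopf_points d. hopf_class d (M *v (SOME z. z \<noteq> 0 \<and> hopf_class d z = x)))"

lemma hopf_map_class:
  assumes d: "d \<noteq> 0" and z: "z \<noteq> 0"
  shows "hopf_map d M (hopf_class d z) = hopf_class d (M *v z)"
proof -
  let ?w = "SOME w. w \<noteq> 0 \<and> hopf_class d w = hopf_class d z"
  have "?w \<noteq> 0 \<and> hopf_class d ?w = hopf_class d z"
    by (rule someI[of _ z]) (use z in simp)
  then obtain k :: int where "?w = (d powi k) *s z"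
    using hopf_class_eq_iff[OF d z, of ?w] by auto
  then have "hopf_class d (M *v ?w) = hopf_class d (M *v z)"
    by (simp add: vec.scale hopf_class_smult d)
  then show ?thesis using z by (simp add: hopf_map_def hopf_class_in_points_iff)
qed

lemma hopf_map_extensional: "hopf_map d M \<in> extensional (hopf_points d)"
  by (simp add: hopf_map_def)

lemma hopf_map_cscale: "d \<noteq> 0 \<Longrightarrow> hopf_map d ((d powi k) *\<^sub>m M) = hopf_map d M"
  by (simp add: hopf_map_def cscale_mult_vec hopf_class_smult)

lemma hopf_map_closed:
  assumes "d \<noteq> 0" "invertible M" "x \<in> hopf_points d" shows "hopf_map d M x \<in> hopf_points d"
  using assms by (auto simp: hopf_points_eq hopf_map_class invertible_mult_vec_eq_0_iff intro!: imageI)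

lemma hopf_map_mult:
  assumes "d \<noteq> 0" "invertible N" "x \<in> hopf_points d"
  shows "hopf_map d (M ** N) x = hopf_map d M (hopf_map d N x)"
  using assms by (auto simp: hopf_points_eq hopf_map_class invertible_mult_vec_eq_0_iff matrix_vector_mul_assoc)

lemma hopf_map_one: "d \<noteq> 0 \<Longrightarrow> x \<in> hopf_points d \<Longrightarrow> hopf_map d (mat 1) x = x"
  by (auto simp: hopf_points_eq hopf_map_class)

lemma hopf_map_Bij:
  assumes d: "d \<noteq> 0" and M: "invertible M"
  shows "hopf_map d M \<in> Bij (hopf_points d)"
proof -
  have iM: "invertible (matrix_inv M)" "M ** matrix_inv M = mat 1" "matrix_inv M ** M = mat 1"
    using M by (simp_all add: invertible_inv_mult invertible_mult_inv invertible_matrix_inv)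
  have "bij_betw (hopf_map d M) (hopf_points d) (hopf_points d)"
    by (rule bij_betw_byWitness[where f' = "hopf_map d (matrix_inv M)"])
      (auto simp: hopf_map_mult[OF d, symmetric] iM M hopf_map_one d hopf_map_closed)
  then show ?thesis by (simp add: Bij_def hopf_map_extensional)
qed

lemma matrix_mult_vec_has_derivative:
  fixes M :: "complex^'n^'n"
  shows "((\<lambda>z. M *v z) has_derivative (\<lambda>z. M *v z)) F"
proof (rule bounded_linear_imp_has_derivative, rule linear_conv_bounded_linear[THEN iffD1])
  show "linear ((*v) M)"
    by (rule linearI) (simp_all add: vec_eq_iff matrix_vector_mult_def scaleR_sum_right distrib_left sum.distrib)
qed

lemma hopf_map_holomorphic:
  fixes M :: "complex^'n^'n"
  assumes d: "d \<noteq> 0" and M: "invertible M"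
  shows "holomorphic_map (hopf_manifold d) (hopf_atlas d) (hopf_manifold d) (hopf_atlas d) (hopf_map d M)"
  unfolding holomorphic_map_def
proof
  let ?p = "hopf_class d :: complex^'n \<Rightarrow> _"
  have cM: "continuous_on S (\<lambda>z. M *v z)" for S
    by (rule has_derivative_continuous_on) (rule matrix_mult_vec_has_derivative)
  have "continuous_map (top_of_set (- {0})) (top_of_set (- {0})) (\<lambda>z. M *v z)"
    using cM by (auto simp: continuous_map_in_subtopology invertible_mult_vec_eq_0_iff[OF M])
  from continuous_map_compose[OF this quotient_imp_continuous_map[OF quotient_map_hopf_class[of d]]]
  have "continuous_map (top_of_set (- {0})) (hopf_manifold d) (hopf_map d M \<circ> ?p)"
    by (rule continuous_map_eq) (simp add: hopf_map_class d)
  then show "continuous_map (hopf_manifold d) (hopf_manifold d) (hopf_map d M)"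
    by (rule continuous_compose_quotient_map[OF quotient_map_hopf_class])
  have "(inv_into W' ?p \<circ> hopf_map d M \<circ> inv_into (?p ` W) (inv_into W ?p)) vec_holomorphic_on
      (inv_into W ?p ` {x \<in> ?p ` W. hopf_map d M x \<in> ?p ` W'})"
    if W: "open W" "0 \<notin> W" "inj_on ?p W" and W': "open W'" "0 \<notin> W'" "inj_on ?p W'" for W W'
    unfolding vec_holomorphic_on_def
  proof
    fix z assume "z \<in> inv_into W ?p ` {x \<in> ?p ` W. hopf_map d M x \<in> ?p ` W'}"
    then obtain y where y: "y \<in> W" "hopf_map d M (?p y) \<in> ?p ` W'" "z = inv_into W ?p (?p y)" by auto
    then have zy: "z = y" using W(3) by (simp add: inv_into_f_f)
    have "z \<noteq> 0" using y(1) zy W(2) by auto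
    obtain z' where z': "z' \<in> W'" "hopf_map d M (?p z) = ?p z'" using y(2) zy by auto
    then have "?p (M *v z) = ?p z'" using hopf_map_class[OF d \<open>z \<noteq> 0\<close>, of M] by simp
    moreover have "z' \<noteq> 0" "M *v z \<noteq> 0"
      using z' W'(2) \<open>z \<noteq> 0\<close> by (auto simp: invertible_mult_vec_eq_0_iff[OF M])
    ultimately obtain k :: int where k: "z' = (d powi k) *s (M *v z)"
      using hopf_class_eq_iff[OF d] by blast
    \<comment> \<open>The charts may pick representatives differing by a power of \<open>d\<close>;
      near z this power is constant, and the map in coordinates is linear.\<close>
    define N where "N = (d powi k) *\<^sub>m M"
    have N: "N *v w = (d powi k) *s (M *v w)" for w by (simp add: N_def cscale_mult_vec)
    let ?S = "W \<inter> (\<lambda>w. N *v w) -` W'"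
    have "open ((\<lambda>w. N *v w) -` W')"
      using W'(1) by (intro open_vimage)
        (auto intro!: has_derivative_continuous_on matrix_mult_vec_has_derivative)
    then have S: "open ?S" "z \<in> ?S" using W y(1) zy z'(1) k by (auto simp: N)
    have eq: "(inv_into W' ?p \<circ> hopf_map d M \<circ> inv_into (?p ` W) (inv_into W ?p)) w = N *v w"
      if w: "w \<in> ?S" for w
    proof -
      have "inv_into (?p ` W) (inv_into W ?p) (inv_into W ?p (?p w)) = ?p w"
        using w by (intro inv_into_f_f inj_on_inv_into) auto
      moreover have "inv_into W ?p (?p w) = w" using w W by (simp add: inv_into_f_f)
      moreover have "w \<noteq> 0" using w W(2) by auto
      then have "hopf_map d M (?p w) = ?p (N *v w)" by (simp add: hopf_map_class d N hopf_class_smult)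
      ultimately show ?thesis using w W'(3) by (simp add: inv_into_f_f)
    qed
    have "((inv_into W' ?p \<circ> hopf_map d M \<circ> inv_into (?p ` W) (inv_into W ?p)) has_derivative
            (\<lambda>w. N *v w)) (at z)"
      using matrix_mult_vec_has_derivative S by (rule has_derivative_transform_within_open) (rule eq[symmetric])
    then show "\<exists>f'. ((inv_into W' ?p \<circ> hopf_map d M \<circ> inv_into (?p ` W) (inv_into W ?p)) has_derivative f') (at z)
        \<and> Vector_Spaces.linear (*s) (*s) f'" using matrix_vector_mul_linear_gen by blast
  qed
  then show "\<forall>(V, \<phi>)\<in>hopf_atlas d. \<forall>(W, \<psi>)\<in>hopf_atlas d.
      (\<psi> \<circ> hopf_map d M \<circ> inv_into V \<phi>) vec_holomorphic_on (\<phi> ` {x\<in>V. hopf_map d M x \<in> W})"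
    by (auto simp: hopf_atlas_def)
qed

lemma hopf_map_biholomorphic:
  fixes M :: "complex^'n^'n"
  assumes d: "d \<noteq> 0" and M: "invertible M"
  shows "biholomorphic_map (hopf_manifold d) (hopf_atlas d) (hopf_manifold d) (hopf_atlas d) (hopf_map d M)"
proof -
  have iM: "invertible (matrix_inv M)" "M ** matrix_inv M = mat 1" "matrix_inv M ** M = mat 1"
    using M by (simp_all add: invertible_inv_mult invertible_mult_inv invertible_matrix_inv)
  have "\<forall>x\<in>hopf_points d. hopf_map d (matrix_inv M) (hopf_map d M x) = x"
    "\<forall>x\<in>hopf_points d. hopf_map d M (hopf_map d (matrix_inv M) x) = x"
    by (simp_all add: hopf_map_mult[OF d, symmetric] iM M hopf_map_one d)
  then show ?thesis
    unfolding biholomorphic_map_def topspace_hopf_manifold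
    using hopf_map_holomorphic[OF d M] hopf_map_holomorphic[OF d iM(1)] by blast
qed

lemma openin_hopf_class_image:
  assumes "d \<noteq> 0" "open Z" "0 \<notin> Z"
  shows "openin (hopf_manifold d) (hopf_class d ` Z)"
proof -
  have "open (- {0 :: complex^'b})" by auto
  then have "openin (top_of_set (- {0})) Z"
    using assms openin_open_eq[of "- {0}" Z] by auto
  then show ?thesis using open_map_hopf_class[OF assms(1)] by (auto simp: open_map_def)
qed

text \<open>\<open>Arg (det A)\<close> is neither additive nor continuous, but its jumps are full
  turns, which multiply the lift by a power of \<open>d\<close> and are invisible on the manifold.
  This yields the homomorphism property and, with a local branch, continuity.\<close>

lemma exists_det_form_action:
  fixes C :: "complex^'n^'n"
  assumes d: "d \<noteq> 0" and C: "invertible C" and \<sigma>: "conj_sign \<sigma> \<epsilon>"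
  obtains \<rho> where "unitary_holomorphic_action (hopf_manifold d) (hopf_atlas d) \<rho>"
    "det_form \<sigma> d (form_exponent d p r) C \<rho>"
proof -
  let ?b = "form_exponent d p r"
  define T where "T t A = exp (?b * of_real t) *\<^sub>m (C ** \<sigma> A ** matrix_inv C)" for t A
  define \<rho> where "\<rho> A = hopf_map d (T (Arg (det A)) A)" for A
  have iC: "C ** matrix_inv C = mat 1" "matrix_inv C ** C = mat 1" "invertible (matrix_inv C)"
    using C by (simp_all add: invertible_inv_mult invertible_mult_inv invertible_matrix_inv)
  have T_inv: "invertible (T t A)" if "unitary_matrix A" for t A
  proof -
    have "invertible (C ** \<sigma> A ** matrix_inv C)"
      using C iC(3) unitary_invertible[OF conj_sign_unitary[OF \<sigma> that]] by (intro invertible_mult)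
    then show ?thesis by (simp add: T_def invertible_det_nz det_cscale)
  qed
  have T_mult: "T t A ** T s B = T (t + s) (A ** B)" for t s A B
  proof -
    have "(C ** \<sigma> A ** matrix_inv C) ** (C ** \<sigma> B ** matrix_inv C)
        = C ** \<sigma> A ** (matrix_inv C ** C) ** \<sigma> B ** matrix_inv C" by (simp only: matrix_mul_assoc)
    then show ?thesis
      by (simp add: T_def cscale_mult_left cscale_mult_right cscale_cscale conj_sign_mult[OF \<sigma>] iC
          matrix_mul_assoc distrib_left exp_add mult.commute)
  qed
  have Arg_det: "cis (Arg (det A)) = det A" if "unitary_matrix A" for A :: "complex^'n^'n"
    using norm_det_unitary[OF that] by (rule cis_Arg_norm_one)
  have \<rho>_T: "\<rho> A = hopf_map d (T t A)" if A: "unitary_matrix A" "det A = cis t" for A t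
  proof -
    obtain m :: int where m: "Arg (det A) = t + 2 * pi * of_int m"
      using Arg_det[OF A(1)] A(2) cis_eq_cis_iff by metis
    have "exp (?b * of_real (2 * pi * of_int m)) = d powi (r * m)"
    proof -
      have "cis (of_int p * (2 * pi * of_int m)) = 1"
        unfolding cis_eq_one_iff by (rule exI[of _ "p * m"]) simp
      then show ?thesis
        unfolding exp_form_exponent[OF d] by (simp add: real_power_exp power_int_exp_hopf_log d mult_ac)
    qed
    then have "T (Arg (det A)) A = (d powi (r * m)) *\<^sub>m T t A"
      by (simp add: T_def m cscale_cscale distrib_left exp_add mult.commute)
    then show ?thesis by (simp add: \<rho>_def hopf_map_cscale d)
  qed
  have \<rho>_mult: "\<rho> (A ** B) x = \<rho> A (\<rho> B x)"
    if AB: "unitary_matrix A" "unitary_matrix B" and x: "x \<in> hopf_points d" for A B x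
  proof -
    have "det (A ** B) = cis (Arg (det A) + Arg (det B))"
      using Arg_det AB by (simp add: det_mul flip: cis_mult)
    then have "\<rho> (A ** B) = hopf_map d (T (Arg (det A)) A ** T (Arg (det B)) B)"
      unfolding T_mult by (rule \<rho>_T[OF unitary_mult[OF AB]])
    then show ?thesis by (simp add: hopf_map_mult[OF d T_inv[OF AB(2)] x] \<rho>_def)
  qed
  let ?X = "prod_topology (top_of_set (carrier unitary_group :: (complex^'n^'n) set)) (hopf_manifold d)"
  have "group_action unitary_group (hopf_points d) \<rho>"
    unfolding group_action_def group_hom_def group_hom_axioms_def hom_def
  proof (intro conjI CollectI ballI funcsetI)
    show "group unitary_group" by (rule group_unitary_group)
    show "group (BijGroup (hopf_points d :: (complex^'n) set set))" by (rule group_BijGroup)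
    show \<rho>_Bij: "\<rho> A \<in> carrier (BijGroup (hopf_points d))" if "A \<in> carrier unitary_group" for A
      using hopf_map_Bij[OF d T_inv] that by (simp add: \<rho>_def BijGroup_def unitary_group_simps)
    fix A B :: "complex^'n^'n"
    assume AB: "A \<in> carrier unitary_group" "B \<in> carrier unitary_group"
    then have u: "unitary_matrix A" "unitary_matrix B" by (simp_all add: unitary_group_simps)
    have "\<rho> (A ** B) = compose (hopf_points d) (\<rho> A) (\<rho> B)"
    proof (rule extensionalityI[of _ "hopf_points d"])
      show "\<rho> (A ** B) \<in> extensional (hopf_points d)" by (simp add: \<rho>_def hopf_map_extensional)
      show "compose (hopf_points d) (\<rho> A) (\<rho> B) \<in> extensional (hopf_points d)" by simp
      show "\<rho> (A ** B) x = compose (hopf_points d) (\<rho> A) (\<rho> B) x" if "x \<in> hopf_points d" for x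
        using that by (simp add: compose_eq \<rho>_mult[OF u])
    qed
    then show "\<rho> (A \<otimes>\<^bsub>unitary_group\<^esub> B) = \<rho> A \<otimes>\<^bsub>BijGroup (hopf_points d)\<^esub> \<rho> B"
      using \<rho>_Bij[OF AB(1)] \<rho>_Bij[OF AB(2)] by (simp add: BijGroup_def unitary_group_simps)
  qed
  moreover have "biholomorphic_map (hopf_manifold d) (hopf_atlas d) (hopf_manifold d) (hopf_atlas d) (\<rho> A)"
    if "A \<in> carrier unitary_group" for A
    using hopf_map_biholomorphic[OF d T_inv] that by (simp add: \<rho>_def unitary_group_simps)
  moreover have "continuous_map ?X
      (hopf_manifold d) (\<lambda>(A, x). \<rho> A x)"
    unfolding continuous_map_def
  proof (intro conjI allI impI)
    show "(\<lambda>(A, x). \<rho> A x) \<in> topspace ?X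
        \<rightarrow> topspace (hopf_manifold d)"
      using hopf_map_closed[OF d T_inv]
      by (auto simp: topspace_hopf_manifold \<rho>_def unitary_group_simps)
    fix V :: "(complex^'n) set set" assume V: "openin (hopf_manifold d) V"
    define Q where "Q = {z. z \<noteq> 0 \<and> hopf_class d z \<in> V}"
    have Q: "open Q" using V by (simp add: openin_hopf_manifold Q_def)
    let ?P = "{q \<in> topspace ?X. (case q of (A, x) \<Rightarrow> \<rho> A x) \<in> V}"
    show "openin ?X ?P"
      unfolding openin_prod_topology_alt
    proof (intro allI impI)
      fix A0 :: "complex^'n^'n" and x0
      assume "(A0, x0) \<in> ?P"
      then have A0: "unitary_matrix A0" and "x0 \<in> hopf_points d" and V0: "\<rho> A0 x0 \<in> V"
        by (auto simp: topspace_hopf_manifold unitary_group_simps)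
      then obtain z0 where z0: "z0 \<noteq> 0" "x0 = hopf_class d z0" by (auto simp: hopf_points_eq)
      have dA0: "det A0 \<noteq> 0" using norm_det_unitary[OF A0] by auto
      \<comment> \<open>A branch of the argument of det A adapted to A0: the principal argument is
        applied to a quotient equal to 1 at A0, far from its cut.\<close>
      define \<tau> where "\<tau> A = Arg (det A0) + Arg (det A / det A0)" for A :: "complex^'n^'n"
      have det_\<tau>: "det A = cis (\<tau> A)" if A: "unitary_matrix A" for A
      proof -
        have "norm (det A / det A0) = 1" using norm_det_unitary[OF A] norm_det_unitary[OF A0] by (simp add: norm_divide)
        then have "cis (Arg (det A / det A0)) = det A / det A0"
          by (rule cis_Arg_norm_one)
        then show ?thesis using Arg_det[OF A0] dA0 by (simp add: \<tau>_def flip: cis_mult)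
      qed
      define F where "F q = T (\<tau> (fst q)) (fst q) *v snd q" for q :: "(complex^'n^'n) \<times> (complex^'n)"
      \<comment> \<open>The open set of pairs for which the quotient avoids the cut of
        \<open>Arg\<close>, so that \<tau> is continuous there.\<close>
      define O1 where "O1 = {q :: (complex^'n^'n) \<times> (complex^'n). det (fst q) / det A0 \<notin> \<real>\<^sub>\<le>\<^sub>0}"
      have cdet: "continuous_on S (\<lambda>q :: (complex^'n^'n) \<times> (complex^'n). det (fst q) / det A0)" for S
        unfolding det_def by (intro continuous_intros) (use dA0 in \<open>simp add: det_def\<close>)
      have "open ((\<lambda>q :: (complex^'n^'n) \<times> (complex^'n). det (fst q) / det A0) -` (- \<real>\<^sub>\<le>\<^sub>0))"
        by (rule open_vimage) (auto intro: cdet)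
      then have O1: "open O1" by (simp add: O1_def vimage_def)
      have c\<tau>: "continuous_on O1 (\<lambda>q. \<tau> (fst q))"
        unfolding \<tau>_def
        by (intro continuous_intros continuous_on_compose2[OF continuous_on_Arg cdet]) (auto simp: O1_def)
      have c\<sigma>: "continuous_on O1 (\<lambda>q. \<sigma> (fst q))"
        using \<sigma> by (auto simp: conj_sign_def map_matrix_def intro!: continuous_intros)
      have cF: "continuous_on O1 F"
        unfolding F_def T_def map_matrix_def matrix_matrix_mult_def matrix_vector_mult_def
        by (intro continuous_intros c\<tau> c\<sigma>)
      have "F (A0, z0) \<in> Q"
      proof -
        have "\<rho> A0 x0 = hopf_class d (F (A0, z0))"
          by (simp add: \<rho>_T[OF A0 det_\<tau>[OF A0]] z0 hopf_map_class d F_def)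
        moreover have "F (A0, z0) \<noteq> 0"
          using z0 T_inv[OF A0] by (simp add: F_def invertible_mult_vec_eq_0_iff)
        ultimately show ?thesis using V0 by (simp add: Q_def)
      qed
      moreover have "(A0, z0) \<in> O1" using dA0 by (simp add: O1_def)
      ultimately have "open (O1 \<inter> F -` Q)" "(A0, z0) \<in> O1 \<inter> F -` Q"
        using continuous_open_preimage[OF cF O1 Q] by auto
      then obtain U Z where UZ: "open U" "open Z" "A0 \<in> U" "z0 \<in> Z" "U \<times> Z \<subseteq> O1 \<inter> F -` Q"
        by (rule open_prod_elim) auto
      let ?U = "carrier unitary_group \<inter> U" and ?Z = "hopf_class d ` (Z - {0})"
      have "openin (top_of_set (carrier unitary_group)) ?U" using UZ(1) by (rule openin_open_Int)
      moreover have "openin (hopf_manifold d) ?Z"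
        by (rule openin_hopf_class_image[OF d]) (use UZ(2) in \<open>auto intro: open_Diff\<close>)
      moreover have "A0 \<in> ?U" "x0 \<in> ?Z" using A0 UZ z0 by (auto simp: unitary_group_simps)
      moreover have "?U \<times> ?Z \<subseteq> ?P"
      proof
        fix q assume "q \<in> ?U \<times> ?Z"
        then obtain A z where q: "q = (A, hopf_class d z)" and A: "A \<in> carrier unitary_group" "A \<in> U"
          and z: "z \<in> Z" "z \<noteq> 0" by auto
        then have uA: "unitary_matrix A" by (simp add: unitary_group_simps)
        have "(A, z) \<in> U \<times> Z" using A z by simp
        then have "F (A, z) \<in> Q" using UZ(5) by auto
        then have "\<rho> A (hopf_class d z) \<in> V"
          using \<rho>_T[OF uA det_\<tau>[OF uA]] z by (simp add: hopf_map_class d F_def Q_def)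
        then show "q \<in> ?P"
          using A z unfolding q by (simp add: topspace_hopf_manifold hopf_class_in_points_iff)
      qed
      ultimately show "\<exists>U W. openin (top_of_set (carrier unitary_group)) U \<and> openin (hopf_manifold d) W \<and>
          A0 \<in> U \<and> x0 \<in> W \<and> U \<times> W \<subseteq> ?P"
        by blast
    qed
  qed
  ultimately have "unitary_holomorphic_action (hopf_manifold d) (hopf_atlas d) \<rho>"
    by (simp add: unitary_holomorphic_action_def topspace_hopf_manifold)
  moreover have "det_form \<sigma> d ?b C \<rho>"
    unfolding det_form_def using \<rho>_T by (simp add: hopf_map_class d T_def)
  ultimately show ?thesis using that by blast
qed

text \<open>Existence of an action for all parameters is part of the statement, so that the
  effectiveness criteria speak about actual actions.\<close>

theorem corollary1p6:
  fixes d :: complex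
  assumes n: "CARD('n::finite) \<ge> 2"
    and d: "d \<noteq> 0" "norm d \<noteq> 1"
  shows
    "(\<forall>\<rho> :: complex^'n^'n \<Rightarrow> (complex^'n) set \<Rightarrow> (complex^'n) set.
       unitary_holomorphic_action (hopf_manifold d) (hopf_atlas d) \<rho> \<and>
       effective_action unitary_group (topspace (hopf_manifold d)) \<rho> \<and>
       transitive_action unitary_group (topspace (hopf_manifold d)) \<rho> \<longrightarrow>
       (\<exists>(p::int) (r::int) (C::complex^'n^'n).
          r \<noteq> 0 \<and> invertible C \<and> (hopf_form_I d p r C \<rho> \<or> hopf_form_II d p r C \<rho>))) \<and>
     (\<forall>(p::int) (r::int) (C::complex^'n^'n). r \<noteq> 0 \<and> invertible C \<longrightarrow>
       (\<exists>\<rho>. unitary_holomorphic_action (hopf_manifold d) (hopf_atlas d) \<rho> \<and> hopf_form_I d p r C \<rho>) \<and>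
       (\<forall>\<rho>. unitary_holomorphic_action (hopf_manifold d) (hopf_atlas d) \<rho> \<and> hopf_form_I d p r C \<rho> \<longrightarrow>
          (effective_action unitary_group (topspace (hopf_manifold d)) \<rho> \<longleftrightarrow>
           \<not> (\<exists>l::int. r dvd l * (1 + p * int CARD('n)) \<and> \<not> r dvd l * p)))) \<and>
     (\<forall>(p::int) (r::int) (C::complex^'n^'n). r \<noteq> 0 \<and> invertible C \<longrightarrow>
       (\<exists>\<rho>. unitary_holomorphic_action (hopf_manifold d) (hopf_atlas d) \<rho> \<and> hopf_form_II d p r C \<rho>) \<and>
       (\<forall>\<rho>. unitary_holomorphic_action (hopf_manifold d) (hopf_atlas d) \<rho> \<and> hopf_form_II d p r C \<rho> \<longrightarrow>
          (effective_action unitary_group (topspace (hopf_manifold d)) \<rho> \<longleftrightarrow>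
           \<not> (\<exists>l::int. r dvd l * (- 1 + p * int CARD('n)) \<and> \<not> r dvd l * p))))"
proof -
  have \<sigma>: "conj_sign (id :: complex^'n^'n \<Rightarrow> _) 1" "conj_sign (cnj_matrix :: complex^'n^'n \<Rightarrow> _) (-1)"
    by (simp_all add: conj_sign_def)
  show ?thesis
    unfolding hopf_form_I_iff[OF d(1)] hopf_form_II_iff[OF d(1)]
  proof (intro conjI allI impI; (elim conjE)?)
    fix \<rho> :: "complex^'n^'n \<Rightarrow> (complex^'n) set \<Rightarrow> (complex^'n) set"
    assume "unitary_holomorphic_action (hopf_manifold d) (hopf_atlas d) \<rho>"
      "effective_action unitary_group (topspace (hopf_manifold d)) \<rho>"
      "transitive_action unitary_group (topspace (hopf_manifold d)) \<rho>"
    then show "\<exists>p r C. r \<noteq> 0 \<and> invertible C \<and>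
        (det_form id d (form_exponent d p r) C \<rho> \<or> det_form cnj_matrix d (form_exponent d p r) C \<rho>)"
      by (rule effective_transitive_classification[OF n d])
  next
    fix p r :: int and C :: "complex^'n^'n"
    assume r: "r \<noteq> 0" and C: "invertible C"
    show "\<exists>\<rho>. unitary_holomorphic_action (hopf_manifold d) (hopf_atlas d) \<rho> \<and> det_form id d (form_exponent d p r) C \<rho>"
      using exists_det_form_action[OF d(1) C \<sigma>(1)] by metis
    show "\<exists>\<rho>. unitary_holomorphic_action (hopf_manifold d) (hopf_atlas d) \<rho> \<and> det_form cnj_matrix d (form_exponent d p r) C \<rho>"
      using exists_det_form_action[OF d(1) C \<sigma>(2)] by metis
    fix \<rho>
    show "effective_action unitary_group (topspace (hopf_manifold d)) \<rho> \<longleftrightarrow>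
        \<not> (\<exists>l. r dvd l * (1 + p * int CARD('n)) \<and> \<not> r dvd l * p)"
      if "det_form id d (form_exponent d p r) C \<rho>"
      by (rule effective_det_form_iff[OF n d C \<sigma>(1) that r])
    show "effective_action unitary_group (topspace (hopf_manifold d)) \<rho> \<longleftrightarrow>
        \<not> (\<exists>l. r dvd l * (- 1 + p * int CARD('n)) \<and> \<not> r dvd l * p)"
      if "det_form cnj_matrix d (form_exponent d p r) C \<rho>"
      by (rule effective_det_form_iff[OF n d C \<sigma>(2) that r])
  qed
qed

end
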